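(* Let $G(n,p)$ be the Erdős–Rényi random graph on $n$ vertices with edge probability $p$, and let $T_{n,p}$ denote the number of triangles in $G(n,p)$. For each $p\in(0,1)$ and each $t\ge0$, $$\lim_{n\to\infty}\frac1{n^2}\log\mathbb{P}(T_{n,p}\ge tn^3)=-\phi(p,t).$$ Next, take any $p\in(0,1)$ and $t\in(p^3/6,1/6)$. Let $F^*_{p,t}$ be the set of minimizers of the variational problem defining $\phi(p,t)$, i.e. the set of $f\in\mathcal{W}$ with $T(f)\ge t$ and $I_p(f)=\phi(p,t)$, and let $\widetilde F^*_{p,t}$ be its image in $\widetilde{\mathcal{W}}$. Then $\widetilde F^*_{p,t}$ is a non-empty compact subset of $\widetilde{\mathcal{W}}$. Moreover, for each $\epsilon>0$ there exists a positive constant $C(\epsilon,p,t)$ depending only on $\epsilon$, $p$ and $t$ such that for any $n$, $$\mathbb{P}\big(\delta_\Box(G(n,p),\widetilde F^*_{p,t})\ge\epsilon\ \big|\ T_{n,p}\ge tn^3\big)\le e^{-C(\epsilon,p,t)n^2}.$$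
   Context: $\mathcal{W}$ is the set of measurable functions $f:[0,1]^2\to[0,1]$ with $f(x,y)=f(y,x)$. On $\mathcal{W}$ the cut distance is $d_\Box(f,g)=\sup_{S,T\subseteq[0,1]}\left|\int_{S\times T}[f(x,y)-g(x,y)]\,dx\,dy\right|$ (sup over measurable $S,T$). $\Sigma$ is the set of measure preserving bijections $\sigma:[0,1]\to[0,1]$, and $g_\sigma(x,y):=g(\sigma x,\sigma y)$. For $g\in\mathcal{W}$, $\widetilde g$ denotes the closure in $(\mathcal{W},d_\Box)$ of the orbit $\{g_\sigma:\sigma\in\Sigma\}$; the quotient space of all $\widetilde g$ is $\widetilde{\mathcal{W}}$, with metric $\delta_\Box(\widetilde f,\widetilde g)=\inf_{\sigma\in\Sigma}d_\Box(f,g_\sigma)$. For a set $\widetilde A\subseteq\widetilde{\mathcal{W}}$, $\delta_\Box(\widetilde g,\widetilde A):=\inf_{\widetilde h\in\widetilde A}\delta_\Box(\widetilde g,\widetilde h)$. For a finite simple graph $G$ on $\{1,\dots,n\}$, $f^G\in\mathcal{W}$ is defined by $f^G(x,y)=1$ if $(\lceil nx\rceil,\lceil ny\rceil)$ is an edge of $G$ and $0$ otherwise; $G$ is identified with the element $\widetilde{f^G}$ of $\widetilde{\mathcal{W}}$. $G(n,p)$ is the random graph on $n$ vertices in which each edge is present independently with probability $p$. For $u\in[0,1]$, $I_p(u)=\frac12u\log\frac up+\frac12(1-u)\log\frac{1-u}{1-p}$ (with $0\log0=0$), and for $f\in\mathcal{W}$, $I_p(f)=\int_0^1\int_0^1I_p(f(x,y))\,dx\,dy$.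 For $f\in\mathcal{W}$, $T(f)=\frac16\int_0^1\int_0^1\int_0^1f(x,y)f(y,z)f(z,x)\,dx\,dy\,dz$. For $t\in[0,1/6)$, $\phi(p,t):=\inf\{I_p(f):f\in\mathcal{W},\ T(f)\ge t\}$; for $t\ge1/6$, $\phi(p,t):=\infty$. By convention $\log0=-\infty$.
   Formalization: The final bound is stated for all sufficiently large n (threshold depending on ε, p, t) instead of for any n; the literal claim fails, e.g. p=1/10, t=1/27, n=3, where the condition forces the complete graph, which is not a minimizer, so for small ε the conditional probability is 1. *)

theory Defs
  imports "HOL-Probability.Probability"
begin

section \<open>The space of graphons and the cut distance\<close>

definition unit_measure :: "real measure" where
  "unit_measure = restrict_space lborel {0..1}"

abbreviation square_measure :: "(real \<times> real) measure" where
  "square_measure \<equiv> unit_measure \<Otimes>\<^sub>M unit_measure"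

text \<open>
  Elements of this space are genuine functions with domain \<open>[0,1]\<^sup>2\<close>: outside the square they
  take the fixed value \<^const>\<open>undefined\<close>. Measurability is Borel measurability.
\<close>

definition graphons :: "(real \<times> real \<Rightarrow> real) set" where
  "graphons = {f \<in> ({0..1} \<times> {0..1}) \<rightarrow>\<^sub>E {0..1}.
      f \<in> borel_measurable square_measure \<and> (\<forall>x\<in>{0..1}. \<forall>y\<in>{0..1}. f (x, y) = f (y, x))}"

definition cut_dist :: "(real \<times> real \<Rightarrow> real) \<Rightarrow> (real \<times> real \<Rightarrow> real) \<Rightarrow> real" where
  "cut_dist f g = (SUP (S, T) \<in> sets unit_measure \<times> sets unit_measure.
      \<bar>LINT z : S \<times> T | square_measure. f z - g z\<bar>)"

text \<open>
  For a Borel bijection of \<open>[0,1]\<close>, measurability of the inverse is automatic (Lusin--Souslin);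
  it is listed so that the maps visibly form a group.
\<close>

definition mp_bijections :: "(real \<Rightarrow> real) set" where
  "mp_bijections = {\<sigma>. bij_betw \<sigma> {0..1} {0..1} \<and>
      \<sigma> \<in> measurable unit_measure unit_measure \<and>
      inv_into {0..1} \<sigma> \<in> measurable unit_measure unit_measure \<and>
      distr unit_measure unit_measure \<sigma> = unit_measure}"

definition relabel :: "(real \<Rightarrow> real) \<Rightarrow> (real \<times> real \<Rightarrow> real) \<Rightarrow> real \<times> real \<Rightarrow> real" where
  "relabel \<sigma> g = restrict (\<lambda>(x, y). g (\<sigma> x, \<sigma> y)) ({0..1} \<times> {0..1})"

text \<open>
  The closure of the orbit of \<open>g\<close>. Since \<^const>\<open>cut_dist\<close> is only a pseudometric on
  \<^const>\<open>graphons\<close>, the closure is written out.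
\<close>

definition graphon_class :: "(real \<times> real \<Rightarrow> real) \<Rightarrow> (real \<times> real \<Rightarrow> real) set" where
  "graphon_class g =
      {h \<in> graphons. \<forall>e>0. \<exists>\<sigma>\<in>mp_bijections. cut_dist h (relabel \<sigma> g) < e}"

definition graphon_quotient :: "(real \<times> real \<Rightarrow> real) set set" where
  "graphon_quotient = graphon_class ` graphons"

definition class_rep :: "(real \<times> real \<Rightarrow> real) set \<Rightarrow> real \<times> real \<Rightarrow> real" where
  "class_rep F = (SOME f. f \<in> graphons \<and> graphon_class f = F)"

text \<open>
  The choice of representatives is immaterial (\<open>cut_metric_class\<close> below). The value \<open>0\<close> off
  \<^const>\<open>graphon_quotient\<close> is a dummy, needed because the locale \<^locale>\<open>Metric_space\<close> asks
  for symmetry and nonnegativity on the whole type (\<open>Metric_space_cut_metric\<close> below).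
\<close>

definition cut_metric ::
  "(real \<times> real \<Rightarrow> real) set \<Rightarrow> (real \<times> real \<Rightarrow> real) set \<Rightarrow> real" where
  "cut_metric F G = (if F \<in> graphon_quotient \<and> G \<in> graphon_quotient
      then INF \<sigma>\<in>mp_bijections. cut_dist (class_rep F) (relabel \<sigma> (class_rep G)) else 0)"

text \<open>An infimum of reals; it is the distance to a set only for nonempty \<open>A\<close>.\<close>

definition cut_metric_set ::
  "(real \<times> real \<Rightarrow> real) set \<Rightarrow> (real \<times> real \<Rightarrow> real) set set \<Rightarrow> real" where
  "cut_metric_set F A = (INF H\<in>A. cut_metric F H)"


section \<open>Random graphs\<close>

text \<open>A simple graph on the vertex set \<open>{1..n}\<close> is given by its set of edges.\<close>

definition vertex_pairs :: "nat \<Rightarrow> nat set set" where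
  "vertex_pairs n = {e. e \<subseteq> {1..n} \<and> card e = 2}"

definition erdos_renyi :: "nat \<Rightarrow> real \<Rightarrow> nat set set pmf" where
  "erdos_renyi n p = map_pmf (\<lambda>\<omega>. {e \<in> vertex_pairs n. \<omega> e})
      (Pi_pmf (vertex_pairs n) False (\<lambda>_. bernoulli_pmf p))"

definition triangles :: "nat \<Rightarrow> nat set set \<Rightarrow> nat" where
  "triangles n E = card {A. A \<subseteq> {1..n} \<and> card A = 3 \<and> (\<forall>e. e \<subseteq> A \<and> card e = 2 \<longrightarrow> e \<in> E)}"

text \<open>
  For \<open>x = 0\<close> the ceiling is \<open>0\<close>, which is not a vertex; on the diagonal blocks the set is a
  singleton. Neither is an edge, so the value there is \<open>0\<close>.
\<close>

definition graph_graphon :: "nat \<Rightarrow> nat set set \<Rightarrow> real \<times> real \<Rightarrow> real" where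
  "graph_graphon n E = restrict
      (\<lambda>(x, y). if {nat \<lceil>real n * x\<rceil>, nat \<lceil>real n * y\<rceil>} \<in> E then 1 else 0) ({0..1} \<times> {0..1})"


section \<open>The variational problem\<close>

text \<open>The library has \<open>ln 0 = 0\<close>, which gives the convention \<open>0 log 0 = 0\<close>.\<close>

definition rate :: "real \<Rightarrow> real \<Rightarrow> real" where
  "rate p u = 1/2 * u * ln (u / p) + 1/2 * (1 - u) * ln ((1 - u) / (1 - p))"

definition graphon_rate :: "real \<Rightarrow> (real \<times> real \<Rightarrow> real) \<Rightarrow> real" where
  "graphon_rate p f = (LINT x|unit_measure. LINT y|unit_measure. rate p (f (x, y)))"

definition triangle_density :: "(real \<times> real \<Rightarrow> real) \<Rightarrow> real" where
  "triangle_density f = 1/6 * (LINT x|unit_measure. LINT y|unit_measure. LINT z|unit_measure.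
      f (x, y) * f (y, z) * f (z, x))"

definition phi :: "real \<Rightarrow> real \<Rightarrow> ereal" where
  "phi p t = (if t < 1/6
      then INF f\<in>{f \<in> graphons. triangle_density f \<ge> t}. ereal (graphon_rate p f) else \<infinity>)"

definition minimizers :: "real \<Rightarrow> real \<Rightarrow> (real \<times> real \<Rightarrow> real) set" where
  "minimizers p t = {f \<in> graphons. triangle_density f \<ge> t \<and> ereal (graphon_rate p f) = phi p t}"

definition minimizer_classes :: "real \<Rightarrow> real \<Rightarrow> (real \<times> real \<Rightarrow> real) set set" where
  "minimizer_classes p t = graphon_class ` minimizers p t"

definition log_ereal :: "real \<Rightarrow> ereal" where
  "log_ereal x = (if x = 0 then -\<infinity> else ereal (ln x))"


section \<open>The cut metric is well defined\<close>

lemma space_unit [simp]: "space unit_measure = {0..1}"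
  by (simp add: unit_measure_def space_restrict_space)

interpretation unit_measure: prob_space unit_measure
  by (rule prob_spaceI) (simp add: unit_measure_def emeasure_restrict_space space_restrict_space)

interpretation square_measure: pair_prob_space unit_measure unit_measure ..

lemma space_square: "space square_measure = {0..1} \<times> {0..1}"
  by (simp add: space_pair_measure)

lemma id_mp: "(\<lambda>x. x) \<in> mp_bijections"
proof -
  have "inv_into {0..1} (\<lambda>x. x) \<in> measurable unit_measure unit_measure"
    by (subst measurable_cong[where g = "\<lambda>x. x"]) (auto intro: inv_into_f_f[where f="\<lambda>x. x", simplified])
  then show ?thesis
    unfolding mp_bijections_def by (simp add: bij_betw_def distr_id)
qed

lemma inv_mp:
  assumes "\<sigma> \<in> mp_bijections"
  shows "inv_into {0..1} \<sigma> \<in> mp_bijections"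
proof -
  let ?I = "{0..1::real}" and ?\<tau> = "inv_into {0..1} \<sigma>"
  have b: "bij_betw \<sigma> ?I ?I" and m: "\<sigma> \<in> measurable unit_measure unit_measure"
    and im: "?\<tau> \<in> measurable unit_measure unit_measure"
    and d: "distr unit_measure unit_measure \<sigma> = unit_measure"
    using assms by (auto simp: mp_bijections_def)
  have bt: "bij_betw ?\<tau> ?I ?I" using b by (rule bij_betw_inv_into)
  have "inv_into ?I ?\<tau> x = \<sigma> x" if "x \<in> ?I" for x
    using that b by (rule inv_into_inv_into_eq[rotated])
  then have "inv_into ?I ?\<tau> \<in> measurable unit_measure unit_measure"
    by (subst measurable_cong[where g = \<sigma>]) (auto simp: m)
  moreover have "distr unit_measure unit_measure ?\<tau> = unit_measure"
  proof -
    have "distr unit_measure unit_measure ?\<tau>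
        = distr (distr unit_measure unit_measure \<sigma>) unit_measure ?\<tau>" by (simp add: d)
    also have "\<dots> = distr unit_measure unit_measure (?\<tau> \<circ> \<sigma>)"
      using im m by (rule distr_distr)
    also have "\<dots> = distr unit_measure unit_measure (\<lambda>x. x)"
      by (rule distr_cong) (use b in \<open>auto simp: bij_betw_def\<close>)
    finally show ?thesis by (simp add: distr_id)
  qed
  ultimately show ?thesis using bt im by (simp add: mp_bijections_def)
qed

lemma comp_mp:
  assumes "\<sigma> \<in> mp_bijections" "\<tau> \<in> mp_bijections"
  shows "\<sigma> \<circ> \<tau> \<in> mp_bijections"
proof -
  let ?I = "{0..1::real}" and ?M = unit_measure
  have b: "bij_betw \<sigma> ?I ?I" "bij_betw \<tau> ?I ?I"
    and m: "\<sigma> \<in> measurable ?M ?M" "\<tau> \<in> measurable ?M ?M"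
    and im: "inv_into ?I \<sigma> \<in> measurable ?M ?M" "inv_into ?I \<tau> \<in> measurable ?M ?M"
    and d: "distr ?M ?M \<sigma> = ?M" "distr ?M ?M \<tau> = ?M"
    using assms by (auto simp: mp_bijections_def)
  have bc: "bij_betw (\<sigma> \<circ> \<tau>) ?I ?I" using b(2,1) by (rule bij_betw_trans)
  have "inv_into ?I (\<sigma> \<circ> \<tau>) x = (inv_into ?I \<tau> \<circ> inv_into ?I \<sigma>) x" if "x \<in> ?I" for x
    using that b inv_into_comp[of \<sigma> \<tau> ?I x] by (simp add: bij_betw_def)
  then have "inv_into ?I (\<sigma> \<circ> \<tau>) \<in> measurable ?M ?M"
    by (subst measurable_cong[where g = "inv_into ?I \<tau> \<circ> inv_into ?I \<sigma>"])
       (auto intro: measurable_comp im)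
  moreover have "distr ?M ?M (\<sigma> \<circ> \<tau>) = ?M"
    using distr_distr[OF m] d by simp
  ultimately show ?thesis using bc measurable_comp[OF m(2,1)] by (simp add: mp_bijections_def)
qed

lemma mp_in: "\<sigma> \<in> mp_bijections \<Longrightarrow> x \<in> {0..1} \<Longrightarrow> \<sigma> x \<in> {0..1}"
  unfolding mp_bijections_def by (auto simp del: atLeastAtMost_iff dest: bij_betwE)

lemma graphonD:
  assumes "f \<in> graphons"
  shows "f \<in> borel_measurable square_measure"
    and "\<And>x y. x \<in> {0..1} \<Longrightarrow> y \<in> {0..1} \<Longrightarrow> f (x, y) \<in> {0..1}"
    and "\<And>x y. x \<in> {0..1} \<Longrightarrow> y \<in> {0..1} \<Longrightarrow> f (x, y) = f (y, x)"
    and "f \<in> extensional ({0..1} \<times> {0..1})"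
  using assms unfolding graphons_def PiE_def Pi_def by (blast | simp)+

lemma measurable_mp_pair:
  assumes "\<sigma> \<in> mp_bijections"
  shows "(\<lambda>(x, y). (\<sigma> x, \<sigma> y)) \<in> measurable square_measure square_measure"
proof -
  have "\<sigma> \<in> measurable unit_measure unit_measure" using assms by (simp add: mp_bijections_def)
  then show ?thesis by measurable
qed

lemma distr_mp_pair:
  assumes "\<sigma> \<in> mp_bijections"
  shows "distr square_measure square_measure (\<lambda>(x, y). (\<sigma> x, \<sigma> y)) = square_measure"
proof -
  have m: "\<sigma> \<in> measurable unit_measure unit_measure"
    and d: "distr unit_measure unit_measure \<sigma> = unit_measure"
    using assms by (auto simp: mp_bijections_def)
  have "sigma_finite_measure (distr unit_measure unit_measure \<sigma>)"
    by (simp add: d unit_measure.sigma_finite_measure_axioms)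
  from pair_measure_distr[OF m m this] show ?thesis by (simp add: d)
qed

lemma relabel_graphon:
  assumes "\<sigma> \<in> mp_bijections" "f \<in> graphons"
  shows "relabel \<sigma> f \<in> graphons"
proof -
  note f = graphonD[OF assms(2)]
  have "(\<lambda>z. f (case z of (x, y) \<Rightarrow> (\<sigma> x, \<sigma> y))) \<in> borel_measurable square_measure"
    using measurable_comp[OF measurable_mp_pair[OF assms(1)] f(1)] by (simp add: comp_def)
  then have "relabel \<sigma> f \<in> borel_measurable square_measure"
    by (rule measurable_cong[THEN iffD1, rotated])
       (auto simp: relabel_def space_square simp del: atLeastAtMost_iff)
  then show ?thesis
    using f mp_in[OF assms(1)]
    by (auto simp: graphons_def relabel_def PiE_def Pi_def simp del: atLeastAtMost_iff)
qed

lemma relabel_comp: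
  assumes "\<sigma> \<in> mp_bijections" "\<tau> \<in> mp_bijections"
  shows "relabel \<tau> (relabel \<sigma> f) = relabel (\<sigma> \<circ> \<tau>) f"
  using mp_in[OF assms(2)] by (auto simp: relabel_def fun_eq_iff simp del: atLeastAtMost_iff)

lemma relabel_id: "f \<in> graphons \<Longrightarrow> relabel (\<lambda>x. x) f = f"
  using graphonD(4)[of f] by (auto simp: relabel_def fun_eq_iff extensional_def)

lemma relabel_cancel:
  assumes "\<sigma> \<in> mp_bijections" "f \<in> graphons"
  shows "relabel (inv_into {0..1} \<sigma>) (relabel \<sigma> f) = f"
proof -
  have "\<sigma> (inv_into {0..1} \<sigma> x) = x" if "x \<in> {0..1}" for x
    using that assms(1) f_inv_into_f[of x \<sigma> "{0..1}"]
    by (simp add: mp_bijections_def bij_betw_def del: atLeastAtMost_iff)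
  then have "relabel (\<sigma> \<circ> inv_into {0..1} \<sigma>) f = relabel (\<lambda>x. x) f"
    by (auto simp: relabel_def fun_eq_iff simp del: atLeastAtMost_iff)
  then show ?thesis
    using relabel_comp[OF assms(1) inv_mp[OF assms(1)]] relabel_id[OF assms(2)] by simp
qed

lemma graphon_integrable:
  assumes "f \<in> graphons" "A \<in> sets square_measure"
  shows "set_integrable square_measure A f"
  unfolding set_integrable_def
proof (rule square_measure.P.integrable_const_bound[where B = 1])
  show "AE z in square_measure. norm (indicat_real A z *\<^sub>R f z) \<le> 1"
  proof (rule AE_I2)
    fix z assume "z \<in> space square_measure"
    then have "f z \<in> {0..1}" using graphonD(2)[OF assms(1)] by (auto simp: space_square)
    then show "norm (indicat_real A z *\<^sub>R f z) \<le> 1" by (auto simp: indicator_def)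
  qed
  show "(\<lambda>z. indicat_real A z *\<^sub>R f z) \<in> borel_measurable square_measure"
    using graphonD(1)[OF assms(1)] assms(2) by measurable
qed

lemma cut_term_bound:
  assumes "f \<in> graphons" "g \<in> graphons" "A \<in> sets square_measure"
  shows "\<bar>LINT z : A | square_measure. f z - g z\<bar> \<le> 1"
proof -
  have *: "0 \<le> (LINT z : A | square_measure. h z)" "(LINT z : A | square_measure. h z) \<le> 1"
    if h: "h \<in> graphons" for h
  proof -
    have int: "integrable square_measure (\<lambda>z. indicat_real A z *\<^sub>R h z)"
      using graphon_integrable[OF h assms(3)] by (simp add: set_integrable_def)
    have b: "h z \<in> {0..1}" if "z \<in> space square_measure" for z
      using that graphonD(2)[OF h] by (auto simp: space_square)
    have "AE z in square_measure. 0 \<le> indicat_real A z *\<^sub>R h z"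
      by (rule AE_I2) (use b in \<open>auto simp: indicator_def\<close>)
    with int show "0 \<le> (LINT z : A | square_measure. h z)"
      unfolding set_lebesgue_integral_def by (rule square_measure.P.integral_ge_const)
    have "AE z in square_measure. indicat_real A z *\<^sub>R h z \<le> 1"
      by (rule AE_I2) (use b in \<open>auto simp: indicator_def\<close>)
    with int show "(LINT z : A | square_measure. h z) \<le> 1"
      unfolding set_lebesgue_integral_def by (rule square_measure.P.integral_le_const)
  qed
  have "(LINT z : A | square_measure. f z - g z)
      = (LINT z : A | square_measure. f z) - (LINT z : A | square_measure. g z)"
    by (intro set_integral_diff(2) graphon_integrable assms)
  then show ?thesis using *[OF assms(1)] *[OF assms(2)] by linarith
qed

lemma cut_dist_upper:
  assumes "f \<in> graphons" "g \<in> graphons" "S \<in> sets unit_measure" "T \<in> sets unit_measure"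
  shows "\<bar>LINT z : S \<times> T | square_measure. f z - g z\<bar> \<le> cut_dist f g"
proof -
  have "bdd_above ((\<lambda>(S, T). \<bar>LINT z : S \<times> T | square_measure. f z - g z\<bar>)
      ` (sets unit_measure \<times> sets unit_measure))"
    by (rule bdd_aboveI2[where M = 1]) (auto intro!: cut_term_bound assms)
  from cSUP_upper[OF _ this, of "(S, T)"] show ?thesis
    using assms by (simp add: cut_dist_def)
qed

lemma cut_dist_least:
  assumes "\<And>S T. S \<in> sets unit_measure \<Longrightarrow> T \<in> sets unit_measure \<Longrightarrow>
      \<bar>LINT z : S \<times> T | square_measure. f z - g z\<bar> \<le> c"
  shows "cut_dist f g \<le> c"
  unfolding cut_dist_def by (rule cSUP_least) (use assms in auto)

lemma cut_dist_nonneg: "f \<in> graphons \<Longrightarrow> g \<in> graphons \<Longrightarrow> 0 \<le> cut_dist f g"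
  using cut_dist_upper[of f g "{}" "{}"] by simp

lemma cut_dist_refl: "f \<in> graphons \<Longrightarrow> cut_dist f f = 0"
  using cut_dist_nonneg[of f f] cut_dist_least[of f f 0] by (simp add: set_lebesgue_integral_def)

lemma cut_dist_sym: "cut_dist f g = cut_dist g f"
proof -
  have "\<bar>LINT z : A | square_measure. f z - g z\<bar> = \<bar>LINT z : A | square_measure. g z - f z\<bar>" for A
  proof -
    have "(\<lambda>z. indicat_real A z *\<^sub>R (f z - g z)) = (\<lambda>z. - (indicat_real A z *\<^sub>R (g z - f z)))"
      by (auto simp: algebra_simps)
    then show ?thesis by (simp add: set_lebesgue_integral_def)
  qed
  then show ?thesis by (simp add: cut_dist_def)
qed

lemma cut_dist_triangle:
  assumes "f \<in> graphons" "g \<in> graphons" "h \<in> graphons"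
  shows "cut_dist f h \<le> cut_dist f g + cut_dist g h"
proof (rule cut_dist_least)
  fix S T assume ST: "S \<in> sets unit_measure" "T \<in> sets unit_measure"
  then have A: "S \<times> T \<in> sets square_measure" by simp
  note i = graphon_integrable[OF _ A]
  have "(LINT z : S \<times> T | square_measure. f z - h z)
     = (LINT z : S \<times> T | square_measure. f z - g z) + (LINT z : S \<times> T | square_measure. g z - h z)"
    using i[OF assms(1)] i[OF assms(2)] i[OF assms(3)] by simp
  then show "\<bar>LINT z : S \<times> T | square_measure. f z - h z\<bar> \<le> cut_dist f g + cut_dist g h"
    using cut_dist_upper[OF assms(1,2) ST] cut_dist_upper[OF assms(2,3) ST] by linarith
qed

lemma cut_dist_relabel_le:
  assumes s: "\<sigma> \<in> mp_bijections" and fg: "f \<in> graphons" "g \<in> graphons"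
  shows "cut_dist (relabel \<sigma> f) (relabel \<sigma> g) \<le> cut_dist f g"
proof (rule cut_dist_least)
  fix S T assume ST: "S \<in> sets unit_measure" "T \<in> sets unit_measure"
  let ?I = "{0..1::real}" and ?r = "\<lambda>(x, y). (\<sigma> x, \<sigma> y)"
  define \<tau> where "\<tau> = inv_into ?I \<sigma>"
  have t: "\<tau> \<in> measurable unit_measure unit_measure" "\<And>x. x \<in> ?I \<Longrightarrow> \<tau> (\<sigma> x) = x"
    using s by (auto simp: mp_bijections_def \<tau>_def bij_betw_def)
  define S' T' where "S' = \<tau> -` S \<inter> ?I" and "T' = \<tau> -` T \<inter> ?I"
  have ST': "S' \<in> sets unit_measure" "T' \<in> sets unit_measure"
    using measurable_sets[OF t(1) ST(1)] measurable_sets[OF t(1) ST(2)]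
    by (simp_all add: S'_def T'_def)
  define k where "k = (\<lambda>z. indicat_real (S' \<times> T') z *\<^sub>R (f z - g z))"
  have k: "k \<in> borel_measurable square_measure"
    unfolding k_def using graphonD(1)[OF fg(1)] graphonD(1)[OF fg(2)] ST' by measurable
  have "(LINT z : S \<times> T | square_measure. relabel \<sigma> f z - relabel \<sigma> g z)
      = (LINT z | square_measure. k (?r z))"
    unfolding set_lebesgue_integral_def
  proof (rule Bochner_Integration.integral_cong[OF refl])
    fix z assume "z \<in> space square_measure"
    then obtain x y where z: "z = (x, y)" "x \<in> ?I" "y \<in> ?I"
      by (auto simp: space_square simp del: atLeastAtMost_iff)
    have "\<sigma> x \<in> ?I" "\<sigma> y \<in> ?I" using z mp_in[OF s] by blast+
    then have "(\<sigma> x, \<sigma> y) \<in> S' \<times> T' \<longleftrightarrow> (x, y) \<in> S \<times> T"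
      using z t(2) by (simp add: S'_def T'_def)
    then show "indicat_real (S \<times> T) z *\<^sub>R (relabel \<sigma> f z - relabel \<sigma> g z) = k (?r z)"
      using z by (simp add: k_def relabel_def indicator_def)
  qed
  also have "\<dots> = (LINT z | distr square_measure square_measure ?r. k z)"
    by (rule integral_distr[symmetric, OF measurable_mp_pair[OF s] k])
  also have "\<dots> = (LINT z : S' \<times> T' | square_measure. f z - g z)"
    by (simp add: distr_mp_pair[OF s] k_def set_lebesgue_integral_def)
  finally show "\<bar>LINT z : S \<times> T | square_measure. relabel \<sigma> f z - relabel \<sigma> g z\<bar> \<le> cut_dist f g"
    using cut_dist_upper[OF fg ST'] by simp
qed

definition orbit_dist :: "(real \<times> real \<Rightarrow> real) \<Rightarrow> (real \<times> real \<Rightarrow> real) \<Rightarrow> real" where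
  "orbit_dist f g = (INF \<sigma>\<in>mp_bijections. cut_dist f (relabel \<sigma> g))"

lemma orbit_dist_bdd:
  assumes "f \<in> graphons" "g \<in> graphons"
  shows "bdd_below ((\<lambda>\<sigma>. cut_dist f (relabel \<sigma> g)) ` mp_bijections)"
  by (rule bdd_belowI2[where m = 0]) (intro cut_dist_nonneg relabel_graphon assms)

lemma orbit_dist_less_iff:
  assumes "f \<in> graphons" "g \<in> graphons"
  shows "orbit_dist f g < c \<longleftrightarrow> (\<exists>\<sigma>\<in>mp_bijections. cut_dist f (relabel \<sigma> g) < c)"
  unfolding orbit_dist_def by (rule cINF_less_iff[OF _ orbit_dist_bdd[OF assms]]) (use id_mp in auto)

lemma orbit_dist_nonneg:
  assumes "f \<in> graphons" "g \<in> graphons"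
  shows "0 \<le> orbit_dist f g"
  unfolding orbit_dist_def
  by (rule cINF_greatest) (use id_mp cut_dist_nonneg relabel_graphon assms in auto)

lemma orbit_dist_refl:
  assumes "f \<in> graphons"
  shows "orbit_dist f f = 0"
proof -
  have "orbit_dist f f \<le> cut_dist f (relabel (\<lambda>x. x) f)"
    unfolding orbit_dist_def by (intro cINF_lower orbit_dist_bdd assms id_mp)
  then show ?thesis
    using orbit_dist_nonneg[OF assms assms] by (simp add: relabel_id cut_dist_refl assms)
qed

lemma orbit_dist_sym_le:
  assumes "f \<in> graphons" "g \<in> graphons"
  shows "orbit_dist g f \<le> orbit_dist f g"
proof (rule dense_ge)
  fix c assume "orbit_dist f g < c"
  then obtain \<sigma> where s: "\<sigma> \<in> mp_bijections" "cut_dist f (relabel \<sigma> g) < c"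
    using orbit_dist_less_iff[OF assms] by blast
  let ?\<tau> = "inv_into {0..1} \<sigma>"
  have "cut_dist g (relabel ?\<tau> f) = cut_dist (relabel ?\<tau> f) (relabel ?\<tau> (relabel \<sigma> g))"
    using cut_dist_sym[of g "relabel ?\<tau> f"] by (simp add: relabel_cancel[OF s(1) assms(2)])
  also have "\<dots> \<le> cut_dist f (relabel \<sigma> g)"
    by (intro cut_dist_relabel_le inv_mp s relabel_graphon assms)
  finally have "cut_dist g (relabel ?\<tau> f) < c" using s(2) by simp
  then show "orbit_dist g f \<le> c"
    using orbit_dist_less_iff[OF assms(2,1)] inv_mp[OF s(1)] by (meson less_imp_le)
qed

lemma orbit_dist_sym:
  "f \<in> graphons \<Longrightarrow> g \<in> graphons \<Longrightarrow> orbit_dist f g = orbit_dist g f"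
  by (simp add: orbit_dist_sym_le antisym)

lemma orbit_dist_triangle:
  assumes "f \<in> graphons" "g \<in> graphons" "h \<in> graphons"
  shows "orbit_dist f h \<le> orbit_dist f g + orbit_dist g h"
proof (rule field_le_epsilon)
  fix e :: real assume "0 < e"
  then have "orbit_dist f g < orbit_dist f g + e/2" "orbit_dist g h < orbit_dist g h + e/2" by auto
  then obtain \<sigma> \<tau> where
    s: "\<sigma> \<in> mp_bijections" "cut_dist f (relabel \<sigma> g) < orbit_dist f g + e/2" and
    t: "\<tau> \<in> mp_bijections" "cut_dist g (relabel \<tau> h) < orbit_dist g h + e/2"
    using orbit_dist_less_iff[OF assms(1,2)] orbit_dist_less_iff[OF assms(2,3)] by meson
  have "cut_dist f (relabel (\<tau> \<circ> \<sigma>) h)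
      \<le> cut_dist f (relabel \<sigma> g) + cut_dist (relabel \<sigma> g) (relabel \<sigma> (relabel \<tau> h))"
    unfolding relabel_comp[OF t(1) s(1)]
    by (intro cut_dist_triangle relabel_graphon comp_mp assms s t)
  also have "cut_dist (relabel \<sigma> g) (relabel \<sigma> (relabel \<tau> h)) \<le> cut_dist g (relabel \<tau> h)"
    by (intro cut_dist_relabel_le relabel_graphon assms s t)
  finally have "cut_dist f (relabel (\<tau> \<circ> \<sigma>) h) < orbit_dist f g + orbit_dist g h + e"
    using s(2) t(2) by simp
  then show "orbit_dist f h \<le> orbit_dist f g + orbit_dist g h + e"
    using orbit_dist_less_iff[OF assms(1,3)] comp_mp[OF t(1) s(1)] by (meson less_imp_le)
qed

lemma graphon_class_eq:
  assumes "g \<in> graphons"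
  shows "graphon_class g = {h \<in> graphons. orbit_dist h g = 0}"
proof -
  have "(\<forall>e>0. \<exists>\<sigma>\<in>mp_bijections. cut_dist h (relabel \<sigma> g) < e) \<longleftrightarrow> orbit_dist h g = 0"
    if "h \<in> graphons" for h
  proof -
    have "(\<forall>e>0. orbit_dist h g < e) \<longleftrightarrow> orbit_dist h g \<le> 0"
      using dense_ge[of 0 "orbit_dist h g"] by (fastforce intro: less_imp_le)
    also have "\<dots> \<longleftrightarrow> orbit_dist h g = 0"
      using orbit_dist_nonneg[OF that assms] by linarith
    finally show ?thesis by (simp add: orbit_dist_less_iff[OF that assms])
  qed
  then show ?thesis by (auto simp: graphon_class_def)
qed

lemma graphon_class_eq_iff:
  assumes "f \<in> graphons" "g \<in> graphons"
  shows "graphon_class f = graphon_class g \<longleftrightarrow> orbit_dist f g = 0"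
proof
  assume "graphon_class f = graphon_class g"
  moreover have "f \<in> graphon_class f"
    using assms(1) by (simp add: graphon_class_eq orbit_dist_refl)
  ultimately have "f \<in> graphon_class g" by (rule subst)
  then show "orbit_dist f g = 0" by (simp add: graphon_class_eq[OF assms(2)])
next
  assume 0: "orbit_dist f g = 0"
  have "orbit_dist h f = orbit_dist h g" if "h \<in> graphons" for h
    using orbit_dist_triangle[OF that assms] orbit_dist_triangle[OF that assms(2,1)]
      orbit_dist_sym[OF assms] 0 by linarith
  then show "graphon_class f = graphon_class g"
    unfolding graphon_class_eq[OF assms(1)] graphon_class_eq[OF assms(2)] by (intro Collect_cong) auto
qed

lemma class_rep:
  assumes "F \<in> graphon_quotient"
  shows "class_rep F \<in> graphons" "graphon_class (class_rep F) = F"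
proof -
  have "\<exists>f. f \<in> graphons \<and> graphon_class f = F" using assms by (auto simp: graphon_quotient_def)
  from someI_ex[OF this] show "class_rep F \<in> graphons" "graphon_class (class_rep F) = F"
    by (simp_all add: class_rep_def)
qed

lemma cut_metric_rep:
  assumes "F \<in> graphon_quotient" "G \<in> graphon_quotient"
  shows "cut_metric F G = orbit_dist (class_rep F) (class_rep G)"
  using assms by (simp add: cut_metric_def orbit_dist_def)

theorem cut_metric_class:
  assumes "f \<in> graphons" "g \<in> graphons"
  shows "cut_metric (graphon_class f) (graphon_class g)
    = (INF \<sigma>\<in>mp_bijections. cut_dist f (relabel \<sigma> g))"
proof -
  have q: "graphon_class f \<in> graphon_quotient" "graphon_class g \<in> graphon_quotient"
    using assms by (auto simp: graphon_quotient_def)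
  let ?f = "class_rep (graphon_class f)" and ?g = "class_rep (graphon_class g)"
  have r: "?f \<in> graphons" "?g \<in> graphons" by (intro class_rep q)+
  have 0: "orbit_dist ?f f = 0" "orbit_dist ?g g = 0"
    using graphon_class_eq_iff[OF r(1) assms(1)] graphon_class_eq_iff[OF r(2) assms(2)]
      class_rep(2)[OF q(1)] class_rep(2)[OF q(2)] by simp_all
  have "orbit_dist ?f ?g = orbit_dist f g"
    using orbit_dist_triangle[OF r(1) assms(1) r(2)] orbit_dist_triangle[OF assms(1,2) r(2)]
      orbit_dist_triangle[OF assms(1) r(1) assms(2)] orbit_dist_triangle[OF r assms(2)]
      0 orbit_dist_sym[OF r(1) assms(1)] orbit_dist_sym[OF r(2) assms(2)] by linarith
  then show ?thesis using cut_metric_rep[OF q] by (simp add: orbit_dist_def)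
qed

theorem Metric_space_cut_metric: "Metric_space graphon_quotient cut_metric"
proof
  fix F G H
  show "0 \<le> cut_metric F G"
    by (cases "F \<in> graphon_quotient \<and> G \<in> graphon_quotient")
       (auto simp: cut_metric_rep class_rep orbit_dist_nonneg, auto simp: cut_metric_def)
  show "cut_metric F G = cut_metric G F"
    by (cases "F \<in> graphon_quotient \<and> G \<in> graphon_quotient")
       (auto simp: cut_metric_rep class_rep orbit_dist_sym, auto simp: cut_metric_def)
  assume F: "F \<in> graphon_quotient" and G: "G \<in> graphon_quotient"
  show "cut_metric F G = 0 \<longleftrightarrow> F = G"
    using graphon_class_eq_iff[of "class_rep F" "class_rep G"] class_rep F G
    by (simp add: cut_metric_rep)
  assume "H \<in> graphon_quotient"
  then show "cut_metric F H \<le> cut_metric F G + cut_metric G H"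
    using F G by (simp add: cut_metric_rep class_rep orbit_dist_triangle)
qed

end

theory Submission
  imports Defs
begin

text \<open>
  Upper bound: by the weak regularity lemma every graph on \<open>n\<close> vertices is cut-close to the step
  graphon \<open>h\<close> of its block densities for some vertex partition into boundedly many classes. The
  probability of a prescribed list of block densities is at most \<open>exp (- n\<^sup>2 I\<^sub>p(h) + O(n))\<close>, as one sees by
  comparing with the random graph whose edge probabilities are these densities, and there are only
  \<open>exp (O(n))\<close> pairs of a partition and a density list. Since \<open>T\<close> is Lipschitz for the cut distance,
  only graphons \<open>h\<close> that nearly satisfy the constraint enter, and moving a graphon towards the constant
  \<open>1\<close> repairs the constraint at a small cost in \<open>I\<^sub>p\<close>.

  Lower bound: for \<open>f\<close> with \<open>T(f) > t\<close>, take the averages of \<open>f\<close> over an \<open>n\<close>-grid as edge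
  probabilities. By Jensen the relative entropy to \<open>G(n,p)\<close> is at most \<open>n\<^sup>2 I\<^sub>p(f)\<close>, by a second moment bound
  the triangle event has probability close to \<open>1\<close>, and the entropy inequality concludes.

  The statements on minimizers follow from compactness of the space of graphons modulo relabelling,
  which is proved as total boundedness (regularity, then sorting the classes of the partition by a permutation of
  grid cells) together with completeness (Radon--Nikodym), and from lower semicontinuity of \<open>I\<^sub>p\<close>, which
  is Jensen's inequality on grids.
\<close>

section \<open>Regularity and random subsets\<close>

text \<open>The cut distance controls \<open>triangle_density\<close> but not
  \<open>graphon_rate\<close>: the graphon of a quasirandom graph is cut-close to a constant p whose
  rate is 0, while its own rate stays away from 0. The rate is therefore never evaluated at a graph,
  only at averages over blocks. The factor 1/2 in \<open>rate\<close> makes up for each edge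
  occupying two cells of the square, so that n^2 times the rate of a step graphon is the relative
  entropy of the corresponding random graph, up to the diagonal. The accuracy of regularity, and
  with it the number of classes, is fixed before n; this is why counting partitions is harmless at
  speed n^2. The probability bounds use labelled partitions throughout; relabelling enters through
  the minimizers. There representatives have to be aligned, because a Cauchy sequence of classes
  says nothing yet about the graphons chosen in them. For t < 1/6 the constant 1 satisfies the
  constraint with room to spare, which is what mixing with it exploits.\<close>

definition fiber_avg :: "'a set \<Rightarrow> ('a \<Rightarrow> 'b) \<Rightarrow> ('a \<Rightarrow> real) \<Rightarrow> 'a \<Rightarrow> real" where
  "fiber_avg X \<kappa> f x = (\<Sum>y\<in>{y\<in>X. \<kappa> y = \<kappa> x}. f y) / real (card {y\<in>X. \<kappa> y = \<kappa> x})"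

lemma fiber_avg_cong: "\<kappa> x = \<kappa> y \<Longrightarrow> fiber_avg X \<kappa> f x = fiber_avg X \<kappa> f y"
  by (simp add: fiber_avg_def)

lemma fiber_avg_range:
  assumes "\<And>x. x \<in> X \<Longrightarrow> 0 \<le> f x" "\<And>x. x \<in> X \<Longrightarrow> f x \<le> 1"
  shows "0 \<le> fiber_avg X \<kappa> f x" "fiber_avg X \<kappa> f x \<le> 1"
proof -
  show "0 \<le> fiber_avg X \<kappa> f x"
    unfolding fiber_avg_def by (intro divide_nonneg_nonneg sum_nonneg) (use assms in auto)
  have "(\<Sum>y\<in>{y\<in>X. \<kappa> y = \<kappa> x}. f y) \<le> real (card {y\<in>X. \<kappa> y = \<kappa> x}) * 1"
    by (rule sum_bounded_above) (use assms in auto)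
  then show "fiber_avg X \<kappa> f x \<le> 1"
    unfolding fiber_avg_def by (simp add: divide_le_eq)
qed

text \<open>\<open>fiber_avg\<close> is the conditional expectation, under uniform weights on X,
  given the partition into fibres of \<kappa>. Tested against a function constant on fibres it is
  indistinguishable from f: after exchanging the sums every y is counted once.\<close>

lemma fiber_avg_sum:
  assumes fin: "finite X" and g: "\<And>x y. x \<in> X \<Longrightarrow> y \<in> X \<Longrightarrow> \<kappa> x = \<kappa> y \<Longrightarrow> g x = g y"
  shows "(\<Sum>x\<in>X. fiber_avg X \<kappa> f x * g x) = (\<Sum>x\<in>X. f x * g x)"
proof -
  let ?N = "\<lambda>x. {y\<in>X. \<kappa> y = \<kappa> x}"
  have "(\<Sum>x\<in>X. fiber_avg X \<kappa> f x * g x) = (\<Sum>x\<in>X. \<Sum>y\<in>X. if \<kappa> y = \<kappa> x then f y * (g x / card (?N x)) else 0)"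
    by (intro sum.cong refl) (simp add: fiber_avg_def sum.If_cases[OF fin] sum_distrib_right
        sum_divide_distrib Int_def conj_commute)
  also have "\<dots> = (\<Sum>y\<in>X. \<Sum>x\<in>X. if \<kappa> y = \<kappa> x then f y * (g x / card (?N x)) else 0)"
    by (rule sum.swap)
  also have "\<dots> = (\<Sum>y\<in>X. f y * g y)"
  proof (intro sum.cong refl)
    fix y assume y: "y \<in> X"
    have "(\<Sum>x\<in>X. if \<kappa> y = \<kappa> x then f y * (g x / card (?N x)) else 0)
        = (\<Sum>x\<in>X. if \<kappa> y = \<kappa> x then f y * (g y / card (?N y)) else 0)"
    proof (intro sum.cong refl)
      fix x assume "x \<in> X"
      then show "(if \<kappa> y = \<kappa> x then f y * (g x / card (?N x)) else 0)
          = (if \<kappa> y = \<kappa> x then f y * (g y / card (?N y)) else 0)"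
        using g[OF y, of x] by simp
    qed
    also have "\<dots> = card (?N y) * (f y * (g y / card (?N y)))"
    proof -
      have "X \<inter> {x. \<kappa> y = \<kappa> x} = ?N y" by auto
      then show ?thesis by (simp add: sum.If_cases[OF fin])
    qed
    also have "\<dots> = f y * g y"
    proof -
      have "card (?N y) \<noteq> 0" using y fin by auto
      then show ?thesis by simp
    qed
    finally show "(\<Sum>x\<in>X. if \<kappa> y = \<kappa> x then f y * (g x / card (?N x)) else 0) = f y * g y" .
  qed
  finally show ?thesis .
qed

text \<open>The finer average minus the coarser one is orthogonal to every function constant on the
  coarser fibres, so the cross term vanishes. Refinement means that \<kappa>' determines
  \<kappa>.\<close>

lemma fiber_avg_pythagoras:
  assumes fin: "finite X" and ref: "\<And>x y. \<kappa>' x = \<kappa>' y \<Longrightarrow> \<kappa> x = \<kappa> y"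
  shows "(\<Sum>x\<in>X. (fiber_avg X \<kappa>' f x)\<^sup>2) = (\<Sum>x\<in>X. (fiber_avg X \<kappa> f x)\<^sup>2)
    + (\<Sum>x\<in>X. (fiber_avg X \<kappa>' f x - fiber_avg X \<kappa> f x)\<^sup>2)"
proof -
  let ?a = "fiber_avg X \<kappa> f" and ?b = "fiber_avg X \<kappa>' f"
  have "(\<Sum>x\<in>X. ?b x * ?a x) = (\<Sum>x\<in>X. f x * ?a x)"
    by (rule fiber_avg_sum[OF fin]) (use ref fiber_avg_cong in metis)
  also have "\<dots> = (\<Sum>x\<in>X. ?a x * ?a x)"
    by (rule fiber_avg_sum[OF fin, symmetric]) (use fiber_avg_cong in metis)
  finally have "(\<Sum>x\<in>X. ?b x * ?a x) = (\<Sum>x\<in>X. ?a x * ?a x)" .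
  moreover have "(\<Sum>x\<in>X. (?b x - ?a x)\<^sup>2) = (\<Sum>x\<in>X. (?b x)\<^sup>2) - 2 * (\<Sum>x\<in>X. ?b x * ?a x) + (\<Sum>x\<in>X. (?a x)\<^sup>2)"
    by (simp add: power2_diff sum.distrib sum_subtractf sum_distrib_left mult.assoc)
  ultimately show ?thesis by (simp add: power2_eq_square)
qed

text \<open>Energy increment: a pair of sets that witnesses irregularity of a partition splits it into
  one whose averages have larger energy by \<open>\<epsilon>\<^sup>2 |V|\<^sup>2\<close>, and the energy is at most \<open>|V|\<^sup>2\<close>.\<close>

lemma weak_regularity:
  fixes A :: "'a \<times> 'a \<Rightarrow> real"
  assumes fin: "finite V" "V \<noteq> {}" and A: "\<And>z. z \<in> V \<times> V \<Longrightarrow> 0 \<le> A z" "\<And>z. z \<in> V \<times> V \<Longrightarrow> A z \<le> 1"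
    and e: "0 < \<epsilon>" and k: "1 < real k * \<epsilon>\<^sup>2"
  obtains c :: "'a \<Rightarrow> nat" where "\<And>i. c i < 4 ^ k"
    "\<And>S T. S \<subseteq> V \<Longrightarrow> T \<subseteq> V \<Longrightarrow>
      \<bar>\<Sum>z\<in>S \<times> T. A z - fiber_avg (V \<times> V) (map_prod c c) A z\<bar> \<le> \<epsilon> * (real (card V))\<^sup>2"
proof -
  let ?X = "V \<times> V" and ?N = "real (card V)"
  define av where "av c = fiber_avg ?X (map_prod c c) A" for c :: "'a \<Rightarrow> nat"
  define reg where "reg c \<longleftrightarrow> (\<forall>S\<subseteq>V. \<forall>T\<subseteq>V. \<bar>\<Sum>z\<in>S \<times> T. A z - av c z\<bar> \<le> \<epsilon> * ?N\<^sup>2)"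
    for c :: "'a \<Rightarrow> nat"
  have finX: "finite ?X" using fin by simp
  have N: "?N > 0" using fin by (simp add: card_gt_0_iff)
  have "\<exists>c. (\<forall>i. c i < 4 ^ m) \<and> (reg c \<or> real m * \<epsilon>\<^sup>2 * ?N\<^sup>2 \<le> (\<Sum>z\<in>?X. (av c z)\<^sup>2))" for m
  proof (induction m)
    case 0
    show ?case by (rule exI[of _ "\<lambda>_. 0"]) (auto intro: sum_nonneg)
  next
    case (Suc m)
    then obtain c where c: "\<forall>i. c i < 4 ^ m"
      and or: "reg c \<or> real m * \<epsilon>\<^sup>2 * ?N\<^sup>2 \<le> (\<Sum>z\<in>?X. (av c z)\<^sup>2)" by blast
    show ?case
    proof (cases "reg c")
      case True
      have "\<forall>i. c i < 4 ^ Suc m" using c by (auto intro: less_le_trans)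
      with True show ?thesis by blast
    next
      case False
      then obtain S T where ST: "S \<subseteq> V" "T \<subseteq> V" and big: "\<epsilon> * ?N\<^sup>2 < \<bar>\<Sum>z\<in>S \<times> T. A z - av c z\<bar>"
        unfolding reg_def by (meson not_le)
      \<comment> \<open>Two extra binary digits record membership in S and in T. This encodes the
        common refinement and multiplies the number of colours by 4, whence
        \<open>4 ^ k\<close>.\<close>
      define c' where "c' i = 4 * c i + (if i \<in> S then 2 else 0) + (if i \<in> T then 1 else 0)" for i
      have c'lt: "c' i < 4 ^ Suc m" for i
        using c[rule_format, of i] unfolding c'_def by auto
      have c'eq: "c i = c j \<and> (i \<in> S \<longleftrightarrow> j \<in> S) \<and> (i \<in> T \<longleftrightarrow> j \<in> T)" if "c' i = c' j" for i j
      proof -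
        have d: "c' l div 4 = c l" "(l \<in> S) = (c' l div 2 mod 2 = 1)" "(l \<in> T) = (c' l mod 2 = 1)" for l
          unfolding c'_def by (cases "l \<in> S"; cases "l \<in> T"; simp; presburger)+
        show ?thesis using d[of i] d[of j] that by simp
      qed
      define d where "d z = av c' z - av c z" for z
      define ST1 where "ST1 = (indicator (S \<times> T) :: _ \<Rightarrow> real)"
      \<comment> \<open>S \<times> T is a union of blocks of c', so averaging over these blocks does
        not change the sum over it.\<close>
      have "(\<Sum>z\<in>?X. av c' z * ST1 z) = (\<Sum>z\<in>?X. A z * ST1 z)"
        unfolding av_def by (rule fiber_avg_sum[OF finX]) (auto simp: ST1_def indicator_def dest: c'eq)
      then have "(\<Sum>z\<in>?X. d z * ST1 z) = (\<Sum>z\<in>?X. (A z - av c z) * ST1 z)"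
        by (simp add: d_def left_diff_distrib sum_subtractf)
      also have "\<dots> = (\<Sum>z\<in>S \<times> T. A z - av c z)"
        using ST by (intro sum.mono_neutral_cong_right finX) (auto simp: ST1_def)
      finally have eq: "(\<Sum>z\<in>?X. d z * ST1 z) = (\<Sum>z\<in>S \<times> T. A z - av c z)" .
      have "(\<Sum>z\<in>?X. (ST1 z)\<^sup>2) \<le> (\<Sum>z\<in>?X. 1)"
        by (intro sum_mono) (auto simp: ST1_def indicator_def)
      then have "(\<Sum>z\<in>?X. (ST1 z)\<^sup>2) \<le> ?N\<^sup>2"
        by (simp add: card_cartesian_product power2_eq_square)
      then have "(\<Sum>z\<in>?X. (d z)\<^sup>2) * (\<Sum>z\<in>?X. (ST1 z)\<^sup>2) \<le> (\<Sum>z\<in>?X. (d z)\<^sup>2) * ?N\<^sup>2"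
        by (intro mult_left_mono sum_nonneg) auto
      then have "(\<Sum>z\<in>S \<times> T. A z - av c z)\<^sup>2 \<le> (\<Sum>z\<in>?X. (d z)\<^sup>2) * ?N\<^sup>2"
        using Cauchy_Schwarz_ineq_sum[of d ST1 ?X] unfolding eq by linarith
      moreover have "(\<epsilon> * ?N\<^sup>2)\<^sup>2 \<le> \<bar>\<Sum>z\<in>S \<times> T. A z - av c z\<bar>\<^sup>2"
        by (rule power_mono) (use big e in auto)
      ultimately have "(\<epsilon> * ?N\<^sup>2)\<^sup>2 \<le> (\<Sum>z\<in>?X. (d z)\<^sup>2) * ?N\<^sup>2" by simp
      then have inc: "\<epsilon>\<^sup>2 * ?N\<^sup>2 \<le> (\<Sum>z\<in>?X. (d z)\<^sup>2)"
        using N by (simp add: power_mult_distrib power2_eq_square mult.assoc)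
      have "(\<Sum>z\<in>?X. (av c' z)\<^sup>2) = (\<Sum>z\<in>?X. (av c z)\<^sup>2) + (\<Sum>z\<in>?X. (d z)\<^sup>2)"
        unfolding av_def d_def by (rule fiber_avg_pythagoras[OF finX]) (auto dest: c'eq)
      then have "real (Suc m) * \<epsilon>\<^sup>2 * ?N\<^sup>2 \<le> (\<Sum>z\<in>?X. (av c' z)\<^sup>2)"
        using or False inc by (simp add: algebra_simps)
      then show ?thesis using c'lt by blast
    qed
  qed
  then obtain c where c: "\<forall>i. c i < 4 ^ k" "reg c \<or> real k * \<epsilon>\<^sup>2 * ?N\<^sup>2 \<le> (\<Sum>z\<in>?X. (av c z)\<^sup>2)" by blast
  \<comment> \<open>After k increments the energy would exceed this maximum, by the choice of
    k.\<close>
  have "(\<Sum>z\<in>?X. (av c z)\<^sup>2) \<le> (\<Sum>z\<in>?X. 1)"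
    unfolding av_def by (intro sum_mono power_le_one fiber_avg_range A)
  also have "\<dots> = 1 * ?N\<^sup>2" by (simp add: card_cartesian_product power2_eq_square)
  also have "\<dots> < real k * \<epsilon>\<^sup>2 * ?N\<^sup>2" using k N by (intro mult_strict_right_mono) auto
  finally have "reg c" using c(2) by auto
  then have "\<bar>\<Sum>z\<in>S \<times> T. A z - fiber_avg ?X (map_prod c c) A z\<bar> \<le> \<epsilon> * ?N\<^sup>2"
    if "S \<subseteq> V" "T \<subseteq> V" for S T
    using that unfolding reg_def av_def by simp
  with c(1) show ?thesis by (intro that[of c]) simp_all
qed

section \<open>Random subsets with independent elements, and the entropy inequality\<close>

definition edge_weight :: "'a set \<Rightarrow> ('a \<Rightarrow> real) \<Rightarrow> 'a set \<Rightarrow> real" where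
  "edge_weight V q G = (\<Prod>e\<in>V. if e \<in> G then q e else 1 - q e)"

lemma sum_Pow_prod_if:
  fixes f g :: "'a \<Rightarrow> real"
  assumes "finite V"
  shows "(\<Sum>G\<in>Pow V. \<Prod>e\<in>V. if e \<in> G then f e else g e) = (\<Prod>e\<in>V. f e + g e)"
proof -
  have "(\<Prod>e\<in>V. if e \<in> G then f e else g e) = (\<Prod>e\<in>G. f e) * (\<Prod>e\<in>V - G. g e)" if "G \<in> Pow V" for G
  proof -
    have "V \<inter> G = G" using that by auto
    then show ?thesis using assms by (simp add: prod.If_cases Diff_eq)
  qed
  then show ?thesis using prod_add[OF assms, of f g] by simp
qed

lemma edge_weight_nonneg:
  "(\<And>e. e \<in> V \<Longrightarrow> 0 \<le> q e \<and> q e \<le> 1) \<Longrightarrow> 0 \<le> edge_weight V q G"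
  unfolding edge_weight_def by (rule prod_nonneg) auto

lemma edge_weight_pos:
  "(\<And>e. e \<in> V \<Longrightarrow> e \<in> G \<Longrightarrow> 0 < q e) \<Longrightarrow> (\<And>e. e \<in> V \<Longrightarrow> e \<notin> G \<Longrightarrow> q e < 1) \<Longrightarrow> 0 < edge_weight V q G"
  unfolding edge_weight_def by (rule prod_pos) auto

text \<open>Replacing the factor 1 - q e by 0 for e in S kills exactly the sets G that miss a point
  of S. The indicator thus becomes part of the product, and the sum over G factorises.\<close>

lemma sum_edge_weight_superset:
  assumes "finite V" "S \<subseteq> V"
  shows "(\<Sum>G\<in>Pow V. edge_weight V q G * of_bool (S \<subseteq> G)) = (\<Prod>e\<in>S. q e)"
proof -
  have "edge_weight V q G * of_bool (S \<subseteq> G)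
      = (\<Prod>e\<in>V. if e \<in> G then q e else (if e \<in> S then 0 else 1 - q e))" for G
  proof (cases "S \<subseteq> G")
    case True then show ?thesis unfolding edge_weight_def by (auto intro!: prod.cong)
  next
    case False
    then obtain e where "e \<in> V" "e \<in> S" "e \<notin> G" using assms by blast
    then have "(\<Prod>e\<in>V. if e \<in> G then q e else (if e \<in> S then 0 else 1 - q e)) = 0"
      using assms(1) by (intro prod_zero) auto
    then show ?thesis using False by simp
  qed
  then have "(\<Sum>G\<in>Pow V. edge_weight V q G * of_bool (S \<subseteq> G)) = (\<Prod>e\<in>V. q e + (if e \<in> S then 0 else 1 - q e))"
    by (simp add: sum_Pow_prod_if[OF assms(1)])
  also have "\<dots> = (\<Prod>e\<in>V. if e \<in> S then q e else 1)" by (intro prod.cong) auto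
  also have "\<dots> = (\<Prod>e\<in>S. q e)"
    using assms by (simp add: prod.If_cases Int_absorb1)
  finally show ?thesis .
qed

lemma sum_edge_weight: "finite V \<Longrightarrow> (\<Sum>G\<in>Pow V. edge_weight V q G) = 1"
  using sum_edge_weight_superset[of V "{}" q] by simp

text \<open>By linearity only the marginal at each e matters. Applied to log-likelihood ratios this
  computes a relative entropy.\<close>

lemma sum_edge_weight_additive:
  fixes a b :: "'a \<Rightarrow> real"
  assumes "finite V"
  shows "(\<Sum>G\<in>Pow V. edge_weight V q G * (\<Sum>e\<in>V. if e \<in> G then a e else b e))
    = (\<Sum>e\<in>V. q e * a e + (1 - q e) * b e)"
proof -
  have "(\<Sum>G\<in>Pow V. edge_weight V q G * (\<Sum>e\<in>V. if e \<in> G then a e else b e))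
      = (\<Sum>e\<in>V. \<Sum>G\<in>Pow V. edge_weight V q G * (if e \<in> G then a e else b e))"
    by (subst sum.swap) (simp add: sum_distrib_left)
  also have "\<dots> = (\<Sum>e\<in>V. q e * a e + (1 - q e) * b e)"
  proof (intro sum.cong refl)
    fix e assume e: "e \<in> V"
    have "(\<Sum>G\<in>Pow V. edge_weight V q G * (if e \<in> G then a e else b e))
        = (\<Sum>G\<in>Pow V. (a e - b e) * (edge_weight V q G * of_bool ({e} \<subseteq> G)) + b e * edge_weight V q G)"
      by (intro sum.cong refl) (auto simp: algebra_simps)
    also have "\<dots> = (a e - b e) * q e + b e"
      using sum_edge_weight_superset[OF assms, of "{e}" q] e sum_edge_weight[OF assms, of q]
      by (simp add: sum.distrib flip: sum_distrib_left)
    finally show "(\<Sum>G\<in>Pow V. edge_weight V q G * (if e \<in> G then a e else b e)) = q e * a e + (1 - q e) * b e"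
      by (simp add: algebra_simps)
  qed
  finally show ?thesis .
qed

text \<open>The Donsker--Varadhan inequality for the test function \<open>s \<cdot> 1\<^sub>A\<close> with \<open>e\<^sup>s = 1 / P(A)\<close>.\<close>

lemma entropy_lower_bound:
  fixes P Q L :: "'a \<Rightarrow> real"
  assumes fin: "finite X" and P: "\<And>x. x \<in> X \<Longrightarrow> 0 \<le> P x" "sum P X \<le> 1"
    and Q: "\<And>x. x \<in> X \<Longrightarrow> 0 \<le> Q x" "sum Q X = 1"
    and QP: "\<And>x. x \<in> X \<Longrightarrow> 0 < Q x \<Longrightarrow> P x = Q x * exp (- L x)"
    and A: "A \<subseteq> X" "0 < sum Q A"
  shows "0 < sum P A" "- ((\<Sum>x\<in>X. Q x * L x) + ln 2) \<le> ln (sum P A) * sum Q A"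
proof -
  have finA: "finite A" using A fin finite_subset by blast
  have "\<exists>x\<in>A. Q x > 0"
  proof (rule ccontr)
    assume "\<not> ?thesis"
    then have "sum Q A \<le> 0" by (intro sum_nonpos) (auto simp: not_less)
    then show False using A by simp
  qed
  then obtain x where x: "x \<in> A" "Q x > 0" by blast
  have "P x > 0" using QP[of x] x A by auto
  then show pos: "0 < sum P A" using x A P finA by (intro sum_pos2[of A x]) auto
  define s where "s = - ln (sum P A)"
  have es: "exp s * sum P A = 1" using pos by (simp add: s_def exp_minus)
  define g where "g x = (if x \<in> A then s else 0)" for x
  \<comment> \<open>Pointwise form of the inequality: 1 + y \<le> exp y at y = g - L - ln 2, where
    exp (- L) turns Q into P. The ln 2 normalises: the P-mean of exp g is 1 from A plus at most 1
    from the complement.\<close>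
  have "Q x * (g x - L x - ln 2) \<le> P x * exp (g x) / 2 - Q x" if "x \<in> X" for x
  proof (cases "Q x = 0")
    case True then show ?thesis using P(1)[OF that] by simp
  next
    case False
    then have q: "Q x > 0" using Q(1)[OF that] by simp
    have "g x - L x - ln 2 \<le> exp (g x - L x - ln 2) - 1" using exp_ge_add_one_self[of "g x - L x - ln 2"] by linarith
    then have "Q x * (g x - L x - ln 2) \<le> Q x * (exp (g x - L x - ln 2) - 1)" using q by simp
    also have "\<dots> = P x * exp (g x) / 2 - Q x"
      using QP[OF that q] by (simp add: exp_diff exp_minus exp_add field_simps)
    finally show ?thesis .
  qed
  then have "(\<Sum>x\<in>X. Q x * (g x - L x - ln 2)) \<le> (\<Sum>x\<in>X. P x * exp (g x) / 2 - Q x)"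
    by (rule sum_mono)
  also have "\<dots> = (\<Sum>x\<in>X. P x * exp (g x)) / 2 - 1"
    using Q by (simp add: sum_subtractf sum_divide_distrib)
  also have "(\<Sum>x\<in>X. P x * exp (g x)) \<le> 2"
  proof -
    have "(\<Sum>x\<in>X. P x * exp (g x)) = (\<Sum>x\<in>A. P x * exp (g x)) + (\<Sum>x\<in>X - A. P x * exp (g x))"
      using A fin by (metis add.commute sum.subset_diff)
    also have "(\<Sum>x\<in>A. P x * exp (g x)) = 1"
      using es by (simp add: g_def mult.commute sum_distrib_left)
    also have "(\<Sum>x\<in>X - A. P x * exp (g x)) = sum P (X - A)" by (simp add: g_def)
    also have "\<dots> \<le> sum P X" by (rule sum_mono2) (use fin P in auto)
    finally show ?thesis using P by simp
  qed
  finally have "(\<Sum>x\<in>X. Q x * (g x - L x - ln 2)) \<le> 0" by simp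
  moreover have "(\<Sum>x\<in>X. Q x * g x) = s * sum Q A"
  proof -
    have "(\<Sum>x\<in>X. Q x * g x) = (\<Sum>x\<in>A. Q x * s)"
      unfolding g_def using A fin by (intro sum.mono_neutral_cong_right) auto
    then show ?thesis by (simp add: sum_distrib_left mult.commute)
  qed
  moreover have "(\<Sum>x\<in>X. Q x * (g x - L x - ln 2))
      = (\<Sum>x\<in>X. Q x * g x) - (\<Sum>x\<in>X. Q x * L x) - ln 2 * sum Q X"
    by (simp add: right_diff_distrib sum_subtractf sum_distrib_left mult.commute[of _ "ln 2"])
  ultimately show "- ((\<Sum>x\<in>X. Q x * L x) + ln 2) \<le> ln (sum P A) * sum Q A"
    using Q by (simp add: s_def mult.commute)
qed

section \<open>Step graphons\<close>

definition gidx :: "nat \<Rightarrow> real \<Rightarrow> nat" where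
  "gidx n x = nat \<lceil>real n * x\<rceil>"

text \<open>The cells with index \<open>1, \<dots>, n\<close> have measure \<open>1 / n\<close>; the point \<open>0\<close> is a null cell of index \<open>0\<close>,
  in accordance with \<^const>\<open>graph_graphon\<close>.\<close>

definition cell :: "nat \<Rightarrow> nat \<Rightarrow> real set" where
  "cell n i = {x \<in> {0..1}. gidx n x = i}"

definition step_graphon :: "nat \<Rightarrow> (nat \<Rightarrow> nat \<Rightarrow> real) \<Rightarrow> real \<times> real \<Rightarrow> real" where
  "step_graphon n A = restrict (\<lambda>(x, y). A (gidx n x) (gidx n y)) ({0..1} \<times> {0..1})"

lemma sets_unit: "sets unit_measure = sets (restrict_space borel {0..1})"
  by (simp add: unit_measure_def sets_restrict_space)

lemma measurable_gidx [measurable]: "gidx n \<in> measurable unit_measure (count_space UNIV)"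
proof -
  have "(\<lambda>x. nat \<lceil>real n * x\<rceil>) \<in> measurable borel (count_space UNIV)"
    by measurable
  then show ?thesis
    unfolding gidx_def[abs_def] unit_measure_def by (intro measurable_restrict_space1) simp
qed

lemma sets_cell [measurable]: "cell n i \<in> sets unit_measure"
proof -
  have "{x \<in> space unit_measure. gidx n x = i} \<in> sets unit_measure" by measurable
  then show ?thesis by (simp add: cell_def)
qed

lemma gidx_le: "x \<in> {0..1} \<Longrightarrow> gidx n x \<le> n"
  using mult_left_mono[of x 1 "real n"] by (simp add: gidx_def ceiling_le_iff nat_le_iff)

lemma gidx_eq_0: "0 < n \<Longrightarrow> x \<in> {0..1} \<Longrightarrow> gidx n x = 0 \<longleftrightarrow> x = 0"
  by (auto simp: gidx_def ceiling_le_iff mult_le_0_iff)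

lemma cell_eq:
  assumes "1 \<le> i" "i \<le> n"
  shows "cell n i = {(real i - 1) / n <.. real i / n}"
proof -
  have n: "real n > 0" using assms by simp
  have "gidx n x = i \<longleftrightarrow> (real i - 1) / n < x \<and> x \<le> real i / n" for x
  proof -
    have "gidx n x = i \<longleftrightarrow> \<lceil>real n * x\<rceil> = int i"
      using assms by (auto simp: gidx_def)
    also have "\<dots> \<longleftrightarrow> real i - 1 < real n * x \<and> real n * x \<le> real i"
      by (simp add: ceiling_eq_iff)
    also have "\<dots> \<longleftrightarrow> (real i - 1) / n < x \<and> x \<le> real i / n"
      using n by (simp add: field_simps)
    finally show ?thesis .
  qed
  moreover have "0 \<le> x \<and> x \<le> 1" if "(real i - 1) / n < x" "x \<le> real i / n" for x
  proof -
    have "0 \<le> (real i - 1) / n" "real i / n \<le> 1" using assms n by (auto simp: field_simps)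
    then show ?thesis using that by linarith
  qed
  ultimately show ?thesis by (auto simp: cell_def)
qed

lemma measure_unit: "A \<in> sets unit_measure \<Longrightarrow> measure unit_measure A = measure lborel A"
  unfolding unit_measure_def
  by (subst measure_restrict_space) (auto simp: sets_restrict_space)

lemma measure_cell: "1 \<le> i \<Longrightarrow> i \<le> n \<Longrightarrow> measure unit_measure (cell n i) = 1 / real n"
  using measure_unit[OF sets_cell, of n i] by (simp add: cell_eq divide_right_mono flip: diff_divide_distrib)

lemma measure_cell_0: "0 < n \<Longrightarrow> measure unit_measure (cell n 0) = 0"
proof -
  assume "0 < n"
  then have "cell n 0 = {0}" using gidx_eq_0[of n] by (auto simp: cell_def)
  then show ?thesis using sets_cell[of n 0] by (simp add: measure_unit)
qed

lemma disjoint_cells: "i \<noteq> j \<Longrightarrow> cell n i \<inter> cell n j = {}"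
  by (auto simp: cell_def)

lemma sum_indicator_cell:
  fixes g :: "nat \<Rightarrow> real"
  assumes "x \<in> {0..1}"
  shows "(\<Sum>i\<le>n. g i * indicator (cell n i) x) = g (gidx n x)"
proof -
  have "(\<Sum>i\<le>n. g i * indicator (cell n i) x) = (\<Sum>i\<le>n. if i = gidx n x then g i else 0)"
    using assms by (intro sum.cong refl) (auto simp: cell_def)
  also have "\<dots> = g (gidx n x)" using gidx_le[OF assms] by simp
  finally show ?thesis .
qed

lemma sum_atMost_eq:
  fixes g :: "nat \<Rightarrow> real"
  shows "(\<Sum>i\<le>n. g i) = g 0 + (\<Sum>i=1..n. g i)"
proof -
  have "{..n} = insert 0 {1..n}" by auto
  then show ?thesis by simp
qed

lemma integral_gidx:
  fixes g :: "nat \<Rightarrow> real"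
  assumes "0 < n"
  shows "(LINT x|unit_measure. g (gidx n x)) = (\<Sum>i=1..n. g i) / n"
proof -
  have "(LINT x|unit_measure. g (gidx n x)) = (LINT x|unit_measure. (\<Sum>i\<le>n. g i * indicator (cell n i) x))"
    by (intro Bochner_Integration.integral_cong refl) (simp only: space_unit sum_indicator_cell)
  also have "\<dots> = (\<Sum>i\<le>n. g i * measure unit_measure (cell n i))"
  proof -
    have "cell n i \<inter> {0..1} = cell n i" for i by (auto simp: cell_def)
    then show ?thesis
      by (subst Bochner_Integration.integral_sum)
         (auto intro!: integrable_real_mult_indicator simp: unit_measure.emeasure_eq_measure)
  qed
  also have "\<dots> = (\<Sum>i=1..n. g i * (1 / n))"
    using assms by (simp add: sum_atMost_eq measure_cell_0 measure_cell)
  finally show ?thesis by (simp add: sum_divide_distrib)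
qed

lemma step_graphon_apply:
  "x \<in> {0..1} \<Longrightarrow> y \<in> {0..1} \<Longrightarrow> step_graphon n A (x, y) = A (gidx n x) (gidx n y)"
  by (simp add: step_graphon_def)

lemma measurable_gidx_pair:
  "(\<lambda>z. A (gidx n (fst z)) (gidx n (snd z))) \<in> borel_measurable square_measure"
proof -
  have 1: "(\<lambda>z. gidx n (fst z)) \<in> measurable square_measure (count_space UNIV)"
    and 2: "(\<lambda>z. gidx n (snd z)) \<in> measurable square_measure (count_space UNIV)"
    by measurable
  have "(\<lambda>z. A i (gidx n (snd z))) \<in> borel_measurable square_measure" for i
    by (rule measurable_compose[OF 2]) simp
  then show ?thesis by (rule measurable_compose_countable[OF _ 1])
qed

lemma step_graphon_in:
  assumes "\<And>i j. A i j = A j i" "\<And>i j. 0 \<le> A i j" "\<And>i j. A i j \<le> 1"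
  shows "step_graphon n A \<in> graphons"
proof -
  have "step_graphon n A \<in> borel_measurable square_measure"
    by (rule measurable_cong[THEN iffD1, OF _ measurable_gidx_pair[of A n]])
       (auto simp: space_square step_graphon_apply simp del: atLeastAtMost_iff)
  then show ?thesis
    using assms by (auto simp: graphons_def step_graphon_def PiE_def Pi_def simp del: atLeastAtMost_iff)
      (auto simp: assms)
qed

lemma iterated_integral_step:
  fixes F :: "real \<Rightarrow> real"
  assumes "0 < n"
  shows "(LINT x|unit_measure. LINT y|unit_measure. F (step_graphon n A (x, y)))
    = (\<Sum>i=1..n. \<Sum>j=1..n. F (A i j)) / (real n)\<^sup>2"
proof -
  have "(LINT x|unit_measure. LINT y|unit_measure. F (step_graphon n A (x, y)))
    = (LINT x|unit_measure. LINT y|unit_measure. F (A (gidx n x) (gidx n y)))"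
    by (intro Bochner_Integration.integral_cong refl) (simp add: step_graphon_apply del: atLeastAtMost_iff)
  also have "\<dots> = (LINT x|unit_measure. (\<Sum>j=1..n. F (A (gidx n x) j)) / n)"
    by (intro Bochner_Integration.integral_cong refl integral_gidx assms)
  also have "\<dots> = (\<Sum>i=1..n. (\<Sum>j=1..n. F (A i j)) / n) / n"
    by (rule integral_gidx[OF assms, where g = "\<lambda>i. (\<Sum>j=1..n. F (A i j)) / n"])
  finally show ?thesis by (simp add: power2_eq_square sum_divide_distrib)
qed

lemma graphon_rate_step:
  "0 < n \<Longrightarrow> graphon_rate p (step_graphon n A) = (\<Sum>i=1..n. \<Sum>j=1..n. rate p (A i j)) / (real n)\<^sup>2"
  by (simp add: graphon_rate_def iterated_integral_step)

lemma triangle_density_step: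
  assumes "0 < n"
  shows "triangle_density (step_graphon n A)
    = (\<Sum>i=1..n. \<Sum>j=1..n. \<Sum>k=1..n. A i j * A j k * A k i) / (6 * real n ^ 3)"
proof -
  let ?F = "\<lambda>i j k. A i j * A j k * A k i"
  have "(LINT x|unit_measure. LINT y|unit_measure. LINT z|unit_measure.
      step_graphon n A (x, y) * step_graphon n A (y, z) * step_graphon n A (z, x))
    = (LINT x|unit_measure. LINT y|unit_measure. LINT z|unit_measure. ?F (gidx n x) (gidx n y) (gidx n z))"
    by (intro Bochner_Integration.integral_cong refl) (simp add: step_graphon_apply del: atLeastAtMost_iff)
  also have "\<dots> = (LINT x|unit_measure. LINT y|unit_measure. (\<Sum>k=1..n. ?F (gidx n x) (gidx n y) k) / n)"
    by (intro Bochner_Integration.integral_cong refl integral_gidx assms)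
  also have "\<dots> = (LINT x|unit_measure. (\<Sum>j=1..n. (\<Sum>k=1..n. ?F (gidx n x) j k) / n) / n)"
    by (intro Bochner_Integration.integral_cong refl
        integral_gidx[OF assms, where g = "\<lambda>j. (\<Sum>k=1..n. ?F (gidx n x) j k) / n" for x])
  also have "\<dots> = (\<Sum>i=1..n. (\<Sum>j=1..n. (\<Sum>k=1..n. ?F i j k) / n) / n) / n"
    by (rule integral_gidx[OF assms, where g = "\<lambda>i. (\<Sum>j=1..n. (\<Sum>k=1..n. ?F i j k) / n) / n"])
  also have "\<dots> = (\<Sum>i=1..n. \<Sum>j=1..n. \<Sum>k=1..n. ?F i j k) / (real n * real n * real n)"
    by (simp flip: sum_divide_distrib add: mult.assoc)
  finally show ?thesis
    by (simp add: triangle_density_def power3_eq_cube)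
qed

text \<open>A linear form on the box [0, u]^V is largest at a vertex, namely u times the indicator
  of the positive coefficients. Passing to -F gives the other sign.\<close>

lemma linear_form_bound:
  fixes F s :: "'a \<Rightarrow> real"
  assumes fin: "finite V" and F: "\<And>S. S \<subseteq> V \<Longrightarrow> \<bar>sum F S\<bar> \<le> C"
    and s: "\<And>i. i \<in> V \<Longrightarrow> 0 \<le> s i \<and> s i \<le> u"
    and u: "0 \<le> u"
  shows "\<bar>\<Sum>i\<in>V. F i * s i\<bar> \<le> C * u"
proof -
  have up: "(\<Sum>i\<in>V. G i * s i) \<le> C * u" if G: "\<And>S. S \<subseteq> V \<Longrightarrow> \<bar>sum G S\<bar> \<le> C" for G :: "'a \<Rightarrow> real"
  proof -
    have "(\<Sum>i\<in>V. G i * s i) \<le> (\<Sum>i\<in>V. if 0 < G i then G i * u else 0)"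
    proof (rule sum_mono)
      fix i assume "i \<in> V"
      then show "G i * s i \<le> (if 0 < G i then G i * u else 0)"
        using s[of i] by (auto simp: mult_nonpos_nonneg)
    qed
    also have "\<dots> = sum G {i\<in>V. 0 < G i} * u"
      by (simp add: sum.If_cases[OF fin] Int_def sum_distrib_right conj_commute)
    also have "\<dots> \<le> C * u" using G[of "{i\<in>V. 0 < G i}"] u by (intro mult_right_mono) auto
    finally show ?thesis .
  qed
  have "(\<Sum>i\<in>V. - F i * s i) \<le> C * u"
    by (rule up) (use F in \<open>simp add: sum_negf\<close>)
  then show ?thesis using up[of F] F by (simp add: sum_negf abs_le_iff)
qed

text \<open>Fixing one argument leaves a linear form, so vertices of the box are reached one
  variable at a time. This leads from sets of indices to fractional weights.\<close>

lemma bilinear_form_bound: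
  fixes D :: "'a \<Rightarrow> 'b \<Rightarrow> real"
  assumes fin: "finite V" "finite W" and D: "\<And>S T. S \<subseteq> V \<Longrightarrow> T \<subseteq> W \<Longrightarrow> \<bar>\<Sum>i\<in>S. \<Sum>j\<in>T. D i j\<bar> \<le> C"
    and s: "\<And>i. i \<in> V \<Longrightarrow> 0 \<le> s i \<and> s i \<le> u" and t: "\<And>j. j \<in> W \<Longrightarrow> 0 \<le> t j \<and> t j \<le> u"
    and u: "0 \<le> u"
  shows "\<bar>\<Sum>i\<in>V. \<Sum>j\<in>W. D i j * s i * t j\<bar> \<le> C * u * u"
proof -
  have "\<bar>\<Sum>i\<in>S. \<Sum>j\<in>W. D i j * t j\<bar> \<le> C * u" if S: "S \<subseteq> V" for S
  proof -
    have "\<bar>\<Sum>j\<in>W. (\<Sum>i\<in>S. D i j) * t j\<bar> \<le> C * u"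
      by (rule linear_form_bound[OF fin(2) _ t u]) (use D S in \<open>simp_all add: sum.swap[of _ S]\<close>)
    then show ?thesis by (simp add: sum.swap[of _ S] sum_distrib_right)
  qed
  then have "\<bar>\<Sum>i\<in>V. (\<Sum>j\<in>W. D i j * t j) * s i\<bar> \<le> C * u * u"
    by (intro linear_form_bound[OF fin(1) _ s u])
  moreover have "(\<Sum>i\<in>V. (\<Sum>j\<in>W. D i j * t j) * s i) = (\<Sum>i\<in>V. \<Sum>j\<in>W. D i j * s i * t j)"
    unfolding sum_distrib_right by (intro sum.cong refl) (simp add: mult_ac)
  ultimately show ?thesis by simp
qed

text \<open>A measurable rectangle sees a step function only through the measures of S and T inside
  the cells. These are weights in [0, 1/n], so a bound for sets of indices suffices.\<close>

lemma cut_dist_step_le: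
  assumes n: "0 < n" and c: "\<And>S T. S \<subseteq> {1..n} \<Longrightarrow> T \<subseteq> {1..n} \<Longrightarrow>
      \<bar>\<Sum>z\<in>S \<times> T. A (fst z) (snd z) - B (fst z) (snd z)\<bar> \<le> c * (real n)\<^sup>2"
  shows "cut_dist (step_graphon n A) (step_graphon n B) \<le> c"
proof (rule cut_dist_least)
  fix S T assume ST [measurable]: "S \<in> sets unit_measure" "T \<in> sets unit_measure"
  define D where "D i j = A i j - B i j" for i j
  define s t where "s i = measure unit_measure (S \<inter> cell n i)" and "t i = measure unit_measure (T \<inter> cell n i)" for i
  let ?R = "\<lambda>i j. (S \<inter> cell n i) \<times> (T \<inter> cell n j)"
  have st: "0 \<le> s i \<and> s i \<le> 1 / n" "0 \<le> t i \<and> t i \<le> 1 / n" if "i \<in> {1..n}" for i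
    using that measure_cell[of i n] unit_measure.finite_measure_mono[of "S \<inter> cell n i" "cell n i"]
      unit_measure.finite_measure_mono[of "T \<inter> cell n i" "cell n i"] by (auto simp: s_def t_def)
  \<comment> \<open>Cell 0 is null, so the entries of A and B with index 0 may be arbitrary.\<close>
  have st0: "s 0 = 0" "t 0 = 0"
    using measure_cell_0[OF n] unit_measure.finite_measure_mono[of "S \<inter> cell n 0" "cell n 0"]
      unit_measure.finite_measure_mono[of "T \<inter> cell n 0" "cell n 0"] by (auto simp: s_def t_def measure_le_0_iff)
  have "(LINT z : S \<times> T | square_measure. step_graphon n A z - step_graphon n B z)
      = (LINT z | square_measure. (\<Sum>i\<le>n. \<Sum>j\<le>n. D i j * indicator (?R i j) z))"
    unfolding set_lebesgue_integral_def
  proof (intro Bochner_Integration.integral_cong refl)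
    fix z assume "z \<in> space square_measure"
    then obtain x y where z: "z = (x, y)" "x \<in> {0..1}" "y \<in> {0..1}" by (auto simp: space_square)
    have "(\<Sum>i\<le>n. \<Sum>j\<le>n. D i j * indicator (?R i j) z)
        = indicator S x * indicator T y * (\<Sum>i\<le>n. (\<Sum>j\<le>n. D i j * indicator (cell n j) y) * indicator (cell n i) x)"
      unfolding sum_distrib_left sum_distrib_right
      by (intro sum.cong refl) (auto simp: z indicator_def)
    also have "\<dots> = indicator S x * indicator T y * D (gidx n x) (gidx n y)"
      by (simp only: sum_indicator_cell[OF z(2)] sum_indicator_cell[OF z(3)])
    finally show "indicator (S \<times> T) z *\<^sub>R (step_graphon n A z - step_graphon n B z)
        = (\<Sum>i\<le>n. \<Sum>j\<le>n. D i j * indicator (?R i j) z)"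
      using z by (simp add: step_graphon_apply D_def indicator_def del: atLeastAtMost_iff)
  qed
  also have "\<dots> = (\<Sum>i\<le>n. \<Sum>j\<le>n. D i j * measure square_measure (?R i j))"
  proof -
    have R: "?R i j \<in> sets square_measure" for i j by measurable
    have int: "integrable square_measure (\<lambda>z. D i j * indicator (?R i j) z)" for i j
      using R by (intro integrable_mult_right integrable_real_indicator)
        (auto simp: square_measure.P.emeasure_eq_measure)
    have "(LINT z | square_measure. D i j * indicator (?R i j) z) = D i j * measure square_measure (?R i j)" for i j
      using R[of i j] by (simp add: sets.Int_space_eq2)
    moreover have "(LINT z | square_measure. (\<Sum>i\<le>n. \<Sum>j\<le>n. D i j * indicator (?R i j) z))
        = (\<Sum>i\<le>n. LINT z | square_measure. (\<Sum>j\<le>n. D i j * indicator (?R i j) z))"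
      by (intro Bochner_Integration.integral_sum Bochner_Integration.integrable_sum int)
    moreover have "(LINT z | square_measure. (\<Sum>j\<le>n. D i j * indicator (?R i j) z))
        = (\<Sum>j\<le>n. LINT z | square_measure. D i j * indicator (?R i j) z)" for i
      by (intro Bochner_Integration.integral_sum int)
    ultimately show ?thesis by simp
  qed
  also have "\<dots> = (\<Sum>i\<le>n. \<Sum>j\<le>n. D i j * s i * t j)"
  proof (intro sum.cong refl)
    fix i j
    have "measure square_measure (?R i j) = s i * t j"
      unfolding s_def t_def measure_def
      by (subst unit_measure.emeasure_pair_measure_Times) (simp_all add: enn2real_mult)
    then show "D i j * measure square_measure (?R i j) = D i j * s i * t j" by simp
  qed
  also have "\<dots> = (\<Sum>i=1..n. \<Sum>j=1..n. D i j * s i * t j)"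
    by (simp add: sum_atMost_eq st0)
  also have "\<bar>\<dots>\<bar> \<le> (c * (real n)\<^sup>2) * (1 / n) * (1 / n)"
    by (rule bilinear_form_bound)
       (use c st in \<open>auto simp: D_def sum.cartesian_product case_prod_beta\<close>)
  also have "\<dots> = c" using n by (simp add: power2_eq_square)
  finally show "\<bar>LINT z : S \<times> T | square_measure. step_graphon n A z - step_graphon n B z\<bar> \<le> c" .
qed

section \<open>Counting in finite graphs\<close>

lemma finite_vertex_pairs: "finite (vertex_pairs n)"
  by (rule finite_subset[of _ "Pow {1..n}"]) (auto simp: vertex_pairs_def)

lemma set_pmf_erdos_renyi: "set_pmf (erdos_renyi n p) \<subseteq> Pow (vertex_pairs n)"
  by (auto simp: erdos_renyi_def)

text \<open>Functions in the support take the default value \<open>False\<close> off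
  \<open>vertex_pairs n\<close>, so the passage to edge sets is injective there and keeps the point
  masses.\<close>

lemma pmf_erdos_renyi:
  assumes p: "0 < p" "p < 1" and G: "G \<subseteq> vertex_pairs n"
  shows "pmf (erdos_renyi n p) G = edge_weight (vertex_pairs n) (\<lambda>_. p) G"
proof -
  let ?V = "vertex_pairs n"
  let ?M = "Pi_pmf ?V False (\<lambda>_. bernoulli_pmf p)" and ?f = "\<lambda>\<omega>. {e \<in> ?V. \<omega> e}"
  have inj: "inj_on ?f (set_pmf ?M)"
  proof (rule inj_onI)
    fix \<omega> \<omega>' assume a: "\<omega> \<in> set_pmf ?M" "\<omega>' \<in> set_pmf ?M" "?f \<omega> = ?f \<omega>'"
    show "\<omega> = \<omega>'"
    proof
      fix e
      show "\<omega> e = \<omega>' e"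
      proof (cases "e \<in> ?V")
        case True
        have "e \<in> ?f \<omega> \<longleftrightarrow> e \<in> ?f \<omega>'" by (simp only: a(3))
        then show ?thesis using True by simp
      next
        case False
        have "\<omega> \<in> {f. \<forall>x. x \<notin> ?V \<longrightarrow> f x = False}" "\<omega>' \<in> {f. \<forall>x. x \<notin> ?V \<longrightarrow> f x = False}"
          using subsetD[OF set_Pi_pmf_subset[OF finite_vertex_pairs] a(1)]
            subsetD[OF set_Pi_pmf_subset[OF finite_vertex_pairs] a(2)] .
        then show ?thesis using False by simp
      qed
    qed
  qed
  have pm: "pmf ?M (\<lambda>e. e \<in> G) = edge_weight ?V (\<lambda>_. p) G"
  proof -
    have "pmf ?M (\<lambda>e. e \<in> G) = (\<Prod>e\<in>?V. pmf (bernoulli_pmf p) (e \<in> G))"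
      using G by (intro pmf_Pi'[OF finite_vertex_pairs]) auto
    also have "\<dots> = edge_weight ?V (\<lambda>_. p) G"
      unfolding edge_weight_def using p by (intro prod.cong refl) simp
    finally show ?thesis .
  qed
  have "edge_weight ?V (\<lambda>_. p) G > 0" using p by (intro edge_weight_pos) auto
  then have "(\<lambda>e. e \<in> G) \<in> set_pmf ?M" using pm by (simp add: set_pmf_iff)
  from trans[OF pmf_map_inj[OF inj this] pm]
  have "pmf (map_pmf ?f ?M) (?f (\<lambda>e. e \<in> G)) = edge_weight ?V (\<lambda>_. p) G" .
  moreover have "?f (\<lambda>e. e \<in> G) = G" using G by auto
  ultimately show ?thesis by (simp add: erdos_renyi_def)
qed

lemma prob_erdos_renyi:
  assumes p: "0 < p" "p < 1"
  shows "\<P>(G in erdos_renyi n p. P G)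
    = (\<Sum>G\<in>{G \<in> Pow (vertex_pairs n). P G}. edge_weight (vertex_pairs n) (\<lambda>_. p) G)"
proof -
  let ?S = "{G \<in> Pow (vertex_pairs n). P G}" and ?M = "erdos_renyi n p"
  have fin: "finite ?S" using finite_vertex_pairs by simp
  have "measure ?M {G. P G} = measure ?M ({G. P G} \<inter> set_pmf ?M)" by (simp add: measure_Int_set_pmf)
  also have "{G. P G} \<inter> set_pmf ?M = ?S \<inter> set_pmf ?M" using set_pmf_erdos_renyi[of n p] by blast
  also have "measure ?M \<dots> = measure ?M ?S" by (simp add: measure_Int_set_pmf)
  also have "\<dots> = sum (pmf ?M) ?S" by (rule measure_measure_pmf_finite[OF fin])
  finally show ?thesis using pmf_erdos_renyi[OF p] by simp
qed

text \<open>Every edge has exactly two orderings; this factor 2 meets the 1/2 in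
  \<open>rate\<close>.\<close>

lemma sum_vertex_pairs:
  fixes g :: "nat set \<Rightarrow> real"
  shows "(\<Sum>(i, j)\<in>{(i, j). i \<in> {1..n} \<and> j \<in> {1..n} \<and> i \<noteq> j}. g {i, j}) = 2 * (\<Sum>e\<in>vertex_pairs n. g e)"
proof -
  let ?X = "{(i, j). i \<in> {1..n} \<and> j \<in> {1..n} \<and> i \<noteq> j}" and ?\<pi> = "\<lambda>(i, j). {i, j}"
  have finX: "finite ?X" by (rule finite_subset[of _ "{1..n} \<times> {1..n}"]) auto
  have "(\<Sum>z\<in>{z\<in>?X. ?\<pi> z = e}. g (?\<pi> z)) = 2 * g e" if "e \<in> vertex_pairs n" for e
  proof -
    have e: "card e = 2" "e \<subseteq> {1..n}" using that by (auto simp: vertex_pairs_def)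
    then obtain a b where ab: "e = {a, b}" "a \<noteq> b" by (auto simp: card_2_iff)
    have "{z\<in>?X. ?\<pi> z = e} = {(a, b), (b, a)}"
      using ab e(2) by (auto simp: doubleton_eq_iff)
    then show ?thesis using ab by (simp add: insert_commute)
  qed
  then have "2 * (\<Sum>e\<in>vertex_pairs n. g e) = (\<Sum>e\<in>vertex_pairs n. \<Sum>z\<in>{z\<in>?X. ?\<pi> z = e}. g (?\<pi> z))"
    unfolding sum_distrib_left by (intro sum.cong refl) (simp only:)
  also have "\<dots> = (\<Sum>z\<in>?X. g (?\<pi> z))"
    by (rule sum.group[OF finX finite_vertex_pairs]) (auto simp: vertex_pairs_def)
  also have "\<dots> = (\<Sum>(i, j)\<in>?X. g {i, j})" by (rule sum.cong) auto
  finally show ?thesis ..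
qed

section \<open>Triangle counts and their second moment\<close>

definition vertex_triples :: "nat \<Rightarrow> nat set set" where
  "vertex_triples n = {A. A \<subseteq> {1..n} \<and> card A = 3}"

definition edges_of :: "'a set \<Rightarrow> 'a set set" where
  "edges_of A = {e. e \<subseteq> A \<and> card e = 2}"

lemma finite_vertex_triples: "finite (vertex_triples n)"
  by (rule finite_subset[of _ "Pow {1..n}"]) (auto simp: vertex_triples_def)

lemma edges_of_triple:
  assumes "i \<noteq> j" "j \<noteq> k" "k \<noteq> i"
  shows "edges_of {i, j, k} = {{i, j}, {j, k}, {k, i}}"
proof (rule set_eqI)
  fix e
  show "e \<in> edges_of {i, j, k} \<longleftrightarrow> e \<in> {{i, j}, {j, k}, {k, i}}"
  proof
    assume "e \<in> edges_of {i, j, k}"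
    then obtain a b where "e = {a, b}" "a \<noteq> b" "a \<in> {i, j, k}" "b \<in> {i, j, k}"
      by (auto simp: edges_of_def card_2_iff)
    then show "e \<in> {{i, j}, {j, k}, {k, i}}" by auto
  next
    assume "e \<in> {{i, j}, {j, k}, {k, i}}"
    then show "e \<in> edges_of {i, j, k}" using assms by (auto simp: edges_of_def)
  qed
qed

text \<open>Every triple has exactly six orderings, in accordance with the 1/6 in
  \<open>triangle_density\<close>.\<close>

lemma sum_vertex_triples:
  fixes h :: "nat set \<Rightarrow> real"
  shows "(\<Sum>(i, j, k)\<in>{(i, j, k). i \<in> {1..n} \<and> j \<in> {1..n} \<and> k \<in> {1..n} \<and> i \<noteq> j \<and> j \<noteq> k \<and> k \<noteq> i}. h {i, j, k})
    = 6 * (\<Sum>A\<in>vertex_triples n. h A)"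
proof -
  let ?X = "{(i, j, k). i \<in> {1..n} \<and> j \<in> {1..n} \<and> k \<in> {1..n} \<and> i \<noteq> j \<and> j \<noteq> k \<and> k \<noteq> i}"
  let ?\<pi> = "\<lambda>(i, j, k). {i, j, k}"
  have finX: "finite ?X" by (rule finite_subset[of _ "{1..n} \<times> {1..n} \<times> {1..n}"]) auto
  have "(\<Sum>z\<in>{z\<in>?X. ?\<pi> z = A}. h (?\<pi> z)) = 6 * h A" if "A \<in> vertex_triples n" for A
  proof -
    have A: "card A = 3" "A \<subseteq> {1..n}" using that by (auto simp: vertex_triples_def)
    then obtain a b c where abc: "A = {a, b, c}" "a \<noteq> b" "b \<noteq> c" "a \<noteq> c" by (auto simp: card_3_iff)
    have "{z\<in>?X. ?\<pi> z = A} = {(a,b,c), (a,c,b), (b,a,c), (b,c,a), (c,a,b), (c,b,a)}"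
    proof (intro equalityI subsetI)
      fix z assume "z \<in> {z\<in>?X. ?\<pi> z = A}"
      then obtain i j k where z: "z = (i, j, k)" "i \<noteq> j" "j \<noteq> k" "k \<noteq> i" "{i, j, k} = {a, b, c}"
        using abc by auto
      then have "i \<in> {a, b, c}" "j \<in> {a, b, c}" "k \<in> {a, b, c}" by blast+
      then show "z \<in> {(a,b,c), (a,c,b), (b,a,c), (b,c,a), (c,a,b), (c,b,a)}" using z by auto
    next
      fix z assume z: "z \<in> {(a,b,c), (a,c,b), (b,a,c), (b,c,a), (c,a,b), (c,b,a)}"
      have "a \<in> {1..n}" "b \<in> {1..n}" "c \<in> {1..n}" using A abc by blast+
      then show "z \<in> {z\<in>?X. ?\<pi> z = A}" using z abc by auto
    qed
    moreover have "(\<Sum>z\<in>{z\<in>?X. ?\<pi> z = A}. h (?\<pi> z)) = (\<Sum>z\<in>{z\<in>?X. ?\<pi> z = A}. h A)"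
      by (rule sum.cong) auto
    ultimately show ?thesis using abc by simp
  qed
  then have "6 * (\<Sum>A\<in>vertex_triples n. h A) = (\<Sum>A\<in>vertex_triples n. \<Sum>z\<in>{z\<in>?X. ?\<pi> z = A}. h (?\<pi> z))"
    unfolding sum_distrib_left by (intro sum.cong refl) (simp only:)
  also have "\<dots> = (\<Sum>z\<in>?X. h (?\<pi> z))"
    by (rule sum.group[OF finX finite_vertex_triples]) (auto simp: vertex_triples_def)
  also have "\<dots> = (\<Sum>(i, j, k)\<in>?X. h {i, j, k})" by (rule sum.cong) auto
  finally show ?thesis ..
qed

lemma triangles_eq: "real (triangles n E) = (\<Sum>A\<in>vertex_triples n. of_bool (edges_of A \<subseteq> E))"
proof -
  have "{A. A \<subseteq> {1..n} \<and> card A = 3 \<and> (\<forall>e. e \<subseteq> A \<and> card e = 2 \<longrightarrow> e \<in> E)}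
      = {A \<in> vertex_triples n. edges_of A \<subseteq> E}"
    by (auto simp: vertex_triples_def edges_of_def)
  then show ?thesis
    by (simp add: triangles_def of_bool_def sum.If_cases[OF finite_vertex_triples] Int_def conj_commute)
qed

text \<open>A singleton is never an edge, so triples with a repeated vertex contribute 0 and the
  identity is exact.\<close>

lemma triangles_hom_count:
  assumes E: "E \<subseteq> vertex_pairs n"
  shows "(\<Sum>i=1..n. \<Sum>j=1..n. \<Sum>k=1..n. of_bool ({i, j} \<in> E) * of_bool ({j, k} \<in> E) * of_bool ({k, i} \<in> E))
    = 6 * real (triangles n E)"
proof -
  let ?X = "{(i, j, k). i \<in> {1..n} \<and> j \<in> {1..n} \<and> k \<in> {1..n} \<and> i \<noteq> j \<and> j \<noteq> k \<and> k \<noteq> i}"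
  let ?f = "\<lambda>i j k. of_bool ({i, j} \<in> E) * of_bool ({j, k} \<in> E) * of_bool ({k, i} \<in> E) :: real"
  have ne: "{i, i} \<notin> E" for i using E by (auto simp: vertex_pairs_def)
  have "(\<Sum>i=1..n. \<Sum>j=1..n. \<Sum>k=1..n. ?f i j k)
      = (\<Sum>(i, j, k)\<in>{1..n} \<times> {1..n} \<times> {1..n}. ?f i j k)"
    by (simp only: sum.cartesian_product case_prod_beta fst_conv snd_conv)
  also have "\<dots> = (\<Sum>(i, j, k)\<in>?X. ?f i j k)"
    by (rule sum.mono_neutral_right) (use ne in auto)
  also have "\<dots> = (\<Sum>(i, j, k)\<in>?X. of_bool (edges_of {i, j, k} \<subseteq> E))"
    by (rule sum.cong) (auto simp: edges_of_triple)
  also have "\<dots> = 6 * real (triangles n E)"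
    by (simp only: sum_vertex_triples[of "\<lambda>A. of_bool (edges_of A \<subseteq> E)"] triangles_eq)
  finally show ?thesis .
qed

text \<open>Chebyshev's inequality. Copies with disjoint edge sets are independent, so only
  overlapping pairs enter the variance, each with at most 1.\<close>

lemma subgraph_count_concentration:
  fixes q :: "'a \<Rightarrow> real" and \<A> :: "'b set" and F :: "'b \<Rightarrow> 'a set"
  assumes fin: "finite V" "finite \<A>" and F: "\<And>A. A \<in> \<A> \<Longrightarrow> F A \<subseteq> V"
    and q: "\<And>e. e \<in> V \<Longrightarrow> 0 \<le> q e \<and> q e \<le> 1" and s: "0 < s"
  shows "(\<Sum>G\<in>{G\<in>Pow V. (\<Sum>A\<in>\<A>. of_bool (F A \<subseteq> G)) < (\<Sum>A\<in>\<A>. \<Prod>e\<in>F A. q e) - s}. edge_weight V q G)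
    \<le> real (card {(A, B) \<in> \<A> \<times> \<A>. F A \<inter> F B \<noteq> {}}) / s\<^sup>2"
proof -
  let ?w = "edge_weight V q"
  define N where "N G = (\<Sum>A\<in>\<A>. of_bool (F A \<subseteq> G) :: real)" for G
  define \<mu> where "\<mu> = (\<Sum>A\<in>\<A>. \<Prod>e\<in>F A. q e)"
  let ?I = "{(A, B) \<in> \<A> \<times> \<A>. F A \<inter> F B \<noteq> {}}" and ?S = "{G\<in>Pow V. N G < \<mu> - s}"
  have w0: "0 \<le> ?w G" for G by (rule edge_weight_nonneg[OF q])
  have finP: "finite (Pow V)" using fin by simp
  have finF: "finite (F A)" if "A \<in> \<A>" for A using F[OF that] fin(1) finite_subset by blast
  have EN: "(\<Sum>G\<in>Pow V. ?w G * N G) = \<mu>"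
  proof -
    have "(\<Sum>G\<in>Pow V. ?w G * N G) = (\<Sum>A\<in>\<A>. \<Sum>G\<in>Pow V. ?w G * of_bool (F A \<subseteq> G))"
      unfolding N_def by (subst sum.swap) (simp add: sum_distrib_left)
    then show ?thesis unfolding \<mu>_def using sum_edge_weight_superset[OF fin(1) F] by simp
  qed
  have N2: "(N G)\<^sup>2 = (\<Sum>(A, B)\<in>\<A> \<times> \<A>. of_bool (F A \<union> F B \<subseteq> G))" for G
    unfolding N_def power2_eq_square sum_product sum.cartesian_product
    by (intro sum.cong refl) (auto simp: of_bool_def)
  have "(\<Sum>G\<in>Pow V. ?w G * (N G)\<^sup>2) = (\<Sum>(A, B)\<in>\<A> \<times> \<A>. \<Sum>G\<in>Pow V. ?w G * of_bool (F A \<union> F B \<subseteq> G))"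
    unfolding N2 case_prod_beta by (subst sum.swap) (simp add: sum_distrib_left)
  also have "\<dots> = (\<Sum>(A, B)\<in>\<A> \<times> \<A>. \<Prod>e\<in>F A \<union> F B. q e)"
  proof (rule sum.cong[OF refl], clarify)
    fix A B assume "A \<in> \<A>" "B \<in> \<A>"
    then have "F A \<union> F B \<subseteq> V" using F by blast
    then show "(\<Sum>G\<in>Pow V. ?w G * of_bool (F A \<union> F B \<subseteq> G)) = (\<Prod>e\<in>F A \<union> F B. q e)"
      by (rule sum_edge_weight_superset[OF fin(1)])
  qed
  also have "\<dots> \<le> (\<Sum>(A, B)\<in>\<A> \<times> \<A>. (\<Prod>e\<in>F A. q e) * (\<Prod>e\<in>F B. q e) + of_bool (F A \<inter> F B \<noteq> {}))"
  proof (rule sum_mono, clarify)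
    fix A B assume AB: "A \<in> \<A>" "B \<in> \<A>"
    have p01: "0 \<le> prod q (F A)" "0 \<le> prod q (F B)" "prod q (F A \<union> F B) \<le> 1"
      by (intro prod_nonneg prod_le_1; use q F AB in blast)+
    show "prod q (F A \<union> F B) \<le> prod q (F A) * prod q (F B) + of_bool (F A \<inter> F B \<noteq> {})"
    proof (cases "F A \<inter> F B = {}")
      case True
      then show ?thesis using finF AB by (simp add: prod.union_disjoint)
    next
      case False
      have "prod q (F A \<union> F B) \<le> prod q (F A) * prod q (F B) + 1"
        using p01(3) mult_nonneg_nonneg[OF p01(1,2)] by linarith
      then show ?thesis using False by simp
    qed
  qed
  also have "\<dots> = \<mu>\<^sup>2 + real (card ?I)"
  proof -
    have "(\<Sum>(A, B)\<in>\<A> \<times> \<A>. (\<Prod>e\<in>F A. q e) * (\<Prod>e\<in>F B. q e)) = \<mu>\<^sup>2"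
      unfolding \<mu>_def power2_eq_square sum_product sum.cartesian_product ..
    moreover have "(\<Sum>(A, B)\<in>\<A> \<times> \<A>. of_bool (F A \<inter> F B \<noteq> {}) :: real) = real (card ?I)"
    proof -
      have "(\<Sum>z\<in>\<A> \<times> \<A>. of_bool (F (fst z) \<inter> F (snd z) \<noteq> {}) :: real)
          = real (card {z \<in> \<A> \<times> \<A>. F (fst z) \<inter> F (snd z) \<noteq> {}})"
      proof -
        have "\<A> \<times> \<A> \<inter> {z. F (fst z) \<inter> F (snd z) \<noteq> {}} = {z \<in> \<A> \<times> \<A>. F (fst z) \<inter> F (snd z) \<noteq> {}}"
          by auto
        moreover have "(\<Sum>z\<in>\<A> \<times> \<A>. of_bool (F (fst z) \<inter> F (snd z) \<noteq> {}) :: real)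
            = real (card (\<A> \<times> \<A> \<inter> {z. F (fst z) \<inter> F (snd z) \<noteq> {}}))"
          by (rule sum_of_bool_eq) (use fin in auto)
        ultimately show ?thesis by (simp only:)
      qed
      moreover have "{z \<in> \<A> \<times> \<A>. F (fst z) \<inter> F (snd z) \<noteq> {}} = ?I" by auto
      ultimately show ?thesis by (simp add: case_prod_beta)
    qed
    ultimately show ?thesis by (simp add: case_prod_beta sum.distrib)
  qed
  finally have EN2: "(\<Sum>G\<in>Pow V. ?w G * (N G)\<^sup>2) \<le> \<mu>\<^sup>2 + real (card ?I)" .
  have "s\<^sup>2 * sum ?w ?S = (\<Sum>G\<in>?S. ?w G * s\<^sup>2)" by (simp add: sum_distrib_left mult.commute)
  also have "\<dots> \<le> (\<Sum>G\<in>?S. ?w G * (N G - \<mu>)\<^sup>2)"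
  proof (rule sum_mono)
    fix G assume "G \<in> ?S"
    then have "s \<le> \<bar>N G - \<mu>\<bar>" by auto
    then have "s\<^sup>2 \<le> (N G - \<mu>)\<^sup>2" using s by (metis abs_of_pos abs_le_square_iff)
    then show "?w G * s\<^sup>2 \<le> ?w G * (N G - \<mu>)\<^sup>2" using w0 by (rule mult_left_mono)
  qed
  also have "\<dots> \<le> (\<Sum>G\<in>Pow V. ?w G * (N G - \<mu>)\<^sup>2)"
    by (rule sum_mono2[OF finP]) (use w0 in auto)
  also have "\<dots> = (\<Sum>G\<in>Pow V. ?w G * (N G)\<^sup>2 - (2 * \<mu>) * (?w G * N G) + \<mu>\<^sup>2 * ?w G)"
    by (intro sum.cong refl) (simp add: power2_eq_square algebra_simps)
  also have "\<dots> = (\<Sum>G\<in>Pow V. ?w G * (N G)\<^sup>2) - 2 * \<mu> * \<mu> + \<mu>\<^sup>2"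
    by (simp add: sum.distrib sum_subtractf EN sum_edge_weight[OF fin(1)] flip: sum_distrib_left)
  also have "\<dots> \<le> real (card ?I)" using EN2 by (simp add: power2_eq_square)
  finally have "sum ?w ?S \<le> real (card ?I) / s\<^sup>2" using s by (simp add: field_simps)
  then show ?thesis by (simp add: N_def \<mu>_def)
qed

text \<open>Two triples that share an edge are determined by its two ends and the two third
  vertices. Against deviations of order n^3 this makes Chebyshev's bound of order n^-2.\<close>

lemma card_overlapping_triples:
  "card {(A, B) \<in> vertex_triples n \<times> vertex_triples n. edges_of A \<inter> edges_of B \<noteq> {}} \<le> n ^ 4"
proof -
  let ?f = "\<lambda>(i, j, k, l). ({i, j, k}, {i, j, l})"
  let ?Q = "{1..n} \<times> {1..n} \<times> {1..n} \<times> {1..n}"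
  have "{(A, B) \<in> vertex_triples n \<times> vertex_triples n. edges_of A \<inter> edges_of B \<noteq> {}} \<subseteq> ?f ` ?Q"
  proof clarify
    fix A B assume A: "A \<in> vertex_triples n" and B: "B \<in> vertex_triples n" and "edges_of A \<inter> edges_of B \<noteq> {}"
    then obtain e where e: "e \<subseteq> A" "e \<subseteq> B" "card e = 2" by (auto simp: edges_of_def)
    obtain i j where ij: "e = {i, j}" "i \<noteq> j" using e(3) by (auto simp: card_2_iff)
    have third: "\<exists>k\<in>{1..n}. C = {i, j, k}" if "C \<in> vertex_triples n" "e \<subseteq> C" for C
    proof -
      have C: "C \<subseteq> {1..n}" "card C = 3" using that(1) by (auto simp: vertex_triples_def)
      then have "finite C" by (metis card.infinite zero_neq_numeral)
      have "card (C - e) = 1" using C e(3) that(2) by (simp add: card_Diff_subset finite_subset[OF that(2) \<open>finite C\<close>])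
      then obtain k where k: "C - e = {k}" by (metis One_nat_def card_1_singletonE)
      have "C = {k} \<union> e" using k that(2) by blast
      then have "C = {i, j, k}" using ij(1) by blast
      moreover have "k \<in> {1..n}" using k C(1) by blast
      ultimately show ?thesis by blast
    qed
    obtain k l where "k \<in> {1..n}" "A = {i, j, k}" "l \<in> {1..n}" "B = {i, j, l}"
      using third[OF A e(1)] third[OF B e(2)] by blast
    moreover have "i \<in> {1..n}" "j \<in> {1..n}" using ij e A by (auto simp: vertex_triples_def)
    ultimately show "(A, B) \<in> ?f ` ?Q" by (intro image_eqI[of _ _ "(i, j, k, l)"]) auto
  qed
  then have "card {(A, B) \<in> vertex_triples n \<times> vertex_triples n. edges_of A \<inter> edges_of B \<noteq> {}} \<le> card (?f ` ?Q)"
    by (intro card_mono) auto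
  also have "\<dots> \<le> card ?Q" by (rule card_image_le) auto
  also have "\<dots> = n ^ 4" by (simp add: card_cartesian_product power4_eq_xxxx)
  finally show ?thesis .
qed

section \<open>Counting lemma and rate function\<close>

text \<open>The continuous counterpart of \<open>linear_form_bound\<close>: among test functions
  with values in [0, 1], the indicator of the set where F is positive maximises the
  integral.\<close>

lemma integral_test_bound:
  fixes F a :: "'a \<Rightarrow> real"
  assumes F: "integrable M F" and C: "\<And>S. S \<in> sets M \<Longrightarrow> \<bar>LINT x|M. indicator S x * F x\<bar> \<le> C"
    and a: "a \<in> borel_measurable M" "\<And>x. x \<in> space M \<Longrightarrow> 0 \<le> a x \<and> a x \<le> 1"
  shows "\<bar>LINT x|M. a x * F x\<bar> \<le> C"
proof -
  have up: "(LINT x|M. a x * G x) \<le> C"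
    if G: "integrable M G" and CG: "\<And>S. S \<in> sets M \<Longrightarrow> \<bar>LINT x|M. indicator S x * G x\<bar> \<le> C" for G
  proof -
    have [measurable]: "G \<in> borel_measurable M" "a \<in> borel_measurable M" using G a by auto
    define S where "S = {x \<in> space M. 0 < G x}"
    have S [measurable]: "S \<in> sets M" unfolding S_def by measurable
    have int: "integrable M (\<lambda>x. indicator S x * G x)"
      by (rule Bochner_Integration.integrable_bound[OF G]) (auto simp: indicator_def)
    have "(LINT x|M. a x * G x) \<le> (LINT x|M. indicator S x * G x)"
    proof (rule integral_mono[OF _ int])
      show "integrable M (\<lambda>x. a x * G x)"
      proof (rule Bochner_Integration.integrable_bound[OF G])
        show "AE x in M. norm (a x * G x) \<le> norm (G x)"
          using a(2) by (intro AE_I2) (auto simp: abs_mult mult_left_le_one_le)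
      qed simp
      show "a x * G x \<le> indicator S x * G x" if "x \<in> space M" for x
        using a(2)[OF that] that by (auto simp: S_def indicator_def mult_left_le_one_le mult_nonneg_nonpos)
    qed
    also have "\<dots> \<le> C" using CG[OF S] by simp
    finally show ?thesis .
  qed
  have "(LINT x|M. a x * - F x) \<le> C"
    by (rule up) (use F C in simp_all)
  then show ?thesis using up[OF F C] by simp
qed

text \<open>A class wide enough to contain the differences of graphons as well.\<close>

definition bounded_kernels :: "(real \<times> real \<Rightarrow> real) set" where
  "bounded_kernels = {u \<in> borel_measurable square_measure. \<forall>z\<in>space square_measure. \<bar>u z\<bar> \<le> 1}"

lemma bounded_kernelsD:
  assumes "u \<in> bounded_kernels"
  shows "u \<in> borel_measurable square_measure"
    and "x \<in> {0..1} \<Longrightarrow> y \<in> {0..1} \<Longrightarrow> \<bar>u (x, y)\<bar> \<le> 1"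
  using assms by (auto simp: bounded_kernels_def space_square simp del: atLeastAtMost_iff)

lemma graphon_bounded_kernel: "f \<in> graphons \<Longrightarrow> f \<in> bounded_kernels"
  using graphonD[of f] by (force simp: bounded_kernels_def space_square)

lemma graphon_diff_bounded_kernel:
  assumes "f \<in> graphons" "g \<in> graphons"
  shows "(\<lambda>z. f z - g z) \<in> bounded_kernels"
proof -
  have "\<bar>f z - g z\<bar> \<le> 1" if "z \<in> space square_measure" for z
  proof -
    have "f z \<in> {0..1}" "g z \<in> {0..1}"
      using that graphonD(2)[OF assms(1)] graphonD(2)[OF assms(2)] by (auto simp: space_square)
    then show ?thesis by auto
  qed
  then show ?thesis using graphonD(1)[OF assms(1)] graphonD(1)[OF assms(2)]
    by (simp add: bounded_kernels_def)
qed

lemma integrable_square_bounded: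
  fixes u :: "real \<times> real \<Rightarrow> real"
  assumes "u \<in> borel_measurable square_measure"
    "\<And>x y. x \<in> {0..1} \<Longrightarrow> y \<in> {0..1} \<Longrightarrow> \<bar>u (x, y)\<bar> \<le> B"
  shows "integrable square_measure u"
  by (rule square_measure.P.integrable_const_bound[where B = B])
     (use assms in \<open>auto intro!: AE_I2 simp: space_square simp del: atLeastAtMost_iff\<close>)

lemma integrable_unit_bounded:
  fixes u :: "real \<Rightarrow> real"
  assumes "u \<in> borel_measurable unit_measure" "\<And>x. x \<in> {0..1} \<Longrightarrow> \<bar>u x\<bar> \<le> B"
  shows "integrable unit_measure u"
  by (rule unit_measure.integrable_const_bound[where B = B])
     (use assms in \<open>auto intro!: AE_I2 simp del: atLeastAtMost_iff\<close>)

lemma abs_integral_unit_le: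
  fixes u :: "real \<Rightarrow> real"
  assumes "\<And>x. x \<in> {0..1} \<Longrightarrow> \<bar>u x\<bar> \<le> B"
  shows "\<bar>LINT x|unit_measure. u x\<bar> \<le> B"
proof (cases "integrable unit_measure u")
  case True
  have "norm (LINT x|unit_measure. u x) \<le> (LINT x|unit_measure. norm (u x))" by (rule integral_norm_bound)
  also have "\<dots> \<le> (LINT x|unit_measure. B)"
    by (rule integral_mono) (use True assms in auto)
  finally show ?thesis using unit_measure.prob_space by simp
next
  case False
  \<comment> \<open>A non-integrable function has integral 0, so only 0 \<le> B is left to
    show.\<close>
  have "\<bar>u 0\<bar> \<le> B" by (rule assms) simp
  then show ?thesis using False by (simp add: not_integrable_integral_eq)
qed

text \<open>\<open>integral_test_bound\<close> is used once in each variable: first T is relaxed to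
  the weight b while S is still a set, then S is relaxed to a. Fubini exchanges the order of
  integration in between.\<close>

lemma cut_dist_test:
  assumes fg: "f \<in> graphons" "g \<in> graphons"
    and a: "a \<in> borel_measurable unit_measure" "\<And>x. x \<in> {0..1} \<Longrightarrow> 0 \<le> a x \<and> a x \<le> 1"
    and b: "b \<in> borel_measurable unit_measure" "\<And>x. x \<in> {0..1} \<Longrightarrow> 0 \<le> b x \<and> b x \<le> 1"
  shows "\<bar>LINT y|unit_measure. LINT z|unit_measure. a y * (b z * (f (y, z) - g (y, z)))\<bar> \<le> cut_dist f g"
proof -
  define d where "d z = f z - g z" for z
  note [measurable] = a(1) b(1)
  have d [measurable]: "d \<in> borel_measurable square_measure"
    and d1: "\<And>x y. x \<in> {0..1} \<Longrightarrow> y \<in> {0..1} \<Longrightarrow> \<bar>d (x, y)\<bar> \<le> 1"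
    using bounded_kernelsD[OF graphon_diff_bounded_kernel[OF fg]] by (simp_all add: d_def[abs_def])
  have ab1: "\<bar>s * r\<bar> \<le> 1" if "\<bar>s\<bar> \<le> 1" "\<bar>r\<bar> \<le> 1" for s r :: real
    using mult_mono[of "\<bar>s\<bar>" 1 "\<bar>r\<bar>" 1] that by (simp add: abs_mult)
  have b1: "\<bar>b x\<bar> \<le> 1" if "x \<in> {0..1}" for x using b(2)[OF that] by simp
  have i1: "\<bar>indicat_real S x\<bar> \<le> 1" for S :: "real set" and x by (simp add: indicator_def)
  have "\<bar>LINT y|unit_measure. a y * (LINT z|unit_measure. b z * d (y, z))\<bar> \<le> cut_dist f g"
  proof (rule integral_test_bound[OF _ _ a(1)])
    show "integrable unit_measure (\<lambda>y. LINT z|unit_measure. b z * d (y, z))"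
      by (rule integrable_unit_bounded[where B = 1], measurable)
         (intro abs_integral_unit_le ab1 b1 d1)
    fix S assume S [measurable]: "S \<in> sets unit_measure"
    have "\<bar>LINT z|unit_measure. b z * (LINT y|unit_measure. indicator S y * d (y, z))\<bar> \<le> cut_dist f g"
    proof (rule integral_test_bound[OF _ _ b(1)])
      show "integrable unit_measure (\<lambda>z. LINT y|unit_measure. indicator S y * d (y, z))"
        by (rule integrable_unit_bounded[where B = 1], measurable)
           (intro abs_integral_unit_le ab1 i1 d1)
      fix T assume T [measurable]: "T \<in> sets unit_measure"
      have "(LINT z|unit_measure. indicator T z * (LINT y|unit_measure. indicator S y * d (y, z)))
          = (LINT z|unit_measure. LINT y|unit_measure. indicator T z * (indicator S y * d (y, z)))"
        by simp
      also have "\<dots> = (LINT y|unit_measure. LINT z|unit_measure. indicator T z * (indicator S y * d (y, z)))"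
        by (rule square_measure.Fubini_integral, rule integrable_square_bounded[where B = 1])
           (simp_all add: case_prod_beta ab1 i1 d1 del: atLeastAtMost_iff)
      also have "\<dots> = (LINT w|square_measure. indicator (S \<times> T) w * d w)"
      proof -
        have "integrable square_measure (\<lambda>w. indicator (S \<times> T) w * d w)"
          by (rule integrable_square_bounded[where B = 1]) (simp_all add: ab1 i1 d1 del: atLeastAtMost_iff)
        from square_measure.integral_fst'[OF this]
        show ?thesis by (simp add: indicator_times mult_ac)
      qed
      finally show "\<bar>LINT z|unit_measure. indicator T z * (LINT y|unit_measure. indicator S y * d (y, z))\<bar> \<le> cut_dist f g"
        using cut_dist_upper[OF fg S T] by (simp add: set_lebesgue_integral_def d_def)
    qed (use b in auto)
    moreover have "(LINT z|unit_measure. b z * (LINT y|unit_measure. indicator S y * d (y, z)))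
        = (LINT y|unit_measure. indicator S y * (LINT z|unit_measure. b z * d (y, z)))"
    proof -
      have "(LINT z|unit_measure. b z * (LINT y|unit_measure. indicator S y * d (y, z)))
          = (LINT z|unit_measure. LINT y|unit_measure. b z * (indicator S y * d (y, z)))" by simp
      also have "\<dots> = (LINT y|unit_measure. LINT z|unit_measure. b z * (indicator S y * d (y, z)))"
        by (rule square_measure.Fubini_integral, rule integrable_square_bounded[where B = 1])
           (simp_all add: case_prod_beta ab1 b1 i1 d1 del: atLeastAtMost_iff)
      also have "\<dots> = (LINT y|unit_measure. LINT z|unit_measure. indicator S y * (b z * d (y, z)))"
        by (simp add: mult_ac)
      finally show ?thesis by simp
    qed
    ultimately show "\<bar>LINT y|unit_measure. indicator S y * (LINT z|unit_measure. b z * d (y, z))\<bar> \<le> cut_dist f g"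
      by simp
  qed (use a in auto)
  then show ?thesis by (simp add: d_def)
qed

text \<open>The trilinear form behind \<open>triangle_density\<close>, which allows the three
  factors to be exchanged one at a time.\<close>

definition triple_integral ::
  "(real \<times> real \<Rightarrow> real) \<Rightarrow> (real \<times> real \<Rightarrow> real) \<Rightarrow> (real \<times> real \<Rightarrow> real) \<Rightarrow> real" where
  "triple_integral u v w = (LINT x|unit_measure. LINT y|unit_measure. LINT z|unit_measure.
      u (x, y) * (v (y, z) * w (z, x)))"

text \<open>Two applications of Fubini. The rotation serves to bring any factor into the middle
  slot, where the comparison of two graphons takes place.\<close>

lemma triple_integral_rotate:
  assumes "u \<in> bounded_kernels" "v \<in> bounded_kernels" "w \<in> bounded_kernels"
  shows "triple_integral u v w = triple_integral v w u"
proof -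
  note [measurable] = bounded_kernelsD(1)[OF assms(1)] bounded_kernelsD(1)[OF assms(2)] bounded_kernelsD(1)[OF assms(3)]
  note b = bounded_kernelsD(2)[OF assms(1)] bounded_kernelsD(2)[OF assms(2)] bounded_kernelsD(2)[OF assms(3)]
  have ab1: "\<bar>s * r\<bar> \<le> 1" if "\<bar>s\<bar> \<le> 1" "\<bar>r\<bar> \<le> 1" for s r :: real
    using mult_mono[of "\<bar>s\<bar>" 1 "\<bar>r\<bar>" 1] that by (simp add: abs_mult)
  have "integrable square_measure (\<lambda>(x, y). LINT z|unit_measure. u (x, y) * (v (y, z) * w (z, x)))"
    by (rule integrable_square_bounded[where B = 1], measurable)
       (auto intro!: abs_integral_unit_le ab1 b simp del: atLeastAtMost_iff)
  from square_measure.Fubini_integral[OF this]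
  have "triple_integral u v w
      = (LINT y|unit_measure. LINT x|unit_measure. LINT z|unit_measure. u (x, y) * (v (y, z) * w (z, x)))"
    by (simp add: triple_integral_def)
  also have "\<dots> = (LINT y|unit_measure. LINT z|unit_measure. LINT x|unit_measure. u (x, y) * (v (y, z) * w (z, x)))"
  proof (rule Bochner_Integration.integral_cong[OF refl])
    fix y assume y [measurable]: "y \<in> space unit_measure"
    have "integrable square_measure (\<lambda>(x, z). u (x, y) * (v (y, z) * w (z, x)))"
      by (rule integrable_square_bounded[where B = 1], measurable)
         (use y in \<open>auto intro!: ab1 b simp del: atLeastAtMost_iff\<close>)
    from square_measure.Fubini_integral[OF this]
    show "(LINT x|unit_measure. LINT z|unit_measure. u (x, y) * (v (y, z) * w (z, x)))
        = (LINT z|unit_measure. LINT x|unit_measure. u (x, y) * (v (y, z) * w (z, x)))" by simp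
  qed
  finally show ?thesis by (simp add: triple_integral_def mult_ac)
qed

text \<open>For fixed x the outer factors u(x, .) and w(., x) are functions of y and of z with
  values in [0, 1], hence admissible tests for the cut distance of f and g. Integrating over x keeps
  the bound.\<close>

lemma triple_integral_diff:
  assumes f: "f \<in> graphons" and g: "g \<in> graphons" and u: "u \<in> graphons" and w: "w \<in> graphons"
  shows "\<bar>triple_integral u f w - triple_integral u g w\<bar> \<le> cut_dist f g"
proof -
  note [measurable] = graphonD(1)[OF u] graphonD(1)[OF w] graphonD(1)[OF f] graphonD(1)[OF g]
  note b = bounded_kernelsD(2)[OF graphon_bounded_kernel[OF f]] bounded_kernelsD(2)[OF graphon_bounded_kernel[OF g]]
    bounded_kernelsD(2)[OF graphon_bounded_kernel[OF u]] bounded_kernelsD(2)[OF graphon_bounded_kernel[OF w]]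
  have ab1: "\<bar>s * r\<bar> \<le> 1" if "\<bar>s\<bar> \<le> 1" "\<bar>r\<bar> \<le> 1" for s r :: real
    using mult_mono[of "\<bar>s\<bar>" 1 "\<bar>r\<bar>" 1] that by (simp add: abs_mult)
  let ?I = "\<lambda>f x. LINT y|unit_measure. LINT z|unit_measure. u (x, y) * (f (y, z) * w (z, x))"
  have inner: "integrable unit_measure (\<lambda>z. u (x, y) * (h (y, z) * w (z, x)))"
    if "x \<in> {0..1}" "y \<in> {0..1}" "h \<in> {f, g}" for x y h
  proof (rule integrable_unit_bounded[where B = 1])
    have [measurable]: "x \<in> space unit_measure" "y \<in> space unit_measure" using that by simp_all
    show "(\<lambda>z. u (x, y) * (h (y, z) * w (z, x))) \<in> borel_measurable unit_measure"
      using that(3) by auto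
    show "\<bar>u (x, y) * (h (y, z) * w (z, x))\<bar> \<le> 1" if "z \<in> {0..1}" for z
      using that \<open>h \<in> {f, g}\<close> \<open>x \<in> {0..1}\<close> \<open>y \<in> {0..1}\<close> by (intro ab1 b) (auto intro!: b simp del: atLeastAtMost_iff)
  qed
  have mid: "integrable unit_measure (\<lambda>y. LINT z|unit_measure. u (x, y) * (h (y, z) * w (z, x)))"
    if "x \<in> {0..1}" "h \<in> {f, g}" for x h
  proof (rule integrable_unit_bounded[where B = 1])
    have [measurable]: "x \<in> space unit_measure" "h \<in> borel_measurable square_measure" using that by auto
    show "(\<lambda>y. LINT z|unit_measure. u (x, y) * (h (y, z) * w (z, x))) \<in> borel_measurable unit_measure"
      by measurable
    show "\<bar>LINT z|unit_measure. u (x, y) * (h (y, z) * w (z, x))\<bar> \<le> 1" if "y \<in> {0..1}" for y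
      using that \<open>h \<in> {f, g}\<close> \<open>x \<in> {0..1}\<close>
      by (intro abs_integral_unit_le ab1 b) (auto intro!: b simp del: atLeastAtMost_iff)
  qed
  have outer: "integrable unit_measure (?I h)" if "h \<in> {f, g}" for h
  proof (rule integrable_unit_bounded[where B = 1])
    have [measurable]: "h \<in> borel_measurable square_measure" using that by auto
    show "?I h \<in> borel_measurable unit_measure" by measurable
    show "\<bar>?I h x\<bar> \<le> 1" if "x \<in> {0..1}" for x
      using that \<open>h \<in> {f, g}\<close>
      by (intro abs_integral_unit_le ab1 b) (auto intro!: b simp del: atLeastAtMost_iff)
  qed
  have "triple_integral u f w - triple_integral u g w = (LINT x|unit_measure. ?I f x - ?I g x)"
    unfolding triple_integral_def using outer by simp
  also have "\<bar>\<dots>\<bar> \<le> cut_dist f g"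
  proof (rule abs_integral_unit_le)
    fix x :: real assume x: "x \<in> {0..1}"
    have [measurable]: "x \<in> space unit_measure" using x by simp
    have "?I f x - ?I g x = (LINT y|unit_measure. (LINT z|unit_measure. u (x, y) * (f (y, z) * w (z, x)))
        - (LINT z|unit_measure. u (x, y) * (g (y, z) * w (z, x))))"
      using mid[OF x] by simp
    also have "\<dots> = (LINT y|unit_measure. LINT z|unit_measure. u (x, y) * (w (z, x) * (f (y, z) - g (y, z))))"
    proof (intro Bochner_Integration.integral_cong refl)
      fix y assume "y \<in> space unit_measure"
      then have y: "y \<in> {0..1}" by simp
      have "(LINT z|unit_measure. u (x, y) * (f (y, z) * w (z, x))) - (LINT z|unit_measure. u (x, y) * (g (y, z) * w (z, x)))
          = (LINT z|unit_measure. u (x, y) * (f (y, z) * w (z, x)) - u (x, y) * (g (y, z) * w (z, x)))"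
        using inner[OF x y] by (intro Bochner_Integration.integral_diff[symmetric]) auto
      then show "(LINT z|unit_measure. u (x, y) * (f (y, z) * w (z, x))) - (LINT z|unit_measure. u (x, y) * (g (y, z) * w (z, x)))
          = (LINT z|unit_measure. u (x, y) * (w (z, x) * (f (y, z) - g (y, z))))"
        by (simp add: algebra_simps)
    qed
    also have "\<bar>\<dots>\<bar> \<le> cut_dist f g"
    proof (rule cut_dist_test[OF f g])
      show "(\<lambda>y. u (x, y)) \<in> borel_measurable unit_measure" "(\<lambda>z. w (z, x)) \<in> borel_measurable unit_measure"
        by measurable
      show "0 \<le> u (x, y) \<and> u (x, y) \<le> 1" if "y \<in> {0..1}" for y using graphonD(2)[OF u x that] by simp
      show "0 \<le> w (y, x) \<and> w (y, x) \<le> 1" if "y \<in> {0..1}" for y using graphonD(2)[OF w that x] by simp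
    qed
    finally show "\<bar>?I f x - ?I g x\<bar> \<le> cut_dist f g" .
  qed
  finally show ?thesis .
qed

lemma triangle_density_triple: "triangle_density f = triple_integral f f f / 6"
  by (simp add: triangle_density_def triple_integral_def mult.assoc)

text \<open>Three exchanges of f for g, each at the cost of one cut distance, together with the
  factor 1/6 give the constant 1/2.\<close>

theorem triangle_density_lipschitz:
  assumes f: "f \<in> graphons" and g: "g \<in> graphons"
  shows "\<bar>triangle_density f - triangle_density g\<bar> \<le> cut_dist f g / 2"
proof -
  note k = graphon_bounded_kernel[OF f] graphon_bounded_kernel[OF g]
  let ?T = triple_integral
  \<comment> \<open>The intermediate terms are matched by rotations, so that every difference
    changes the middle factor only.\<close>
  have "?T f f f - ?T g g g = (?T f f f - ?T f g f) + (?T f f g - ?T f g g) + (?T g f g - ?T g g g)"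
    using triple_integral_rotate[OF k(1) k(2) k(1)] triple_integral_rotate[OF k(2) k(1) k(1)]
      triple_integral_rotate[OF k(1) k(2) k(2)] triple_integral_rotate[OF k(2) k(2) k(1)] by simp
  then show ?thesis
    using triple_integral_diff[OF f g f f] triple_integral_diff[OF f g f g] triple_integral_diff[OF f g g g]
    unfolding triangle_density_triple by linarith
qed

lemma cut_dist_le_L1:
  assumes "f \<in> graphons" "g \<in> graphons"
  shows "cut_dist f g \<le> (LINT z|square_measure. \<bar>f z - g z\<bar>)"
proof (rule cut_dist_least)
  fix S T assume [measurable]: "S \<in> sets unit_measure" "T \<in> sets unit_measure"
  note k = bounded_kernelsD[OF graphon_diff_bounded_kernel[OF assms]]
  note [measurable] = k(1)
  have int: "integrable square_measure (\<lambda>z. f z - g z)"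
    by (rule integrable_square_bounded[OF k(1)]) (rule k(2))
  have "\<bar>LINT z : S \<times> T | square_measure. f z - g z\<bar> \<le> (LINT z | square_measure. \<bar>indicator (S \<times> T) z * (f z - g z)\<bar>)"
    unfolding set_lebesgue_integral_def by simp
  also have "\<dots> \<le> (LINT z|square_measure. \<bar>f z - g z\<bar>)"
  proof (rule integral_mono)
    show "integrable square_measure (\<lambda>z. \<bar>indicator (S \<times> T) z * (f z - g z)\<bar>)"
      by (rule Bochner_Integration.integrable_bound[OF int]) (auto simp: indicator_def)
  qed (use int in \<open>auto simp: indicator_def\<close>)
  finally show "\<bar>LINT z : S \<times> T | square_measure. f z - g z\<bar> \<le> (LINT z|square_measure. \<bar>f z - g z\<bar>)" .
qed

section \<open>The rate function and Jensen's inequality\<close>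

lemma rate_nonneg:
  assumes "0 < a" "a < 1" "0 \<le> u" "u \<le> 1"
  shows "0 \<le> rate a u"
proof -
  have *: "u - a \<le> u * ln (u / a)" if "0 < a" "0 \<le> u" for u a :: real
  proof (cases "u = 0")
    case False
    have "1 - a / u \<le> ln (u / a)" using ln_le_minus_one[of "a / u"] that False by (simp add: ln_div)
    then have "u * (1 - a / u) \<le> u * ln (u / a)" using that by (intro mult_left_mono) auto
    then show ?thesis using False by (simp add: right_diff_distrib)
  qed (use that in auto)
  show ?thesis
    using *[of a u] *[of "1 - a" "1 - u"] assms by (simp add: rate_def)
qed

text \<open>As a function of u this is the tangent of \<open>rate p\<close> at a. By
  \<open>rate_shift\<close> the gap between the two is \<open>rate a u\<close>, so convexity is
  reduced to the nonnegativity of relative entropy, and no derivative appears.\<close>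

definition rate_line :: "real \<Rightarrow> real \<Rightarrow> real \<Rightarrow> real" where
  "rate_line p a u = (u * ln (a / p) + (1 - u) * ln ((1 - a) / (1 - p))) / 2"

lemma rate_shift:
  assumes "0 < a" "a < 1" "0 < p" "p < 1" "0 \<le> u" "u \<le> 1"
  shows "rate p u = rate a u + rate_line p a u"
proof -
  have *: "u * ln (u / p) = u * ln (u / a) + u * ln (a / p)" if "0 < a" "0 < p" "0 \<le> u" for u a p :: real
    using that by (cases "u = 0") (simp_all add: ln_div algebra_simps)
  show ?thesis using *[of a p u] *[of "1 - a" "1 - p" "1 - u"] assms
    by (simp add: rate_def rate_line_def field_simps)
qed

lemma rate_le:
  assumes "0 < p" "p < 1" "0 \<le> u" "u \<le> 1"
  shows "rate p u \<le> ln (1 / p) + ln (1 / (1 - p))"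
proof -
  have *: "u * ln (u / p) \<le> ln (1 / p)" if "0 < p" "p < 1" "0 \<le> u" "u \<le> 1" for u p :: real
  proof (cases "u = 0")
    case False
    have "u * ln (u / p) \<le> u * ln (1 / p)"
      using that False by (intro mult_left_mono) (auto simp: divide_right_mono)
    also have "\<dots> \<le> 1 * ln (1 / p)" using that by (intro mult_right_mono) auto
    finally show ?thesis by simp
  qed (use that in auto)
  have "0 \<le> ln (1 / p)" "0 \<le> ln (1 / (1 - p))" using assms by simp_all
  moreover have "rate p u = (u * ln (u / p) + (1 - u) * ln ((1 - u) / (1 - p))) / 2"
    by (simp add: rate_def add_divide_distrib)
  moreover have "u * ln (u / p) \<le> ln (1 / p)" "(1 - u) * ln ((1 - u) / (1 - p)) \<le> ln (1 / (1 - p))"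
    using *[of p u] *[of "1 - p" "1 - u"] assms by simp_all
  moreover have "(A + B) / 2 \<le> C + D" if "A \<le> C" "B \<le> D" "0 \<le> C" "0 \<le> D" for A B C D :: real
  proof -
    have "(A + B) / 2 \<le> (C + D) / 2" using that by (intro divide_right_mono add_mono) auto
    also have "\<dots> \<le> C + D" using that by (simp add: field_simps)
    finally show ?thesis .
  qed
  ultimately show ?thesis by simp
qed

text \<open>Everything reduces to u ln u at the point 0; the second term is its reflection under u
  \<mapsto> 1 - u.\<close>

lemma continuous_on_rate:
  assumes "0 < p" "p < 1"
  shows "continuous_on {0..1} (rate p)"
proof -
  have xlnx: "continuous_on {0..} (\<lambda>u::real. u * ln u)"
    unfolding continuous_on_def
  proof
    fix u :: real assume u: "u \<in> {0..}"
    show "((\<lambda>u. u * ln u) \<longlongrightarrow> u * ln u) (at u within {0..})"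
    proof (cases "u = 0")
      case False
      then show ?thesis by (intro tendsto_intros) auto
    next
      case True
      have "\<bar>v * ln v\<bar> \<le> 2 * sqrt v + \<bar>v\<bar> * \<bar>v\<bar>" if "v \<in> {0..}" for v :: real
      proof (cases "v = 0")
        case False
        then have v: "v > 0" using that by simp
        \<comment> \<open>The logarithm inequality at 1 / sqrt v, rather than at 1 / v, bounds - v
          ln v by 2 sqrt v, which vanishes at 0.\<close>
        have "ln (1 / sqrt v) \<le> 1 / sqrt v" using ln_le_minus_one[of "1 / sqrt v"] v by simp
        then have "- ln v \<le> 2 * (1 / sqrt v)" using v by (simp add: ln_div ln_sqrt)
        then have "v * - ln v \<le> v * (2 * (1 / sqrt v))" using v by (intro mult_left_mono) auto
        also have "\<dots> = 2 * (v / sqrt v)" by simp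
        also have "v / sqrt v = sqrt v" using v by (simp add: real_div_sqrt)
        finally have 1: "- (v * ln v) \<le> 2 * sqrt v" by simp
        have "v * ln v \<le> v * v" using ln_le_minus_one[OF v] v by (intro mult_left_mono) auto
        moreover have "0 \<le> sqrt v" "0 \<le> v * v" using v by simp_all
        ultimately have "\<bar>v * ln v\<bar> \<le> 2 * sqrt v + v * v" using 1 by linarith
        then show ?thesis using v by simp
      qed simp
      then have ev: "\<forall>\<^sub>F v in at 0 within {0..}. norm (v * ln v) \<le> 2 * sqrt v + \<bar>v\<bar> * \<bar>v\<bar>"
        by (simp add: eventually_at_filter)
      have "((\<lambda>v. 2 * sqrt v + \<bar>v\<bar> * \<bar>v\<bar>) \<longlongrightarrow> 2 * sqrt 0 + \<bar>0\<bar> * \<bar>0\<bar>) (at (0::real) within {0..})"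
        by (intro tendsto_intros)
      then have "((\<lambda>v. 2 * sqrt v + \<bar>v\<bar> * \<bar>v\<bar>) \<longlongrightarrow> 0) (at (0::real) within {0..})" by simp
      with ev have "((\<lambda>v::real. v * ln v) \<longlongrightarrow> 0) (at 0 within {0..})" by (rule Lim_null_comparison)
      then show ?thesis using True by simp
    qed
  qed
  have eq: "rate p u = (u * ln u - u * ln p + ((1 - u) * ln (1 - u) - (1 - u) * ln (1 - p))) / 2"
    if "u \<in> {0..1}" for u
  proof -
    have *: "u * ln (u / p) = u * ln u - u * ln p" if "0 \<le> u" "0 < p" for u p :: real
      using that by (cases "u = 0") (simp_all add: ln_div algebra_simps)
    show ?thesis using *[of u p] *[of "1 - u" "1 - p"] that assms by (simp add: rate_def add_divide_distrib)
  qed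
  have c1: "continuous_on {0..1} (\<lambda>u::real. (1 - u) * ln (1 - u))"
    by (rule continuous_on_compose2[OF xlnx]) (auto intro!: continuous_intros)
  have c2: "continuous_on {0..1} (\<lambda>u::real. u * ln u)" by (rule continuous_on_subset[OF xlnx]) auto
  have "continuous_on {0..1} (\<lambda>u. (u * ln u - u * ln p + ((1 - u) * ln (1 - u) - (1 - u) * ln (1 - p))) * (1 / 2))"
    by (intro c1 c2 continuous_on_mult continuous_on_add continuous_on_diff continuous_on_const continuous_on_id)
  then show ?thesis by (rule continuous_on_eq) (simp add: eq)
qed

lemma measurable_rate [measurable]: "rate p \<in> borel_measurable borel"
  unfolding rate_def[abs_def] by measurable

lemma graphon_rate_square:
  assumes p: "0 < p" "p < 1" and f: "f \<in> graphons"
  shows "integrable square_measure (\<lambda>z. rate p (f z))"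
    "graphon_rate p f = (LINT z|square_measure. rate p (f z))"
proof -
  note [measurable] = graphonD(1)[OF f]
  show int: "integrable square_measure (\<lambda>z. rate p (f z))"
  proof (rule integrable_square_bounded[where B = "ln (1 / p) + ln (1 / (1 - p))"])
    fix x y :: real assume "x \<in> {0..1}" "y \<in> {0..1}"
    then have "f (x, y) \<in> {0..1}" by (rule graphonD(2)[OF f])
    then show "\<bar>rate p (f (x, y))\<bar> \<le> ln (1 / p) + ln (1 / (1 - p))"
      using rate_le[OF p] rate_nonneg[OF p] by simp
  qed measurable
  show "graphon_rate p f = (LINT z|square_measure. rate p (f z))"
    unfolding graphon_rate_def by (rule square_measure.integral_fst'[OF int])
qed

lemma graphon_rate_nonneg:
  assumes p: "0 < p" "p < 1" and f: "f \<in> graphons"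
  shows "0 \<le> graphon_rate p f"
proof -
  have "0 \<le> rate p (f z)" if "z \<in> space square_measure" for z
  proof -
    have "f z \<in> {0..1}" using that graphonD(2)[OF f] by (auto simp: space_square simp del: atLeastAtMost_iff)
    then show ?thesis by (intro rate_nonneg p) auto
  qed
  then show ?thesis unfolding graphon_rate_square(2)[OF p f] by (intro integral_nonneg_AE AE_I2)
qed

text \<open>Integrating the tangent at c over B bounds the integral below by b times the value of
  this tangent at the mean a, and c = a is the best choice. At a = 0 and a = 1 the slope is
  infinite, and c tends to the endpoint instead.\<close>

lemma rate_jensen:
  fixes g :: "'a \<Rightarrow> real"
  assumes p: "0 < p" "p < 1" and M: "finite_measure M" and B: "B \<in> sets M" "measure M B = b" "0 < b"
    and g: "g \<in> borel_measurable M" "\<And>x. x \<in> space M \<Longrightarrow> 0 \<le> g x \<and> g x \<le> 1"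
    and a: "(LINT x|M. indicator B x * g x) = b * a"
  shows "b * rate p a \<le> (LINT x|M. indicator B x * rate p (g x))"
proof -
  interpret finite_measure M by (rule M)
  note [measurable] = B(1) g(1)
  have intB: "integrable M (indicator B :: _ \<Rightarrow> real)" using B by (simp add: emeasure_eq_measure)
  have ing: "integrable M (\<lambda>x. indicator B x * g x)"
    by (rule integrable_const_bound[where B = 1]) (use g in \<open>auto intro!: AE_I2 simp: indicator_def\<close>)
  have inr: "integrable M (\<lambda>x. indicator B x * rate p (g x))"
  proof (rule integrable_const_bound[where B = "ln (1 / p) + ln (1 / (1 - p))"])
    have "\<bar>indicator B x * rate p (g x)\<bar> \<le> ln (1 / p) + ln (1 / (1 - p))" if "x \<in> space M" for x
      using rate_le[OF p, of "g x"] rate_nonneg[OF p, of "g x"] g(2)[OF that]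
      by (auto simp: indicator_def)
    then show "AE x in M. norm (indicator B x * rate p (g x)) \<le> ln (1 / p) + ln (1 / (1 - p))"
      by (intro AE_I2) simp
  qed measurable
  have intBr: "(LINT x|M. indicator B x) = b"
    using B by (simp add: sets.Int_space_eq2)
  have line: "b * rate_line p c a \<le> (LINT x|M. indicator B x * rate p (g x))" if c: "0 < c" "c < 1" for c
  proof -
    have "rate_line p c u = (ln (c / p) - ln ((1 - c) / (1 - p))) / 2 * u + ln ((1 - c) / (1 - p)) / 2" for u
      by (simp add: rate_line_def field_simps)
    then have eq: "indicator B x * rate_line p c (g x)
        = (ln (c / p) - ln ((1 - c) / (1 - p))) / 2 * (indicator B x * g x) + ln ((1 - c) / (1 - p)) / 2 * indicator B x" for x
      by (simp add: algebra_simps)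
    have "b * rate_line p c a = (LINT x|M. indicator B x * rate_line p c (g x))"
      unfolding eq using ing intB
      by (simp add: a B(2) sets.Int_space_eq2[OF B(1)]) (simp add: rate_line_def field_simps)
    also have "\<dots> \<le> (LINT x|M. indicator B x * rate p (g x))"
    proof (rule integral_mono[OF _ inr])
      show "integrable M (\<lambda>x. indicator B x * rate_line p c (g x))" unfolding eq using ing intB by simp
      show "indicator B x * rate_line p c (g x) \<le> indicator B x * rate p (g x)" if "x \<in> space M" for x
        using rate_shift[OF c p, of "g x"] rate_nonneg[OF c, of "g x"] g(2)[OF that]
        by (auto simp: indicator_def)
    qed
    finally show ?thesis .
  qed
  have "0 \<le> (LINT x|M. indicator B x * g x)"
    by (intro integral_nonneg_AE AE_I2) (use g in \<open>auto simp: indicator_def\<close>)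
  then have a0: "0 \<le> a" using a B by (simp add: zero_le_mult_iff)
  have "(LINT x|M. indicator B x * g x) \<le> (LINT x|M. indicator B x)"
    by (rule integral_mono[OF ing intB]) (use g in \<open>auto simp: indicator_def\<close>)
  then have a1: "a \<le> 1" using a intBr B by simp
  consider "a = 0" | "a = 1" | "0 < a" "a < 1" using a0 a1 by linarith
  then show ?thesis
  proof cases
    case 3
    have "rate a a = 0" using 3 by (simp add: rate_def)
    then show ?thesis using line[OF 3] rate_shift[OF 3 p, of a] a0 a1 by simp
  next
    case 1
    \<comment> \<open>The singular term ln (c / p) carries the factor a = 0, so the limit is
      finite.\<close>
    have "((\<lambda>c. b * rate_line p c a) \<longlongrightarrow> b * rate p a) (at_right 0)"
      unfolding 1 rate_line_def rate_def using p by (auto intro!: tendsto_eq_intros)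
    moreover have "\<forall>\<^sub>F c in at_right 0. b * rate_line p c a \<le> (LINT x|M. indicator B x * rate p (g x))"
      using eventually_at_right_real[of 0 1] by (rule eventually_mono) (use line in auto)
    ultimately show ?thesis by (rule tendsto_upperbound) simp
  next
    case 2
    have "((\<lambda>c. b * rate_line p c a) \<longlongrightarrow> b * rate p a) (at_left 1)"
      unfolding 2 rate_line_def rate_def using p by (auto intro!: tendsto_eq_intros)
    moreover have "\<forall>\<^sub>F c in at_left 1. b * rate_line p c a \<le> (LINT x|M. indicator B x * rate p (g x))"
      using eventually_at_left_real[of 0 1] by (rule eventually_mono) (use line in auto)
    ultimately show ?thesis by (rule tendsto_upperbound) simp
  qed
qed

lemma integral_rectangle_swap:
  fixes u :: "real \<times> real \<Rightarrow> real"
  assumes u [measurable]: "u \<in> borel_measurable square_measure"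
    and ST [measurable]: "S \<in> sets unit_measure" "T \<in> sets unit_measure"
  shows "(LINT z|square_measure. indicator (S \<times> T) z * u (snd z, fst z)) = (LINT z|square_measure. indicator (T \<times> S) z * u z)"
proof -
  have "(\<lambda>z. indicator (T \<times> S) z * u z) \<in> borel_measurable square_measure" by measurable
  from square_measure.integral_product_swap[OF this]
  have "(LINT z|square_measure. indicator (T \<times> S) (snd z, fst z) * u (snd z, fst z))
      = (LINT z|square_measure. indicator (T \<times> S) z * u z)"
    by (simp only: case_prod_unfold)
  moreover have "(\<lambda>z. indicator (T \<times> S) (snd z, fst z) * u (snd z, fst z)) = (\<lambda>z. indicator (S \<times> T) z * u (snd z, fst z))"
    by (auto simp: indicator_def fun_eq_iff)
  ultimately show ?thesis by simp
qed

lemma graphon_rectangle_swap: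
  assumes f: "f \<in> graphons" and ST: "S \<in> sets unit_measure" "T \<in> sets unit_measure"
  shows "(LINT z|square_measure. indicator (S \<times> T) z * f z) = (LINT z|square_measure. indicator (T \<times> S) z * f z)"
proof -
  have "f (snd z, fst z) = f z" if "z \<in> space square_measure" for z
    using that graphonD(3)[OF f, of "fst z" "snd z"] by (auto simp: space_square)
  then have "(LINT z|square_measure. indicator (S \<times> T) z * f z) = (LINT z|square_measure. indicator (S \<times> T) z * f (snd z, fst z))"
    by (intro Bochner_Integration.integral_cong refl) simp
  then show ?thesis using integral_rectangle_swap[OF graphonD(1)[OF f] ST] by simp
qed

lemma measure_rectangle:
  assumes "S \<in> sets unit_measure" "T \<in> sets unit_measure"
  shows "measure square_measure (S \<times> T) = measure unit_measure S * measure unit_measure T"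
  unfolding measure_def
  by (subst unit_measure.emeasure_pair_measure_Times) (simp_all add: enn2real_mult assms)

section \<open>Averages over grids\<close>

text \<open>Multiplying by n^2, rather than dividing by the measure of the cell, gives 0 on null and
  empty cells; the bounds 0 and 1 then hold for all indices.\<close>

definition cell_avg :: "nat \<Rightarrow> (real \<times> real \<Rightarrow> real) \<Rightarrow> nat \<Rightarrow> nat \<Rightarrow> real" where
  "cell_avg n f i j = (real n)\<^sup>2 * (LINT z|square_measure. indicator (cell n i \<times> cell n j) z * f z)"

definition grid_avg :: "nat \<Rightarrow> (real \<times> real \<Rightarrow> real) \<Rightarrow> real \<times> real \<Rightarrow> real" where
  "grid_avg n f = step_graphon n (cell_avg n f)"

lemma measure_cell_le:
  assumes "0 < n"
  shows "measure unit_measure (cell n i) \<le> 1 / real n"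
proof -
  consider "i = 0" | "1 \<le> i" "i \<le> n" | "n < i" by linarith
  then show ?thesis
  proof cases
    case 1 then show ?thesis using measure_cell_0[OF assms] by simp
  next
    case 2 then show ?thesis by (simp add: measure_cell)
  next
    case 3
    then have "cell n i = {}" using gidx_le[of _ n] by (force simp: cell_def simp del: atLeastAtMost_iff)
    then show ?thesis by simp
  qed
qed

lemma integrable_rectangle:
  fixes f :: "real \<times> real \<Rightarrow> real"
  assumes "integrable square_measure f" and [measurable]: "S \<in> sets unit_measure" "T \<in> sets unit_measure"
  shows "integrable square_measure (\<lambda>z. indicator (S \<times> T) z * f z)"
proof (rule Bochner_Integration.integrable_bound[OF assms(1)])
  have [measurable]: "f \<in> borel_measurable square_measure" using assms(1) by auto
  show "(\<lambda>z. indicator (S \<times> T) z * f z) \<in> borel_measurable square_measure" by measurable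
qed (auto simp: indicator_def)

lemma integral_indicator_rectangle:
  assumes [measurable]: "S \<in> sets unit_measure" "T \<in> sets unit_measure"
  shows "(LINT z|square_measure. indicator (S \<times> T) z * c) = c * (measure unit_measure S * measure unit_measure T)"
proof -
  have "S \<times> T \<in> sets square_measure" by measurable
  then show ?thesis using measure_rectangle[OF assms] by (simp add: sets.Int_space_eq2)
qed

lemma integral_square_cells:
  fixes g :: "real \<times> real \<Rightarrow> real"
  assumes n: "0 < n" and g: "integrable square_measure g"
  shows "(LINT z|square_measure. g z)
    = (\<Sum>i=1..n. \<Sum>j=1..n. LINT z|square_measure. indicator (cell n i \<times> cell n j) z * g z)"
proof -
  let ?J = "\<lambda>i j. LINT z|square_measure. indicator (cell n i \<times> cell n j) z * g z"
  have int: "integrable square_measure (\<lambda>z. indicator (cell n i \<times> cell n j) z * g z)" for i j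
    by (rule integrable_rectangle[OF g]) auto
  have "(LINT z|square_measure. g z)
      = (LINT z|square_measure. (\<Sum>i\<le>n. \<Sum>j\<le>n. indicator (cell n i \<times> cell n j) z * g z))"
  proof (rule Bochner_Integration.integral_cong[OF refl])
    fix z assume "z \<in> space square_measure"
    then obtain x y where z: "z = (x, y)" "x \<in> {0..1}" "y \<in> {0..1}" by (auto simp: space_square)
    have "(\<Sum>i\<le>n. \<Sum>j\<le>n. indicator (cell n i \<times> cell n j) z * g z)
        = (\<Sum>i\<le>n. (\<Sum>j\<le>n. g z * indicator (cell n j) y) * indicator (cell n i) x)"
      unfolding sum_distrib_right z(1) by (intro sum.cong refl) (auto simp: indicator_def)
    also have "\<dots> = g z" by (simp only: sum_indicator_cell[OF z(2)] sum_indicator_cell[OF z(3)])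
    finally show "g z = (\<Sum>i\<le>n. \<Sum>j\<le>n. indicator (cell n i \<times> cell n j) z * g z)" by simp
  qed
  also have "\<dots> = (\<Sum>i\<le>n. LINT z|square_measure. (\<Sum>j\<le>n. indicator (cell n i \<times> cell n j) z * g z))"
    by (intro Bochner_Integration.integral_sum Bochner_Integration.integrable_sum int)
  also have "\<dots> = (\<Sum>i\<le>n. \<Sum>j\<le>n. ?J i j)"
    by (intro sum.cong refl Bochner_Integration.integral_sum int)
  finally have eq: "(LINT z|square_measure. g z) = (\<Sum>i\<le>n. \<Sum>j\<le>n. ?J i j)" .
  have 0: "?J i j = 0" if "i = 0 \<or> j = 0" for i j
  proof -
    have "measure square_measure (cell n i \<times> cell n j) = 0"
      using that measure_cell_0[OF n] by (auto simp: measure_rectangle)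
    then have "cell n i \<times> cell n j \<in> null_sets square_measure"
      by (auto intro!: null_setsI simp: square_measure.P.emeasure_eq_measure)
    then have "AE z in square_measure. z \<notin> cell n i \<times> cell n j" by (rule AE_not_in)
    then have "AE z in square_measure. indicator (cell n i \<times> cell n j) z * g z = 0"
      by eventually_elim (simp add: indicator_def)
    then show ?thesis by (rule integral_eq_zero_AE)
  qed
  show ?thesis unfolding eq by (simp add: sum_atMost_eq 0)
qed

lemma graphon_integrable_square: "f \<in> graphons \<Longrightarrow> integrable square_measure f"
  using bounded_kernelsD[OF graphon_bounded_kernel] by (intro integrable_square_bounded[where B = 1]) auto

lemma graphon_in_unit: "f \<in> graphons \<Longrightarrow> z \<in> space square_measure \<Longrightarrow> 0 \<le> f z \<and> f z \<le> 1"
  using graphonD(2)[of f "fst z" "snd z"] by (auto simp: space_square)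

lemma cell_avg_bounds:
  assumes f: "f \<in> graphons" and n: "0 < n"
  shows "cell_avg n f i j = cell_avg n f j i" "0 \<le> cell_avg n f i j" "cell_avg n f i j \<le> 1"
proof -
  show "cell_avg n f i j = cell_avg n f j i"
    unfolding cell_avg_def using graphon_rectangle_swap[OF f sets_cell sets_cell] by simp
  show "0 \<le> cell_avg n f i j"
    unfolding cell_avg_def
    by (intro mult_nonneg_nonneg integral_nonneg_AE AE_I2) (use graphon_in_unit[OF f] in \<open>auto simp: indicator_def\<close>)
  have "(LINT z|square_measure. indicator (cell n i \<times> cell n j) z * f z)
      \<le> (LINT z|square_measure. indicator (cell n i \<times> cell n j) z * 1)"
  proof (rule integral_mono)
    show "integrable square_measure (\<lambda>z. indicator (cell n i \<times> cell n j) z * f z)"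
      by (intro integrable_rectangle graphon_integrable_square f sets_cell)
    show "integrable square_measure (\<lambda>z. indicator (cell n i \<times> cell n j) z * (1::real))"
      by (intro integrable_rectangle sets_cell) simp
  qed (use graphon_in_unit[OF f] in \<open>auto simp: indicator_def\<close>)
  also have "\<dots> = 1 * (measure unit_measure (cell n i) * measure unit_measure (cell n j))"
    by (rule integral_indicator_rectangle) auto
  also have "\<dots> \<le> 1 * (1 / real n * (1 / real n))"
    by (intro mult_mono measure_cell_le n) auto
  finally show "cell_avg n f i j \<le> 1"
    using n unfolding cell_avg_def by (simp add: power2_eq_square field_simps)
qed

lemma grid_avg_in: "f \<in> graphons \<Longrightarrow> 0 < n \<Longrightarrow> grid_avg n f \<in> graphons"
  unfolding grid_avg_def by (intro step_graphon_in cell_avg_bounds)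

lemma graphon_rate_grid_avg_le:
  assumes p: "0 < p" "p < 1" and f: "f \<in> graphons" and n: "0 < n"
  shows "graphon_rate p (grid_avg n f) \<le> graphon_rate p f"
proof -
  let ?B = "\<lambda>i j. cell n i \<times> cell n j"
  have j: "1 / (real n)\<^sup>2 * rate p (cell_avg n f i j) \<le> (LINT z|square_measure. indicator (?B i j) z * rate p (f z))"
    if "i \<in> {1..n}" "j \<in> {1..n}" for i j
  proof (rule rate_jensen[OF p square_measure.P.finite_measure_axioms])
    show "?B i j \<in> sets square_measure" by measurable
    show "measure square_measure (?B i j) = 1 / (real n)\<^sup>2"
      using that by (simp add: measure_rectangle measure_cell power2_eq_square)
    show "(LINT z|square_measure. indicator (?B i j) z * f z) = 1 / (real n)\<^sup>2 * cell_avg n f i j"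
      using n by (simp add: cell_avg_def)
  qed (use n graphonD(1)[OF f] graphon_in_unit[OF f] in auto)
  have "graphon_rate p (grid_avg n f) = (\<Sum>i=1..n. \<Sum>j=1..n. 1 / (real n)\<^sup>2 * rate p (cell_avg n f i j))"
    unfolding grid_avg_def graphon_rate_step[OF n] by (simp add: sum_divide_distrib)
  also have "\<dots> \<le> (\<Sum>i=1..n. \<Sum>j=1..n. LINT z|square_measure. indicator (?B i j) z * rate p (f z))"
    by (intro sum_mono j)
  also have "\<dots> = graphon_rate p f"
    using integral_square_cells[OF n graphon_rate_square(1)[OF p f]] graphon_rate_square(2)[OF p f] by simp
  finally show ?thesis .
qed

section \<open>Continuous functions are dense in L1, hence grid averages converge in L1\<close>

lemma sets_square_borel:
  assumes "A \<in> sets square_measure"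
  shows "A \<in> sets (borel :: (real \<times> real) measure)"
proof -
  have u: "a \<in> sets borel" if "a \<in> sets unit_measure" for a
    using that by (auto simp: sets_unit sets_restrict_space)
  have "A \<in> sigma_sets (space unit_measure \<times> space unit_measure)
      {a \<times> b |a b. a \<in> sets unit_measure \<and> b \<in> sets unit_measure}"
    using assms by (simp add: sets_pair_measure)
  then have "A \<in> sets (borel \<Otimes>\<^sub>M borel)"
  proof induction
    case (Compl a)
    have "space unit_measure \<times> space unit_measure \<in> sets (borel \<Otimes>\<^sub>M borel)"
      by (intro pair_measureI) auto
    then show ?case using Compl.IH by (rule sets.Diff)
  qed (auto intro!: pair_measureI u)
  then show ?thesis by (simp only: borel_prod)
qed

lemma measurable_square_borel: "(\<lambda>z. z) \<in> measurable square_measure (borel :: (real \<times> real) measure)"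
proof -
  have "(\<lambda>x. x) \<in> borel_measurable unit_measure"
    unfolding unit_measure_def by (rule measurable_restrict_space1) simp
  then have "(\<lambda>z. (fst z, snd z)) \<in> borel_measurable square_measure"
    by (intro borel_measurable_Pair measurable_compose[OF measurable_fst] measurable_compose[OF measurable_snd])
  then show ?thesis by simp
qed

text \<open>Regularity of the image measure on the plane provides a compact set inside A and an open
  set around A of nearly equal measure. A Urysohn function between them differs from the indicator
  of A only on the small difference set.\<close>

lemma L1_continuous_indicator:
  assumes A: "A \<in> sets square_measure" and e: "0 < (e::real)"
  shows "\<exists>g. continuous_on UNIV g \<and> (\<forall>z. 0 \<le> g z \<and> g z \<le> 1) \<and>
    (LINT z|square_measure. \<bar>indicator A z - g z\<bar>) < e"
proof -
  define N where "N = distr square_measure (borel :: (real \<times> real) measure) (\<lambda>z. z)"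
  interpret N: prob_space N
    unfolding N_def by (rule square_measure.P.prob_space_distr[OF measurable_square_borel])
  have setsN [simp]: "sets N = sets borel" by (simp add: N_def)
  have Ab: "A \<in> sets borel" by (rule sets_square_borel[OF A])
  have fin: "emeasure N (space N) \<noteq> \<infinity>" by simp
  have "\<exists>U. A \<subseteq> U \<and> open U \<and> measure N U < measure N A + e / 2"
  proof (rule ccontr)
    assume "\<not> ?thesis"
    then have "ennreal (measure N A + e / 2) \<le> (INF U \<in> {U. A \<subseteq> U \<and> open U}. emeasure N U)"
      by (intro INF_greatest) (auto simp: N.emeasure_eq_measure not_less intro!: ennreal_leI)
    also have "\<dots> = emeasure N A" by (rule outer_regular[OF setsN fin Ab, symmetric])
    finally show False using e by (simp add: N.emeasure_eq_measure)
  qed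
  then obtain U where U: "A \<subseteq> U" "open U" "measure N U < measure N A + e / 2" by blast
  have "\<exists>K. K \<subseteq> A \<and> compact K \<and> measure N A - e / 2 < measure N K"
  proof (rule ccontr)
    assume *: "\<not> ?thesis"
    have "emeasure N A = (SUP K \<in> {K. K \<subseteq> A \<and> compact K}. emeasure N K)"
      by (rule inner_regular[OF setsN fin Ab])
    also have "\<dots> \<le> ennreal (measure N A - e / 2)"
      using *
      by (intro SUP_least) (auto simp: N.emeasure_eq_measure not_less intro!: ennreal_leI)
    finally have "ennreal (measure N A) \<le> ennreal (measure N A - e / 2)" by (simp add: N.emeasure_eq_measure)
    \<comment> \<open>\<open>ennreal\<close> sends negative reals to 0, so the sign has to be known;
      the empty compact set supplies it.\<close>
    moreover have "0 \<le> measure N A - e / 2"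
      using * compact_empty by (metis empty_subsetI measure_empty not_less)
    ultimately show False using e by simp
  qed
  then obtain K where K: "K \<subseteq> A" "compact K" "measure N A - e / 2 < measure N K" by blast
  have meas: "U \<in> sets N" "K \<in> sets N" "A \<in> sets N" using U K Ab by (auto simp: compact_imp_closed)
  obtain g :: "real \<times> real \<Rightarrow> real" where g: "continuous_on UNIV g" "\<And>z. g z \<in> closed_segment 1 0"
    "\<And>z. z \<in> K \<Longrightarrow> g z = 1" "\<And>z. z \<in> - U \<Longrightarrow> g z = 0"
  proof (rule Urysohn_local[of UNIV K "- U" 1 "0::real"])
    show "closedin (top_of_set UNIV) K" using K(2) by (simp add: compact_imp_closed)
    show "closedin (top_of_set UNIV) (- U)" using U(2) by (simp add: closed_Compl)
    show "K \<inter> - U = {}" using K U by blast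
  qed (use that in auto)
  have g01: "0 \<le> g z" "g z \<le> 1" for z using g(2)[of z] by (auto simp: closed_segment_eq_real_ivl)
  have gm [measurable]: "g \<in> borel_measurable borel" using g(1) by (rule borel_measurable_continuous_onI)
  have UK: "U - K \<in> sets borel" using meas by auto
  have "(LINT z|square_measure. \<bar>indicator A z - g z\<bar>) = (LINT z|N. \<bar>indicator A z - g z\<bar>)"
    unfolding N_def by (rule integral_distr[symmetric, OF measurable_square_borel]) (use Ab in measurable)
  also have "\<dots> \<le> (LINT z|N. indicator (U - K) z)"
  proof (rule integral_mono)
    show "integrable N (\<lambda>z. \<bar>indicator A z - g z\<bar>)"
    proof (rule N.integrable_const_bound[where B = 1])
      show "AE z in N. norm \<bar>indicator A z - g z\<bar> \<le> 1"
        using g01 by (intro AE_I2) (auto simp: indicator_def)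
      show "(\<lambda>z. \<bar>indicator A z - g z\<bar>) \<in> borel_measurable N"
        unfolding N_def using Ab by measurable
    qed
    show "integrable N (indicator (U - K) :: _ \<Rightarrow> real)" using UK by (simp add: N.emeasure_eq_measure)
    show "\<bar>indicator A z - g z\<bar> \<le> indicator (U - K) z" for z
      using g01[of z] g(3)[of z] g(4)[of z] K(1) U(1) by (auto simp: indicator_def)
  qed
  also have "\<dots> = measure N (U - K)"
    using UK by (simp add: sets.Int_space_eq2)
  also have "\<dots> = measure N U - measure N K"
    using K U meas by (intro N.finite_measure_Diff) auto
  also have "\<dots> < e" using U(3) K(3) by simp
  finally show ?thesis using g(1) g01 by blast
qed

lemma L1_continuous:
  assumes "integrable square_measure (f :: real \<times> real \<Rightarrow> real)" "0 < e"
  shows "\<exists>s. continuous_on UNIV s \<and> integrable square_measure s \<and> (LINT z|square_measure. \<bar>f z - s z\<bar>) < e"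
  using assms
proof (induction arbitrary: e rule: integrable_induct)
  case (base A c)
  \<comment> \<open>The summand 1 covers the case c = 0.\<close>
  have "0 < e / (\<bar>c\<bar> + 1)" using base by simp
  from L1_continuous_indicator[OF base(1) this] obtain g where
    g: "continuous_on UNIV g" "\<And>z. 0 \<le> g z \<and> g z \<le> 1" "(LINT z|square_measure. \<bar>indicator A z - g z\<bar>) < e / (\<bar>c\<bar> + 1)"
    by blast
  have gm: "g \<in> borel_measurable square_measure"
    using measurable_compose[OF measurable_square_borel borel_measurable_continuous_onI[OF g(1)]] .
  have "integrable square_measure (\<lambda>z. c * g z)"
    by (intro integrable_mult_right integrable_square_bounded[OF gm, where B = 1]) (use g in auto)
  moreover have "(LINT z|square_measure. \<bar>indicator A z *\<^sub>R c - c * g z\<bar>) < e"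
  proof -
    have "(LINT z|square_measure. \<bar>indicator A z *\<^sub>R c - c * g z\<bar>) = (LINT z|square_measure. \<bar>c\<bar> * \<bar>indicator A z - g z\<bar>)"
      by (intro Bochner_Integration.integral_cong refl) (simp add: algebra_simps flip: abs_mult)
    also have "\<dots> = \<bar>c\<bar> * (LINT z|square_measure. \<bar>indicator A z - g z\<bar>)" by simp
    also have "\<dots> \<le> \<bar>c\<bar> * (e / (\<bar>c\<bar> + 1))" using g(3) by (intro mult_left_mono) auto
    also have "\<dots> < e" using base by (simp add: field_simps)
    finally show ?thesis .
  qed
  ultimately show ?case using g(1) by (intro exI[of _ "\<lambda>z. c * g z"]) (auto intro!: continuous_intros)
next
  case (add f g)
  have "0 < e / 2" using add.prems by simp
  from add.IH(1)[OF this] add.IH(2)[OF this] obtain s t where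
    s: "continuous_on UNIV s" "integrable square_measure s" "(LINT z|square_measure. \<bar>f z - s z\<bar>) < e / 2" and
    t: "continuous_on UNIV t" "integrable square_measure t" "(LINT z|square_measure. \<bar>g z - t z\<bar>) < e / 2" by blast
  have "(LINT z|square_measure. \<bar>(f z + g z) - (s z + t z)\<bar>)
      \<le> (LINT z|square_measure. \<bar>f z - s z\<bar> + \<bar>g z - t z\<bar>)"
    by (rule integral_mono) (use add.hyps s t in auto)
  also have "\<dots> = (LINT z|square_measure. \<bar>f z - s z\<bar>) + (LINT z|square_measure. \<bar>g z - t z\<bar>)"
    by (rule Bochner_Integration.integral_add) (use add.hyps s t in auto)
  also have "\<dots> < e" using s t by simp
  finally show ?case using s t by (intro exI[of _ "\<lambda>z. s z + t z"]) (auto intro!: continuous_intros)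
next
  case (lim f u)
  have [measurable]: "f \<in> borel_measurable square_measure" "\<And>i. u i \<in> borel_measurable square_measure"
    using lim.hyps by auto
  have "(\<lambda>i. LINT z|square_measure. \<bar>f z - u i z\<bar>) \<longlonglongrightarrow> (LINT z|square_measure. (0::real))"
  proof (rule integral_dominated_convergence[where w = "\<lambda>z. 3 * \<bar>f z\<bar>"])
    show "AE z in square_measure. (\<lambda>i. \<bar>f z - u i z\<bar>) \<longlonglongrightarrow> 0"
    proof (rule AE_I2)
      fix z assume "z \<in> space square_measure"
      from lim.hyps(2)[OF this] have "(\<lambda>i. \<bar>f z - u i z\<bar>) \<longlonglongrightarrow> \<bar>f z - f z\<bar>" by (intro tendsto_intros)
      then show "(\<lambda>i. \<bar>f z - u i z\<bar>) \<longlonglongrightarrow> 0" by simp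
    qed
    show "AE z in square_measure. norm \<bar>f z - u i z\<bar> \<le> 3 * \<bar>f z\<bar>" for i
    proof (rule AE_I2)
      fix z assume "z \<in> space square_measure"
      from lim.hyps(3)[OF this, of i] show "norm \<bar>f z - u i z\<bar> \<le> 3 * \<bar>f z\<bar>" by simp
    qed
  qed (use lim.hyps(4) in auto)
  then have "\<forall>\<^sub>F i in sequentially. (LINT z|square_measure. \<bar>f z - u i z\<bar>) < e / 2"
    using lim.prems by (intro order_tendstoD(2)) auto
  then obtain i where i: "(LINT z|square_measure. \<bar>f z - u i z\<bar>) < e / 2"
    by (auto simp: eventually_sequentially)
  have "0 < e / 2" using lim.prems by simp
  from lim.IH[OF this, of i] obtain s where s: "continuous_on UNIV s" "integrable square_measure s"
    "(LINT z|square_measure. \<bar>u i z - s z\<bar>) < e / 2" by blast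
  have "(LINT z|square_measure. \<bar>f z - s z\<bar>) \<le> (LINT z|square_measure. \<bar>f z - u i z\<bar> + \<bar>u i z - s z\<bar>)"
    by (rule integral_mono) (use lim.hyps(1,4) s in auto)
  also have "\<dots> = (LINT z|square_measure. \<bar>f z - u i z\<bar>) + (LINT z|square_measure. \<bar>u i z - s z\<bar>)"
    by (rule Bochner_Integration.integral_add) (use lim.hyps(1,4) s in auto)
  also have "\<dots> < e" using s i by simp
  finally show ?case using s by blast
qed

text \<open>For a continuous s the oscillation on small cells is uniformly small, and averaging does
  not increase L1 distances. Approximating f by such an s in L1 gives the claim.\<close>

theorem grid_avg_L1:
  assumes f: "f \<in> graphons"
  shows "(\<lambda>n. LINT z|square_measure. \<bar>f z - grid_avg n f z\<bar>) \<longlonglongrightarrow> 0"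
proof (rule LIMSEQ_I)
  fix r :: real assume r: "0 < r"
  \<comment> \<open>The final estimate is 2 (e + e): the L1 error of s and its oscillation on a
    cell, each of them once for f and once for its average.\<close>
  define e where "e = r / 4"
  have e: "0 < e" using r by (simp add: e_def)
  have fi: "integrable square_measure f" by (rule graphon_integrable_square[OF f])
  obtain s where s: "continuous_on UNIV s" "integrable square_measure s"
    "(LINT z|square_measure. \<bar>f z - s z\<bar>) < e" using L1_continuous[OF fi e] by blast
  have "uniformly_continuous_on ({0..1} \<times> {0..1}) s"
    by (intro compact_uniformly_continuous continuous_on_subset[OF s(1)] compact_Times) auto
  then obtain d where d: "0 < d"
    "\<And>z z'. z \<in> {0..1} \<times> {0..1} \<Longrightarrow> z' \<in> {0..1} \<times> {0..1} \<Longrightarrow> dist z' z < d \<Longrightarrow> dist (s z') (s z) < e"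
    using e unfolding uniformly_continuous_on_def by meson
  \<comment> \<open>Each of the two coordinates varies by at most 1/n inside a cell, so the distance
    is at most 2/n.\<close>
  obtain n0 :: nat where n0: "2 / d < real n0" using reals_Archimedean2 by blast
  have "norm ((LINT z|square_measure. \<bar>f z - grid_avg n f z\<bar>) - 0) < r" if nn: "n0 \<le> n" for n
  proof -
    have dn: "2 / d < real n" using n0 nn by linarith
    have "0 < 2 / d" using d(1) by simp
    then have "0 < real n" using dn by (rule order.strict_trans)
    then have n: "0 < n" by simp
    have nd: "2 / real n < d" using dn d(1) n by (simp add: field_simps)
    let ?B = "\<lambda>i j. cell n i \<times> cell n j"
    define b where "b = 1 / (real n)\<^sup>2"
    have b: "0 < b" using n by (simp add: b_def)
    define c where "c i j = s (real i / n, real j / n)" for i j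
    define I where "I i j = (LINT z|square_measure. indicator (?B i j) z * \<bar>f z - s z\<bar>)" for i j
    define J where "J i j = (LINT z|square_measure. indicator (?B i j) z * \<bar>f z - c i j\<bar>)" for i j
    have mB: "(LINT z|square_measure. indicator (?B i j) z * k) = k * b" if "i \<in> {1..n}" "j \<in> {1..n}" for i j k
      unfolding integral_indicator_rectangle[OF sets_cell sets_cell]
      using that by (simp add: measure_cell b_def power2_eq_square)
    have ind: "integrable square_measure (\<lambda>z. indicator (?B i j) z * h z)"
      if "integrable square_measure h" for i j and h :: "real \<times> real \<Rightarrow> real"
      by (intro integrable_rectangle that sets_cell)
    have close: "\<bar>s z - c i j\<bar> \<le> e" if zB: "z \<in> ?B i j" and "i \<in> {1..n}" "j \<in> {1..n}" for z i j
    proof -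
      obtain x y where z: "z = (x, y)" "x \<in> cell n i" "y \<in> cell n j" using zB by blast
      have "x \<in> {0..1}" "y \<in> {0..1}" using z by (auto simp: cell_def)
      moreover have "real i / n \<in> {0..1}" "real j / n \<in> {0..1}" using that n by auto
      moreover have "\<bar>x - real i / n\<bar> \<le> 1 / n" "\<bar>y - real j / n\<bar> \<le> 1 / n"
        using z that by (auto simp: cell_eq diff_divide_distrib)
      moreover have "dist z (real i / n, real j / n) \<le> \<bar>x - real i / n\<bar> + \<bar>y - real j / n\<bar>"
        using sqrt_sum_squares_le_sum_abs by (simp add: z dist_Pair_Pair dist_real_def)
      ultimately have "dist (s z) (c i j) < e"
        unfolding c_def using nd by (intro d(2)) (auto simp: z)
      then show ?thesis by (simp add: dist_real_def)
    qed
    have JI: "J i j \<le> I i j + e * b" if ij: "i \<in> {1..n}" "j \<in> {1..n}" for i j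
    proof -
      have "J i j \<le> (LINT z|square_measure. indicator (?B i j) z * \<bar>f z - s z\<bar> + indicator (?B i j) z * e)"
        unfolding J_def
      proof (rule integral_mono)
        show "indicator (?B i j) z * \<bar>f z - c i j\<bar> \<le> indicator (?B i j) z * \<bar>f z - s z\<bar> + indicator (?B i j) z * e" for z
          using close[OF _ ij, of z] by (auto simp: indicator_def)
      qed (auto intro!: ind Bochner_Integration.integrable_add Bochner_Integration.integrable_diff integrable_abs fi s(2))
      also have "\<dots> = I i j + (LINT z|square_measure. indicator (?B i j) z * e)"
        unfolding I_def
        by (intro Bochner_Integration.integral_add ind integrable_abs Bochner_Integration.integrable_diff fi s(2)) simp_all
      finally show ?thesis unfolding mB[OF ij] .
    qed
    have aJ: "b * \<bar>cell_avg n f i j - c i j\<bar> \<le> J i j" if ij: "i \<in> {1..n}" "j \<in> {1..n}" for i j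
    proof -
      have "(LINT z|square_measure. indicator (?B i j) z * (f z - c i j))
          = (LINT z|square_measure. indicator (?B i j) z * f z - indicator (?B i j) z * c i j)"
        by (simp add: right_diff_distrib)
      also have "\<dots> = (LINT z|square_measure. indicator (?B i j) z * f z) - (LINT z|square_measure. indicator (?B i j) z * c i j)"
        by (intro Bochner_Integration.integral_diff ind fi) simp
      also have "\<dots> = b * (cell_avg n f i j - c i j)"
        unfolding mB[OF ij] using n by (simp add: cell_avg_def b_def field_simps)
      finally have "b * (cell_avg n f i j - c i j) = (LINT z|square_measure. indicator (?B i j) z * (f z - c i j))" ..
      then have "\<bar>b * (cell_avg n f i j - c i j)\<bar> \<le> (LINT z|square_measure. \<bar>indicator (?B i j) z * (f z - c i j)\<bar>)"
        by simp
      then show ?thesis using b unfolding J_def by (simp add: abs_mult)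
    qed
    have E: "(LINT z|square_measure. indicator (?B i j) z * \<bar>f z - grid_avg n f z\<bar>) \<le> 2 * (I i j + e * b)"
      if ij: "i \<in> {1..n}" "j \<in> {1..n}" for i j
    proof -
      let ?a = "cell_avg n f i j"
      have "(LINT z|square_measure. indicator (?B i j) z * \<bar>f z - grid_avg n f z\<bar>)
          = (LINT z|square_measure. indicator (?B i j) z * \<bar>f z - ?a\<bar>)"
        by (intro Bochner_Integration.integral_cong refl)
           (auto simp: indicator_def grid_avg_def step_graphon_apply cell_def simp del: atLeastAtMost_iff)
      also have "\<dots> \<le> (LINT z|square_measure. indicator (?B i j) z * \<bar>f z - c i j\<bar> + indicator (?B i j) z * \<bar>?a - c i j\<bar>)"
      proof (rule integral_mono)
        show "indicator (?B i j) z * \<bar>f z - ?a\<bar> \<le> indicator (?B i j) z * \<bar>f z - c i j\<bar> + indicator (?B i j) z * \<bar>?a - c i j\<bar>" for z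
          by (auto simp: indicator_def)
      qed (auto intro!: ind Bochner_Integration.integrable_add Bochner_Integration.integrable_diff integrable_abs fi)
      also have "\<dots> = J i j + (LINT z|square_measure. indicator (?B i j) z * \<bar>?a - c i j\<bar>)"
        unfolding J_def
        by (intro Bochner_Integration.integral_add ind integrable_abs Bochner_Integration.integrable_diff fi) simp_all
      also have "\<dots> \<le> 2 * (I i j + e * b)"
        unfolding mB[OF ij] using aJ[OF ij] JI[OF ij] by (simp add: mult.commute)
      finally show ?thesis .
    qed
    have gi: "integrable square_measure (grid_avg n f)" by (intro graphon_integrable_square grid_avg_in f n)
    have "(LINT z|square_measure. \<bar>f z - grid_avg n f z\<bar>)
        = (\<Sum>i=1..n. \<Sum>j=1..n. LINT z|square_measure. indicator (?B i j) z * \<bar>f z - grid_avg n f z\<bar>)"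
      by (intro integral_square_cells n integrable_abs Bochner_Integration.integrable_diff fi gi)
    also have "\<dots> \<le> (\<Sum>i=1..n. \<Sum>j=1..n. 2 * (I i j + e * b))"
      by (intro sum_mono E)
    also have "\<dots> = 2 * ((\<Sum>i=1..n. \<Sum>j=1..n. I i j) + e)"
      using n by (simp add: b_def sum.distrib power2_eq_square flip: sum_distrib_left)
    also have "(\<Sum>i=1..n. \<Sum>j=1..n. I i j) = (LINT z|square_measure. \<bar>f z - s z\<bar>)"
      unfolding I_def
      by (intro integral_square_cells[symmetric] n integrable_abs Bochner_Integration.integrable_diff fi s(2))
    finally have "(LINT z|square_measure. \<bar>f z - grid_avg n f z\<bar>) < r" using s(3) by (simp add: e_def)
    moreover have "0 \<le> (LINT z|square_measure. \<bar>f z - grid_avg n f z\<bar>)" by simp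
    ultimately show ?thesis by simp
  qed
  then show "\<exists>n0. \<forall>n\<ge>n0. norm ((LINT z|square_measure. \<bar>f z - grid_avg n f z\<bar>) - 0) < r" by blast
qed

lemma grid_avg_cut_dist:
  assumes f: "f \<in> graphons"
  shows "(\<lambda>n. cut_dist f (grid_avg n f)) \<longlonglongrightarrow> 0"
proof (rule tendsto_sandwich[OF _ _ tendsto_const grid_avg_L1[OF f]])
  show "\<forall>\<^sub>F n in sequentially. 0 \<le> cut_dist f (grid_avg n f)"
    using eventually_gt_at_top[of 0] by eventually_elim (intro cut_dist_nonneg f grid_avg_in)
  show "\<forall>\<^sub>F n in sequentially. cut_dist f (grid_avg n f) \<le> (LINT z|square_measure. \<bar>f z - grid_avg n f z\<bar>)"
    using eventually_gt_at_top[of 0] by eventually_elim (intro cut_dist_le_L1 f grid_avg_in)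
qed

text \<open>A subsequence of the grid averages converges almost everywhere, and
  \<open>rate p\<close> is bounded and continuous on [0, 1], so dominated convergence applies. With
  Jensen, the rate of f is the supremum of the rates of its grid averages.\<close>

lemma graphon_rate_le_grid:
  assumes p: "0 < p" "p < 1" and f: "f \<in> graphons"
    and m: "\<And>n. 0 < n \<Longrightarrow> graphon_rate p (grid_avg n f) \<le> m"
  shows "graphon_rate p f \<le> m"
proof -
  define u where "u n z = f z - grid_avg (Suc n) f z" for n z
  have g: "grid_avg (Suc n) f \<in> graphons" for n by (intro grid_avg_in f) simp
  have ui: "integrable square_measure (u n)" for n
    unfolding u_def[abs_def] by (intro Bochner_Integration.integrable_diff graphon_integrable_square f g)
  have "(\<lambda>n. LINT z|square_measure. norm (u n z)) \<longlonglongrightarrow> 0"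
    using LIMSEQ_Suc[OF grid_avg_L1[OF f]] by (simp add: u_def)
  from tendsto_L1_AE_subseq[OF ui this] obtain r where r: "strict_mono r"
    "AE z in square_measure. (\<lambda>n. u (r n) z) \<longlonglongrightarrow> 0" by blast
  let ?C = "ln (1 / p) + ln (1 / (1 - p))"
  have "(\<lambda>n. LINT z|square_measure. rate p (grid_avg (Suc (r n)) f z)) \<longlonglongrightarrow> (LINT z|square_measure. rate p (f z))"
  proof (rule integral_dominated_convergence[where w = "\<lambda>_. ?C"])
    show "AE z in square_measure. (\<lambda>n. rate p (grid_avg (Suc (r n)) f z)) \<longlonglongrightarrow> rate p (f z)"
      using r(2)
    proof (rule AE_mp, intro AE_I2 impI)
      fix z assume z: "z \<in> space square_measure" and "(\<lambda>n. u (r n) z) \<longlonglongrightarrow> 0"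
      then have "(\<lambda>n. f z - u (r n) z) \<longlonglongrightarrow> f z - 0" by (intro tendsto_intros)
      then have "(\<lambda>n. grid_avg (Suc (r n)) f z) \<longlonglongrightarrow> f z" by (simp add: u_def)
      moreover have "f z \<in> {0..1}" "grid_avg (Suc (r n)) f z \<in> {0..1}" for n
        using graphon_in_unit[OF f z] graphon_in_unit[OF g z] by auto
      ultimately show "(\<lambda>n. rate p (grid_avg (Suc (r n)) f z)) \<longlonglongrightarrow> rate p (f z)"
        by (intro continuous_on_tendsto_compose[OF continuous_on_rate[OF p]]) (auto intro!: always_eventually)
    qed
    show "AE z in square_measure. norm (rate p (grid_avg (Suc (r n)) f z)) \<le> ?C" for n
    proof (rule AE_I2)
      fix z assume "z \<in> space square_measure"
      from graphon_in_unit[OF g this, of "r n"] show "norm (rate p (grid_avg (Suc (r n)) f z)) \<le> ?C"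
        using rate_le[OF p] rate_nonneg[OF p] by simp
    qed
  qed (use graphon_rate_square(1)[OF p f] graphon_rate_square(1)[OF p g] in auto)
  then have "(\<lambda>n. graphon_rate p (grid_avg (Suc (r n)) f)) \<longlonglongrightarrow> graphon_rate p f"
    by (simp add: graphon_rate_square(2)[OF p f] graphon_rate_square(2)[OF p g])
  then show ?thesis by (rule LIMSEQ_le_const2) (use m in auto)
qed

text \<open>On a fixed grid the cell averages are integrals over rectangles, hence continuous for
  the cut distance, and the rate of a step graphon is continuous in its entries. Jensen compares it
  with the rate of \<open>h k\<close>; refining the grid recovers f.\<close>

theorem graphon_rate_lsc:
  assumes p: "0 < p" "p < 1" and f: "f \<in> graphons" and h: "\<And>k. h k \<in> graphons"
    and cut: "(\<lambda>k. cut_dist (h k) f) \<longlonglongrightarrow> 0"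
    and r: "\<And>k. graphon_rate p (h k) \<le> m k" "m \<longlonglongrightarrow> l"
  shows "graphon_rate p f \<le> l"
proof (rule graphon_rate_le_grid[OF p f])
  fix n :: nat assume n: "0 < n"
  have a: "(\<lambda>k. cell_avg n (h k) i j) \<longlonglongrightarrow> cell_avg n f i j" for i j
  proof -
    have "\<bar>cell_avg n (h k) i j - cell_avg n f i j\<bar> \<le> (real n)\<^sup>2 * cut_dist (h k) f" for k
    proof -
      let ?B = "cell n i \<times> cell n j"
      have "(LINT z : ?B | square_measure. h k z - f z)
          = (LINT z | square_measure. indicator ?B z * h k z - indicator ?B z * f z)"
        unfolding set_lebesgue_integral_def
        by (rule Bochner_Integration.integral_cong[OF refl]) (simp add: right_diff_distrib)
      also have "\<dots> = (LINT z | square_measure. indicator ?B z * h k z) - (LINT z | square_measure. indicator ?B z * f z)"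
        by (intro Bochner_Integration.integral_diff integrable_rectangle graphon_integrable_square h f sets_cell)
      finally have "cell_avg n (h k) i j - cell_avg n f i j
          = (real n)\<^sup>2 * (LINT z : ?B | square_measure. h k z - f z)"
        by (simp add: cell_avg_def right_diff_distrib)
      then show ?thesis
        using cut_dist_upper[OF h f sets_cell sets_cell] by (simp add: abs_mult mult_left_mono)
    qed
    then have "\<forall>\<^sub>F k in sequentially. norm (cell_avg n (h k) i j - cell_avg n f i j) \<le> (real n)\<^sup>2 * cut_dist (h k) f"
      by (simp add: always_eventually)
    moreover have "(\<lambda>k. (real n)\<^sup>2 * cut_dist (h k) f) \<longlonglongrightarrow> 0"
      using tendsto_mult_left[OF cut, of "(real n)\<^sup>2"] by simp
    ultimately have "(\<lambda>k. cell_avg n (h k) i j - cell_avg n f i j) \<longlonglongrightarrow> 0"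
      by (rule Lim_null_comparison)
    then show ?thesis by (rule LIM_zero_cancel)
  qed
  have "(\<lambda>k. rate p (cell_avg n (h k) i j)) \<longlonglongrightarrow> rate p (cell_avg n f i j)" for i j
    using cell_avg_bounds[OF f n] cell_avg_bounds[OF h n]
    by (intro continuous_on_tendsto_compose[OF continuous_on_rate[OF p] a]) (auto intro!: always_eventually)
  then have "(\<lambda>k. graphon_rate p (grid_avg n (h k))) \<longlonglongrightarrow> graphon_rate p (grid_avg n f)"
    unfolding grid_avg_def graphon_rate_step[OF n] using n by (intro tendsto_intros) auto
  then show "graphon_rate p (grid_avg n f) \<le> l"
  proof (rule LIMSEQ_le[OF _ r(2)])
    show "\<exists>N. \<forall>k\<ge>N. graphon_rate p (grid_avg n (h k)) \<le> m k"
      using order_trans[OF graphon_rate_grid_avg_le[OF p h n] r(1)] by blast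
  qed
qed

section \<open>Completeness of the cut distance\<close>

lemma set_integral_graphon_bounds:
  assumes f: "f \<in> graphons" and A: "A \<in> sets square_measure"
  shows "0 \<le> (LINT z:A|square_measure. f z)" "(LINT z:A|square_measure. f z) \<le> measure square_measure A"
proof -
  have f01: "0 \<le> f z \<and> f z \<le> 1" if "z \<in> space square_measure" for z
    using that graphonD(2)[OF f, of "fst z" "snd z"] by (auto simp: space_square)
  show "0 \<le> (LINT z:A|square_measure. f z)"
    unfolding set_lebesgue_integral_def
    by (intro integral_nonneg_AE AE_I2) (use f01 in \<open>auto simp: indicator_def\<close>)
  have "(LINT z:A|square_measure. f z) \<le> (LINT z|square_measure. indicator A z)"
    unfolding set_lebesgue_integral_def
  proof (rule integral_mono)
    show "integrable square_measure (\<lambda>z. indicator A z *\<^sub>R f z)"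
      using graphon_integrable[OF f A] by (simp add: set_integrable_def)
    show "integrable square_measure (indicator A :: _ \<Rightarrow> real)"
      using A by (simp add: square_measure.P.emeasure_eq_measure)
  qed (use f01 in \<open>auto simp: indicator_def\<close>)
  then show "(LINT z:A|square_measure. f z) \<le> measure square_measure A"
    using A by (simp add: sets.Int_space_eq2)
qed

lemma set_integral_graphon_sums:
  assumes f: "f \<in> graphons" and A: "range A \<subseteq> sets square_measure" "disjoint_family A"
  shows "(LINT z:(\<Union>i. A i)|square_measure. f z) = (\<Sum>i. LINT z:A i|square_measure. f z)"
proof (rule lebesgue_integral_countable_add)
  show "A i \<in> sets square_measure" for i using A by auto
  show "A i \<inter> A j = {}" if "i \<noteq> j" for i j using A(2) that by (auto simp: disjoint_family_on_def)
  have "(\<Union>i. A i) \<in> sets square_measure" using A by auto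
  then show "set_integrable square_measure (\<Union>i. A i) f" by (rule graphon_integrable[OF f])
qed

text \<open>If the integrals over all rectangles converge, then so do those over all measurable sets; the
  limit is a measure dominated by \<open>square_measure\<close>, and its density is the limit graphon.\<close>

theorem cut_dist_complete:
  assumes f: "\<And>k. f k \<in> graphons" and cauchy: "\<And>k. cut_dist (f k) (f (Suc k)) \<le> (1 / 2) ^ k"
  obtains g where "g \<in> graphons" "(\<lambda>k. cut_dist (f k) g) \<longlonglongrightarrow> 0"
proof -
  let ?N = square_measure
  define I where "I k A = (LINT z:A|?N. f k z)" for k A
  have Ibd: "0 \<le> I k A" "I k A \<le> measure ?N A" if "A \<in> sets ?N" for k A
    unfolding I_def by (rule set_integral_graphon_bounds[OF f that])+
  have Isum: "I k (\<Union>i. A i) = (\<Sum>i. I k (A i))" if "range A \<subseteq> sets ?N" "disjoint_family A" for k A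
    unfolding I_def by (rule set_integral_graphon_sums[OF f that])
  have step: "\<bar>I k (S \<times> T) - I (Suc k) (S \<times> T)\<bar> \<le> (1 / 2) ^ k"
    if ST: "S \<in> sets unit_measure" "T \<in> sets unit_measure" for k S T
  proof -
    have "S \<times> T \<in> sets ?N" using ST by simp
    then have "(LINT z:S \<times> T|?N. f k z - f (Suc k) z) = I k (S \<times> T) - I (Suc k) (S \<times> T)"
      unfolding I_def by (intro set_integral_diff(2) graphon_integrable f)
    then show ?thesis using cut_dist_upper[OF f f ST, of k "Suc k"] cauchy[of k] by simp
  qed
  have conv_rect: "convergent (\<lambda>k. I k (S \<times> T))" if ST: "S \<in> sets unit_measure" "T \<in> sets unit_measure" for S T
  proof -
    have "summable (\<lambda>k. I (Suc k) (S \<times> T) - I k (S \<times> T))"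
    proof (rule summable_comparison_test')
      show "summable (\<lambda>k. (1 / 2 :: real) ^ k)" by (rule summable_geometric) simp
      show "norm (I (Suc k) (S \<times> T) - I k (S \<times> T)) \<le> (1 / 2) ^ k" if "0 \<le> k" for k
        using step[OF ST, of k] by simp
    qed
    then have "convergent (\<lambda>n. \<Sum>k<n. I (Suc k) (S \<times> T) - I k (S \<times> T))"
      by (simp add: summable_iff_convergent)
    then have "convergent (\<lambda>n. I n (S \<times> T) - I 0 (S \<times> T))" by (simp only: sum_lessThan_telescope[of "\<lambda>k. I k (S \<times> T)"])
    then show ?thesis by (simp add: convergent_diff_const_right_iff)
  qed
  \<comment> \<open>Uniformly in k the terms are dominated by the measures of the disjoint pieces,
    whose sum is finite, so limit and sum may be exchanged.\<close>
  have tannery: "summable (\<lambda>i. norm (b i)) \<and> (\<lambda>k. I k (\<Union>i. A i)) \<longlonglongrightarrow> suminf b"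
    if A: "range A \<subseteq> sets ?N" "disjoint_family A" and b: "\<And>i. (\<lambda>k. I k (A i)) \<longlonglongrightarrow> b i" for A and b :: "nat \<Rightarrow> real"
  proof -
    have "(\<lambda>i. measure ?N (A i)) sums measure ?N (\<Union>i. A i)"
      by (rule square_measure.P.finite_measure_UNION[OF A])
    then have "summable (\<lambda>i. measure ?N (A i))" by (rule sums_summable)
    moreover have "\<forall>\<^sub>F (i, k) in at_top \<times>\<^sub>F sequentially. norm (I k (A i)) \<le> measure ?N (A i)"
      using Ibd A by (intro always_eventually) (auto simp: abs_le_iff range_subsetD intro: order_trans[of _ 0])
    ultimately show ?thesis
      using tannerys_theorem[of "\<lambda>i k. I k (A i)" b sequentially "\<lambda>i. measure ?N (A i)"] b Isum[OF A]
      by simp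
  qed
  have conv: "convergent (\<lambda>k. I k A)" if "A \<in> sets ?N" for A
  proof -
    let ?\<Omega> = "space unit_measure \<times> space unit_measure"
    let ?G = "{a \<times> b |a b. a \<in> sets unit_measure \<and> b \<in> sets unit_measure}"
    have N: "sets ?N = sigma_sets ?\<Omega> ?G" by (rule sets_pair_measure)
    have "A \<in> sigma_sets ?\<Omega> ?G" using that by (simp only: N)
    with Int_stable_pair_measure_generator pair_measure_closed show ?thesis
    \<comment> \<open>Rectangles form a generator stable under intersection, so complements and
      disjoint unions suffice to reach every measurable set.\<close>
    proof (induction rule: sigma_sets_induct_disjoint)
      case (basic A)
      then show ?case using conv_rect by auto
    next
      case empty
      then show ?case using conv_rect[of "{}" "{}"] by simp
    next
      case (compl A)
      then have A: "A \<in> sets ?N" by (simp only: N)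
      have "?\<Omega> \<in> sets ?N" by (intro pair_measureI sets.top)
      then have D: "?\<Omega> - A \<in> sets ?N" using A by (rule sets.Diff)
      have "I k (?\<Omega> - A) = I k ?\<Omega> - I k A" for k
      proof -
        have "I k (A \<union> (?\<Omega> - A)) = I k A + I k (?\<Omega> - A)"
          unfolding I_def
          by (rule set_integral_Un[OF _ graphon_integrable[OF f A] graphon_integrable[OF f D]]) auto
        moreover have "A \<union> (?\<Omega> - A) = ?\<Omega>" using sets.sets_into_space[OF A] by (auto simp: space_pair_measure)
        ultimately show ?thesis by simp
      qed
      then show ?case
        using convergent_diff[OF conv_rect[OF sets.top sets.top] compl(2)] by simp
    next
      case (union A)
      have A: "range A \<subseteq> sets ?N" using union(2) by (simp only: N)
      have "\<forall>i. \<exists>b. (\<lambda>k. I k (A i)) \<longlonglongrightarrow> b" using union(3) by (simp add: convergent_def)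
      then obtain b where "\<And>i. (\<lambda>k. I k (A i)) \<longlonglongrightarrow> b i" by metis
      from tannery[OF A union(1) this] show ?case by (auto simp: convergent_def)
    qed
  qed
  define L where "L A = lim (\<lambda>k. I k A)" for A
  have L: "(\<lambda>k. I k A) \<longlonglongrightarrow> L A" if "A \<in> sets ?N" for A
    unfolding L_def using conv[OF that] by (simp add: convergent_LIMSEQ_iff)
  have L0: "0 \<le> L A" and L1: "L A \<le> measure ?N A" if "A \<in> sets ?N" for A
    using LIMSEQ_le_const[OF L[OF that]] LIMSEQ_le_const2[OF L[OF that]] Ibd[OF that] by blast+
  define \<nu> where "\<nu> = measure_of (space ?N) (sets ?N) (\<lambda>A. ennreal (L A))"
  have sets\<nu> [simp]: "sets \<nu> = sets ?N" by (simp add: \<nu>_def sets.sigma_sets_eq)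
  have em: "emeasure \<nu> A = ennreal (L A)" if "A \<in> sets ?N" for A
    unfolding \<nu>_def
  proof (rule emeasure_measure_of_sigma[OF sets.sigma_algebra_axioms _ _ that])
    show "positive (sets ?N) (\<lambda>A. ennreal (L A))"
      using L1[of "{}"] by (simp add: positive_def ennreal_eq_0_iff)
    show "countably_additive (sets ?N) (\<lambda>A. ennreal (L A))"
    proof (rule countably_additiveI)
      fix A :: "nat \<Rightarrow> (real \<times> real) set"
      assume A: "range A \<subseteq> sets ?N" "disjoint_family A" "(\<Union>i. A i) \<in> sets ?N"
      have t: "summable (\<lambda>i. norm (L (A i)))" "(\<lambda>k. I k (\<Union>i. A i)) \<longlonglongrightarrow> (\<Sum>i. L (A i))"
        using tannery[OF A(1,2), of "\<lambda>i. L (A i)"] L A(1) by auto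
      have "L (\<Union>i. A i) = (\<Sum>i. L (A i))" by (rule LIMSEQ_unique[OF L[OF A(3)] t(2)])
      moreover have "(\<Sum>i. ennreal (L (A i))) = ennreal (\<Sum>i. L (A i))"
        by (rule suminf_ennreal2) (use L0 A(1) summable_norm_cancel[OF t(1)] in auto)
      ultimately show "(\<Sum>i. ennreal (L (A i))) = ennreal (L (\<Union>i. A i))" by simp
    qed
  qed
  have "absolutely_continuous ?N \<nu>"
    unfolding absolutely_continuous_def
  proof
    fix A assume A: "A \<in> null_sets ?N"
    then have "A \<in> sets ?N" "measure ?N A = 0" by (auto simp: null_sets_def measure_def)
    then show "A \<in> null_sets \<nu>" using L1[of A] by (auto simp: null_sets_def em ennreal_eq_0_iff)
  qed
  from square_measure.P.Radon_Nikodym[OF this sets\<nu>] obtain h where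
    h [measurable]: "h \<in> borel_measurable ?N" and dens: "density ?N h = \<nu>" by blast
  have hint: "(\<integral>\<^sup>+z. h z * indicator A z \<partial>?N) = ennreal (L A)" if "A \<in> sets ?N" for A
    using em[OF that] emeasure_density[OF h that] dens by simp
  \<comment> \<open>On the set B where h exceeds 1 the integral of h - 1 vanishes, because L B is at
    most the measure of B.\<close>
  have h1: "AE z in ?N. h z \<le> 1"
  proof -
    define B where "B = {z \<in> space ?N. 1 < h z}"
    have B [measurable]: "B \<in> sets ?N" unfolding B_def by measurable
    have "(\<integral>\<^sup>+z. h z * indicator B z - indicator B z \<partial>?N)
        = (\<integral>\<^sup>+z. h z * indicator B z \<partial>?N) - (\<integral>\<^sup>+z. indicator B z \<partial>?N)"
    proof (rule nn_integral_diff)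
      show "(\<integral>\<^sup>+z. indicator B z \<partial>?N) \<noteq> \<infinity>"
        using B by (simp add: square_measure.P.emeasure_eq_measure)
    qed (auto simp: B_def indicator_def)
    also have "\<dots> = ennreal (L B) - ennreal (measure ?N B)"
      using hint[OF B] B by (simp add: square_measure.P.emeasure_eq_measure)
    also have "\<dots> = 0" using L0[OF B] L1[OF B] by (simp add: ennreal_minus ennreal_neg)
    finally have "AE z in ?N. h z * indicator B z - indicator B z = 0"
      by (subst (asm) nn_integral_0_iff_AE) auto
    then show ?thesis
    proof (rule AE_mp, intro AE_I2 impI)
      fix z assume z: "z \<in> space ?N" "h z * indicator B z - indicator B z = 0"
      show "h z \<le> 1"
      proof (rule ccontr)
        assume "\<not> h z \<le> 1"
        then have "1 < h z" by simp
        then have "z \<in> B" using z(1) by (simp add: B_def)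
        then have "h z - 1 = 0" using z(2) by simp
        then have "h z \<le> 1" by (rule ennreal_minus_eq_0)
        then show False using \<open>1 < h z\<close> by simp
      qed
    qed
  qed
  \<comment> \<open>The bound 1 is known almost everywhere; truncation enforces it everywhere, as
    membership in \<open>graphons\<close> demands.\<close>
  define g0 where "g0 z = enn2real (min 1 (h z))" for z
  have g0m [measurable]: "g0 \<in> borel_measurable ?N" unfolding g0_def[abs_def] by measurable
  have g001: "0 \<le> g0 z \<and> g0 z \<le> 1" for z
  proof -
    have "enn2real (min 1 (h z)) \<le> enn2real 1" by (rule enn2real_mono) auto
    then show ?thesis by (simp add: g0_def)
  qed
  have g0int: "(LINT z|?N. indicator A z * g0 z) = L A" if A: "A \<in> sets ?N" for A
  proof -
    have "(LINT z|?N. indicator A z * g0 z) = enn2real (\<integral>\<^sup>+z. ennreal (indicator A z * g0 z) \<partial>?N)"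
      by (rule integral_eq_nn_integral) (use A g001 in \<open>auto intro!: AE_I2 mult_nonneg_nonneg\<close>)
    also have "(\<integral>\<^sup>+z. ennreal (indicator A z * g0 z) \<partial>?N) = (\<integral>\<^sup>+z. h z * indicator A z \<partial>?N)"
    proof (rule nn_integral_cong_AE, use h1 in eventually_elim)
      fix z assume "h z \<le> 1"
      then have "h z < top" by (simp add: order_le_less_trans)
      with \<open>h z \<le> 1\<close> show "ennreal (indicator A z * g0 z) = h z * indicator A z"
        by (simp add: g0_def indicator_def min_absorb2)
    qed
    also have "\<dots> = ennreal (L A)" by (rule hint[OF A])
    finally show ?thesis using L0[OF A] by simp
  qed
  \<comment> \<open>The density is symmetric only up to a null set. Symmetrising leaves the
    integrals over rectangles unchanged, because L agrees on S \<times> T and T \<times> S.\<close>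
  define g where "g = restrict (\<lambda>z. (g0 z + g0 (snd z, fst z)) / 2) ({0..1} \<times> {0..1})"
  have swapm: "(\<lambda>z. g0 (snd z, fst z)) \<in> borel_measurable ?N" by measurable
  have g: "g \<in> graphons"
  proof -
    have "(\<lambda>z. (g0 z + g0 (snd z, fst z)) / 2) \<in> borel_measurable ?N" using swapm by measurable
    then have "g \<in> borel_measurable ?N"
      by (rule measurable_cong[THEN iffD1, rotated]) (auto simp: g_def space_square)
    moreover have "0 \<le> (g0 z + g0 w) / 2 \<and> (g0 z + g0 w) / 2 \<le> 1" for z w
      using g001[of z] g001[of w] by simp
    ultimately show ?thesis
      unfolding graphons_def by (auto simp: g_def PiE_def Pi_def extensional_def add.commute)
  qed
  have gint: "(LINT z:S \<times> T|?N. g z) = L (S \<times> T)"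
    if ST [measurable]: "S \<in> sets unit_measure" "T \<in> sets unit_measure" for S T
  proof -
    have rect: "S \<times> T \<in> sets ?N" "T \<times> S \<in> sets ?N" by measurable
    have "I k (S \<times> T) = I k (T \<times> S)" for k
      unfolding I_def set_lebesgue_integral_def using graphon_rectangle_swap[OF f ST] by simp
    then have sym: "L (S \<times> T) = L (T \<times> S)" by (simp add: L_def)
    have i1: "integrable ?N (\<lambda>z. indicator (S \<times> T) z * g0 z)"
      by (rule square_measure.P.integrable_const_bound[where B = 1])
         (use g001 in \<open>auto intro!: AE_I2 simp: indicator_def\<close>)
    have i2: "integrable ?N (\<lambda>z. indicator (S \<times> T) z * g0 (snd z, fst z))"
      by (rule square_measure.P.integrable_const_bound[where B = 1])
         (use g001 in \<open>auto intro!: AE_I2 simp: indicator_def\<close>)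
    have "(LINT z:S \<times> T|?N. g z)
        = (LINT z|?N. (indicator (S \<times> T) z * g0 z + indicator (S \<times> T) z * g0 (snd z, fst z)) / 2)"
      unfolding set_lebesgue_integral_def
      by (rule Bochner_Integration.integral_cong[OF refl]) (auto simp: g_def space_square indicator_def)
    also have "\<dots> = ((LINT z|?N. indicator (S \<times> T) z * g0 z) + (LINT z|?N. indicator (S \<times> T) z * g0 (snd z, fst z))) / 2"
      using i1 i2 by simp
    also have "\<dots> = L (S \<times> T)"
      using g0int[OF rect(1)] g0int[OF rect(2)] integral_rectangle_swap[OF g0m ST] sym by simp
    finally show ?thesis .
  qed
  have "cut_dist (f k) g \<le> 2 * (1 / 2) ^ k" for k
  proof (rule cut_dist_least)
    fix S T assume ST: "S \<in> sets unit_measure" "T \<in> sets unit_measure"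
    have rect: "S \<times> T \<in> sets ?N" using ST by simp
    \<comment> \<open>The geometric sum is kept in its exact form, which is what the induction on m
      reproduces.\<close>
    have le': "\<bar>I k (S \<times> T) - I (k + m) (S \<times> T)\<bar> \<le> 2 * (1 / 2) ^ k - 2 * (1 / 2) ^ (k + m)" for m
    proof (induction m)
      case (Suc m)
      then show ?case using step[OF ST, of "k + m"] by simp
    qed simp
    have le: "\<bar>I k (S \<times> T) - I (m + k) (S \<times> T)\<bar> \<le> 2 * (1 / 2) ^ k" for m
    proof -
      have "0 \<le> 2 * (1 / 2 :: real) ^ (k + m)" by simp
      then have "\<bar>I k (S \<times> T) - I (k + m) (S \<times> T)\<bar> \<le> 2 * (1 / 2) ^ k" using le'[of m] by linarith
      then show ?thesis by (simp only: add.commute[of m k])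
    qed
    have "(\<lambda>m. \<bar>I k (S \<times> T) - I (m + k) (S \<times> T)\<bar>) \<longlonglongrightarrow> \<bar>I k (S \<times> T) - L (S \<times> T)\<bar>"
      by (intro tendsto_intros LIMSEQ_ignore_initial_segment L rect)
    then have "\<bar>I k (S \<times> T) - L (S \<times> T)\<bar> \<le> 2 * (1 / 2) ^ k"
      by (rule LIMSEQ_le_const2) (use le in blast)
    moreover have "(LINT z:S \<times> T|?N. f k z - g z) = I k (S \<times> T) - L (S \<times> T)"
      unfolding gint[OF ST, symmetric] I_def by (intro set_integral_diff(2) graphon_integrable f g rect)
    ultimately show "\<bar>LINT z:S \<times> T|?N. f k z - g z\<bar> \<le> 2 * (1 / 2) ^ k" by simp
  qed
  then have "(\<lambda>k. cut_dist (f k) g) \<longlonglongrightarrow> 0"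
  proof (intro tendsto_sandwich[of "\<lambda>_. 0" "\<lambda>k. cut_dist (f k) g" sequentially "\<lambda>k. 2 * (1 / 2) ^ k" 0] always_eventually allI)
    show "0 \<le> cut_dist (f k) g" for k by (rule cut_dist_nonneg[OF f g])
    have "(\<lambda>k. 2 * (1 / 2 :: real) ^ k) \<longlonglongrightarrow> 2 * 0"
      by (intro tendsto_intros LIMSEQ_power_zero) simp
    then show "(\<lambda>k. 2 * (1 / 2 :: real) ^ k) \<longlonglongrightarrow> 0" by simp
  qed auto
  with g show ?thesis by (rule that)
qed

section \<open>Compactness of the graphon space\<close>

text \<open>Translates the half-open cell i onto the cell \<pi> i. The point 0 belongs to none of
  the cells 1, ..., n and stays fixed, so that a bijection of the closed interval results.\<close>

definition perm_map :: "nat \<Rightarrow> (nat \<Rightarrow> nat) \<Rightarrow> real \<Rightarrow> real" where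
  "perm_map n \<pi> x = (if x = 0 then 0 else x + (real (\<pi> (gidx n x)) - real (gidx n x)) / real n)"

lemma perm_map_gidx:
  assumes n: "0 < n" and \<pi>: "\<pi> permutes {1..n}" and x: "x \<in> {0..1}"
  shows "gidx n (perm_map n \<pi> x) = \<pi> (gidx n x)" "perm_map n \<pi> x \<in> {0..1}" "perm_map n \<pi> x = 0 \<longleftrightarrow> x = 0"
proof -
  let ?y = "perm_map n \<pi> x"
  have "gidx n ?y = \<pi> (gidx n x) \<and> ?y \<in> {0..1} \<and> (?y = 0 \<longleftrightarrow> x = 0)"
  proof (cases "x = 0")
    case True
    have "\<pi> 0 = 0" using \<pi> by (intro permutes_not_in) auto
    then show ?thesis using True by (simp add: perm_map_def gidx_def)
  next
    case False
    define i where "i = gidx n x"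
    have i: "i \<in> {1..n}" using gidx_le[OF x, of n] gidx_eq_0[OF n x] False by (auto simp: i_def)
    then have \<pi>i: "\<pi> i \<in> {1..n}" using permutes_in_image[OF \<pi>] by blast
    have "x \<in> cell n i" using x by (simp add: cell_def i_def del: atLeastAtMost_iff)
    then have "(real i - 1) / n < x" "x \<le> real i / n" using i by (auto simp: cell_eq)
    then have "?y \<in> cell n (\<pi> i)"
      using \<pi>i False by (auto simp: cell_eq perm_map_def diff_divide_distrib i_def)
    then have y: "?y \<in> {0..1}" "gidx n ?y = \<pi> i" unfolding cell_def by blast+
    moreover have "?y \<noteq> 0" using gidx_eq_0[OF n y(1)] y(2) \<pi>i by simp
    ultimately show ?thesis using False by (simp add: i_def)
  qed
  then show "gidx n ?y = \<pi> (gidx n x)" "?y \<in> {0..1}" "?y = 0 \<longleftrightarrow> x = 0" by blast+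
qed

lemma perm_map_inv:
  assumes n: "0 < n" and \<pi>: "\<pi> permutes {1..n}" and x: "x \<in> {0..1}"
  shows "perm_map n (inv \<pi>) (perm_map n \<pi> x) = x"
proof (cases "x = 0")
  case True
  then show ?thesis by (simp add: perm_map_def)
next
  case False
  define y where "y = perm_map n \<pi> x"
  have y: "gidx n y = \<pi> (gidx n x)" "y \<noteq> 0"
    using perm_map_gidx[OF n \<pi> x] False by (simp_all add: y_def)
  have "inv \<pi> (\<pi> (gidx n x)) = gidx n x" using permutes_inverses(2)[OF \<pi>] .
  then have "perm_map n (inv \<pi>) y = y + (real (gidx n x) - real (\<pi> (gidx n x))) / n"
    using y by (simp add: perm_map_def)
  moreover have "y = x + (real (\<pi> (gidx n x)) - real (gidx n x)) / n"
    using False by (simp add: y_def perm_map_def)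
  ultimately have "perm_map n (inv \<pi>) y = x" by (simp add: diff_divide_distrib)
  then show ?thesis by (simp only: y_def)
qed

lemma measurable_unit_ident: "(\<lambda>x. x) \<in> borel_measurable unit_measure"
  unfolding unit_measure_def by (rule measurable_restrict_space1) simp

lemma measurable_perm_map:
  assumes n: "0 < n" and \<pi>: "\<pi> permutes {1..n}"
  shows "perm_map n \<pi> \<in> measurable unit_measure unit_measure"
proof -
  note [measurable] = measurable_unit_ident
  have "(\<lambda>x. (real (\<pi> (gidx n x)) - real (gidx n x)) / real n) \<in> borel_measurable unit_measure"
    by (rule measurable_compose[OF measurable_gidx]) simp
  then have "perm_map n \<pi> \<in> borel_measurable unit_measure"
    unfolding perm_map_def[abs_def] by measurable
  then have "perm_map n \<pi> \<in> measurable unit_measure (restrict_space lborel {0..1})"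
    using perm_map_gidx(2)[OF n \<pi>] by (intro measurable_restrict_space2) auto
  then show ?thesis by (simp only: unit_measure_def)
qed

lemma measure_unit_cells:
  assumes n: "0 < n" and A [measurable]: "A \<in> sets unit_measure"
  shows "measure unit_measure A = (\<Sum>i=1..n. measure unit_measure (A \<inter> cell n i))"
proof -
  have "A \<subseteq> {0..1}" using sets.sets_into_space[OF A] by simp
  then have "A = (\<Union>i\<in>{..n}. A \<inter> cell n i)"
    using gidx_le[of _ n] by (auto simp: cell_def simp del: atLeastAtMost_iff)
  then have "measure unit_measure A = measure unit_measure (\<Union>i\<in>{..n}. A \<inter> cell n i)" by simp
  also have "\<dots> = (\<Sum>i\<in>{..n}. measure unit_measure (A \<inter> cell n i))"
    by (rule unit_measure.finite_measure_finite_Union)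
       (use disjoint_cells[of _ _ n] in \<open>auto simp: disjoint_family_on_def\<close>)
  also have "\<dots> = measure unit_measure (A \<inter> cell n 0) + (\<Sum>i=1..n. measure unit_measure (A \<inter> cell n i))"
    by (rule sum_atMost_eq)
  also have "measure unit_measure (A \<inter> cell n 0) = 0"
    using measure_cell_0[OF n] unit_measure.finite_measure_mono[of "A \<inter> cell n 0" "cell n 0"]
    by (auto simp: measure_le_0_iff)
  finally show ?thesis by simp
qed

text \<open>On each cell the map is a translation, under which Lebesgue measure is invariant, and
  \<pi> merely reorders the sum over the cells. The inverse is the map of
  \<open>inv \<pi>\<close>.\<close>

lemma perm_map_mp:
  assumes n: "0 < n" and \<pi>: "\<pi> permutes {1..n}"
  shows "perm_map n \<pi> \<in> mp_bijections"
proof -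
  let ?\<sigma> = "perm_map n \<pi>" and ?\<tau> = "perm_map n (inv \<pi>)" and ?I = "{0..1::real}"
  have \<pi>': "inv \<pi> permutes {1..n}" by (rule permutes_inv[OF \<pi>])
  have ts: "?\<tau> (?\<sigma> x) = x" if "x \<in> ?I" for x by (rule perm_map_inv[OF n \<pi> that])
  have st: "?\<sigma> (?\<tau> x) = x" if "x \<in> ?I" for x
    using perm_map_inv[OF n \<pi>' that] by (simp add: permutes_inv_inv[OF \<pi>])
  have bij: "bij_betw ?\<sigma> ?I ?I"
    by (rule bij_betw_byWitness[where f' = ?\<tau>])
       (use ts st perm_map_gidx(2)[OF n \<pi>] perm_map_gidx(2)[OF n \<pi>'] in \<open>auto simp del: atLeastAtMost_iff\<close>)
  note m = measurable_perm_map[OF n \<pi>] measurable_perm_map[OF n \<pi>']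
  have "inv_into ?I ?\<sigma> x = ?\<tau> x" if "x \<in> ?I" for x
    using st[OF that] perm_map_gidx(2)[OF n \<pi>' that] bij
    by (metis bij_betw_imp_inj_on inv_into_f_f)
  then have inv: "inv_into ?I ?\<sigma> \<in> measurable unit_measure unit_measure"
    by (subst measurable_cong[where g = ?\<tau>]) (auto simp: m simp del: atLeastAtMost_iff)
  have pre: "measure unit_measure (?\<sigma> -` A \<inter> ?I) = measure unit_measure A"
    if A [measurable]: "A \<in> sets unit_measure" for A
  proof -
    have pA: "?\<sigma> -` A \<inter> ?I \<in> sets unit_measure" using measurable_sets[OF m(1) A] by simp
    have piece: "measure unit_measure ((?\<sigma> -` A \<inter> ?I) \<inter> cell n i) = measure unit_measure (A \<inter> cell n (\<pi> i))"
      if i: "i \<in> {1..n}" for i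
    proof -
      define c where "c = (real (\<pi> i) - real i) / n"
      have \<pi>i: "\<pi> i \<in> {1..n}" using permutes_in_image[OF \<pi>] i by blast
      have AI: "A \<inter> cell n (\<pi> i) \<in> sets unit_measure" by measurable
      then have B: "A \<inter> cell n (\<pi> i) \<in> sets borel"
        by (auto simp: sets_unit sets_restrict_space)
      have eq: "(?\<sigma> -` A \<inter> ?I) \<inter> cell n i = (+) c -` (A \<inter> cell n (\<pi> i))"
      proof (rule set_eqI)
        fix x
        have c: "x \<in> cell n i \<longleftrightarrow> c + x \<in> cell n (\<pi> i)"
          using i \<pi>i by (auto simp: cell_eq c_def diff_divide_distrib)
        moreover have "?\<sigma> x = c + x" "x \<in> ?I" if "x \<in> cell n i"
        proof -
          have "gidx n x = i" "x \<in> ?I" using that by (auto simp: cell_def)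
          moreover have "x \<noteq> 0" using gidx_eq_0[OF n \<open>x \<in> ?I\<close>] \<open>gidx n x = i\<close> i by auto
          ultimately show "?\<sigma> x = c + x" "x \<in> ?I" by (auto simp: perm_map_def c_def)
        qed
        ultimately show "x \<in> (?\<sigma> -` A \<inter> ?I) \<inter> cell n i \<longleftrightarrow> x \<in> (+) c -` (A \<inter> cell n (\<pi> i))"
          by auto
      qed
      have "measure unit_measure ((?\<sigma> -` A \<inter> ?I) \<inter> cell n i) = measure lborel ((?\<sigma> -` A \<inter> ?I) \<inter> cell n i)"
        by (rule measure_unit[OF sets.Int[OF pA sets_cell]])
      also have "\<dots> = measure lborel ((+) c -` (A \<inter> cell n (\<pi> i)))" by (simp only: eq)
      also have "\<dots> = measure (distr lborel borel ((+) c)) (A \<inter> cell n (\<pi> i))"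
        using B by (subst measure_distr) auto
      also have "\<dots> = measure unit_measure (A \<inter> cell n (\<pi> i))"
        using measure_unit[OF AI] by (simp add: lborel_distr_plus)
      finally show ?thesis .
    qed
    have "measure unit_measure (?\<sigma> -` A \<inter> ?I) = (\<Sum>i=1..n. measure unit_measure (A \<inter> cell n (\<pi> i)))"
      using measure_unit_cells[OF n pA] piece by simp
    also have "\<dots> = (\<Sum>i=1..n. measure unit_measure (A \<inter> cell n i))"
      using sum.permute[OF \<pi>, of "\<lambda>i. measure unit_measure (A \<inter> cell n i)"] by (simp add: comp_def)
    also have "\<dots> = measure unit_measure A" by (rule measure_unit_cells[OF n A, symmetric])
    finally show ?thesis .
  qed
  have "distr unit_measure unit_measure ?\<sigma> = unit_measure"
  proof (rule measure_eqI)
    fix A assume "A \<in> sets (distr unit_measure unit_measure ?\<sigma>)"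
    then have A: "A \<in> sets unit_measure" by simp
    show "emeasure (distr unit_measure unit_measure ?\<sigma>) A = emeasure unit_measure A"
      using pre[OF A] by (simp add: emeasure_distr[OF m(1) A] unit_measure.emeasure_eq_measure)
  qed simp
  then show ?thesis using bij m inv by (simp add: mp_bijections_def)
qed

lemma relabel_perm_map:
  assumes "0 < n" "\<pi> permutes {1..n}"
  shows "relabel (perm_map n \<pi>) (step_graphon n A) = step_graphon n (\<lambda>i j. A (\<pi> i) (\<pi> j))"
  using perm_map_gidx[OF assms]
  by (auto simp: relabel_def step_graphon_def fun_eq_iff simp del: atLeastAtMost_iff)

section \<open>Sorting the classes of a partition, and a finite net of step graphons\<close>

lemma sorting_permutation:
  fixes c :: "nat \<Rightarrow> nat"
  obtains \<pi> where "\<pi> permutes {1..n}" "\<And>i j. 1 \<le> i \<Longrightarrow> i \<le> j \<Longrightarrow> j \<le> n \<Longrightarrow> c (\<pi> i) \<le> c (\<pi> j)"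
proof -
  define xs where "xs = sort_key c [1..<Suc n]"
  have xs: "length xs = n" "set xs = {1..n}" "distinct xs" "sorted (map c xs)"
    by (auto simp: xs_def)
  define \<pi> where "\<pi> i = (if i \<in> {1..n} then xs ! (i - 1) else i)" for i
  have "bij_betw \<pi> {1..n} {1..n}"
  proof (rule bij_betw_imageI)
    show "inj_on \<pi> {1..n}"
    proof (rule inj_onI)
      fix i j assume ij: "i \<in> {1..n}" "j \<in> {1..n}" "\<pi> i = \<pi> j"
      then have "i - 1 = j - 1"
        using nth_eq_iff_index_eq[OF xs(3), of "i - 1" "j - 1"] xs(1) by (auto simp: \<pi>_def)
      then show "i = j" using ij by auto
    qed
    show "\<pi> ` {1..n} = {1..n}"
    proof (intro equalityI subsetI)
      fix y assume "y \<in> \<pi> ` {1..n}"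
      then obtain i where "i \<in> {1..n}" "y = xs ! (i - 1)" by (auto simp: \<pi>_def)
      then show "y \<in> {1..n}" using xs(1,2) nth_mem[of "i - 1" xs] by auto
    next
      fix y assume "y \<in> {1..n}"
      then obtain k where "k < n" "xs ! k = y" using xs(1,2) by (metis in_set_conv_nth)
      then show "y \<in> \<pi> ` {1..n}" by (intro image_eqI[of _ _ "Suc k"]) (auto simp: \<pi>_def)
    qed
  qed
  then have "\<pi> permutes {1..n}" by (rule bij_imp_permutes) (auto simp: \<pi>_def)
  moreover have "c (\<pi> i) \<le> c (\<pi> j)" if "1 \<le> i" "i \<le> j" "j \<le> n" for i j
    using sorted_nth_mono[OF xs(4), of "i - 1" "j - 1"] that xs(1) by (simp add: \<pi>_def)
  ultimately show ?thesis by (rule that)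
qed

lemma orbit_dist_le_cut:
  assumes "f \<in> graphons" "g \<in> graphons" "\<sigma> \<in> mp_bijections"
  shows "orbit_dist f g \<le> cut_dist f (relabel \<sigma> g)"
  unfolding orbit_dist_def by (intro cINF_lower orbit_dist_bdd assms)

lemma orbit_dist_le_cut_dist: "f \<in> graphons \<Longrightarrow> g \<in> graphons \<Longrightarrow> orbit_dist f g \<le> cut_dist f g"
  using orbit_dist_le_cut[OF _ _ id_mp] by (simp add: relabel_id)

lemma orbit_dist_relabel:
  assumes "f \<in> graphons" "\<sigma> \<in> mp_bijections"
  shows "orbit_dist (relabel \<sigma> f) f = 0"
  using orbit_dist_le_cut[OF relabel_graphon[OF assms(2,1)] assms]
    orbit_dist_nonneg[OF relabel_graphon[OF assms(2,1)] assms(1)]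
  by (simp add: cut_dist_refl relabel_graphon assms)

lemma fiber_avg_symmetric:
  fixes A :: "'a \<times> 'a \<Rightarrow> real"
  assumes "\<And>i j. A (i, j) = A (j, i)"
  shows "fiber_avg (V \<times> V) (map_prod c c) A (i, j) = fiber_avg (V \<times> V) (map_prod c c) A (j, i)"
proof -
  let ?F = "\<lambda>i j. {y \<in> V \<times> V. map_prod c c y = map_prod c c (i, j)}"
  have b: "bij_betw prod.swap (?F i j) (?F j i)"
    by (rule bij_betw_byWitness[where f' = prod.swap]) auto
  have "(\<Sum>y\<in>?F i j. A y) = (\<Sum>y\<in>?F i j. A (prod.swap y))"
    using assms by (intro sum.cong refl) (auto simp: prod.swap_def)
  also have "\<dots> = (\<Sum>y\<in>?F j i. A y)" by (rule sum.reindex_bij_betw[OF b])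
  finally show ?thesis using bij_betw_same_card[OF b] by (simp add: fiber_avg_def)
qed

lemma graphon_regularity:
  assumes n: "0 < n" and A: "\<And>i j. A i j = A j i" "\<And>i j. 0 \<le> A i j" "\<And>i j. A i j \<le> 1"
    and e: "0 < e" "1 < real k * e\<^sup>2"
  obtains c where "\<And>i. c i < (4::nat) ^ k"
    "step_graphon n (\<lambda>i j. fiber_avg ({1..n} \<times> {1..n}) (map_prod c c) (\<lambda>z. A (fst z) (snd z)) (i, j)) \<in> graphons"
    "cut_dist (step_graphon n A)
      (step_graphon n (\<lambda>i j. fiber_avg ({1..n} \<times> {1..n}) (map_prod c c) (\<lambda>z. A (fst z) (snd z)) (i, j))) \<le> e"
proof -
  let ?A = "\<lambda>z. A (fst z) (snd z)"
  obtain c :: "nat \<Rightarrow> nat" where c: "\<And>i. c i < 4 ^ k"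
    "\<And>S T. S \<subseteq> {1..n} \<Longrightarrow> T \<subseteq> {1..n} \<Longrightarrow>
      \<bar>\<Sum>z\<in>S \<times> T. ?A z - fiber_avg ({1..n} \<times> {1..n}) (map_prod c c) ?A z\<bar> \<le> e * (real (card {1..n}))\<^sup>2"
    by (rule weak_regularity[of "{1..n}" ?A e k]) (use n A e in auto)
  show ?thesis
  proof (rule that[OF c(1)])
    show "step_graphon n (\<lambda>i j. fiber_avg ({1..n} \<times> {1..n}) (map_prod c c) ?A (i, j)) \<in> graphons"
    proof (rule step_graphon_in)
      show "fiber_avg ({1..n} \<times> {1..n}) (map_prod c c) ?A (i, j) = fiber_avg ({1..n} \<times> {1..n}) (map_prod c c) ?A (j, i)" for i j
        by (rule fiber_avg_symmetric) (use A in simp)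
    qed (intro fiber_avg_range; use A in simp)+
    show "cut_dist (step_graphon n A) (step_graphon n (\<lambda>i j. fiber_avg ({1..n} \<times> {1..n}) (map_prod c c) ?A (i, j))) \<le> e"
      by (rule cut_dist_step_le[OF n]) (use c(2) in simp)
  qed
qed

text \<open>\<open>(i + l - 1) div l\<close> is i / l rounded up, the coarse cell that contains the
  fine cell i; it sends 0 to 0, so equality holds at every point of the square.\<close>

lemma step_graphon_coarse:
  assumes l: "0 < l"
  shows "step_graphon N G = step_graphon (N * l) (\<lambda>i j. G ((i + l - 1) div l) ((j + l - 1) div l))"
proof -
  have b: "(i + l - 1) div l \<le> m \<longleftrightarrow> i \<le> l * m" for i m :: nat
  proof -
    have "(i + l - 1) div l < Suc m \<longleftrightarrow> i + l - 1 < Suc m * l" using l by (rule div_less_iff_less_mult)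
    then show ?thesis using l by (auto simp: algebra_simps)
  qed
  have "gidx N x = (gidx (N * l) x + l - 1) div l" if "x \<in> {0..1}" for x
  proof -
    have "gidx N x \<le> m \<longleftrightarrow> (gidx (N * l) x + l - 1) div l \<le> m" for m
    proof -
      have "gidx N x \<le> m \<longleftrightarrow> real N * x \<le> real m" by (simp add: gidx_def nat_le_iff ceiling_le_iff)
      also have "\<dots> \<longleftrightarrow> real l * (real N * x) \<le> real l * real m" using l by simp
      also have "\<dots> \<longleftrightarrow> gidx (N * l) x \<le> l * m"
        by (simp add: gidx_def nat_le_iff ceiling_le_iff mult_ac)
      finally show ?thesis by (simp only: b)
    qed
    then show ?thesis by (metis order_antisym order_refl)
  qed
  then show ?thesis by (auto simp: step_graphon_def fun_eq_iff simp del: atLeastAtMost_iff)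
qed

text \<open>Block I runs from \<open>(I - 1) * l + 1\<close> to \<open>I * l\<close>. A sorted
  colouring rises by at least 1 inside each block where it is not constant, while its values stay
  below K.\<close>

lemma coarse_block_count:
  fixes d :: "nat \<Rightarrow> nat"
  assumes mono: "\<And>i j. 1 \<le> i \<Longrightarrow> i \<le> j \<Longrightarrow> j \<le> N * l \<Longrightarrow> d i \<le> d j" and K: "\<And>i. d i < K" and l: "0 < l"
  shows "card {I \<in> {1..N}. d ((I - 1) * l + 1) < d (I * l)} \<le> K"
proof -
  \<comment> \<open>Monotonicity says nothing about the colour of index 0, so the telescoping sum
    starts from the value 0 instead.\<close>
  define e where "e I = (if I = 0 then 0 else d (I * l))" for I
  have "real (card {I \<in> {1..N}. d ((I - 1) * l + 1) < d (I * l)})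
      = (\<Sum>I=1..N. if d ((I - 1) * l + 1) < d (I * l) then 1 else 0)"
    by (simp add: sum.If_cases Int_def conj_commute)
  also have "\<dots> \<le> (\<Sum>I=1..N. real (e I) - real (e (I - 1)))"
  proof (rule sum_mono)
    fix I assume I: "I \<in> {1..N}"
    have Il: "I * l \<le> N * l" using I by simp
    have 1: "(I - 1) * l + 1 \<le> I * l" using I l by (cases I) auto
    have "e (I - 1) \<le> d ((I - 1) * l + 1)"
    proof (cases "I - 1 = 0")
      case False
      then have "1 \<le> (I - 1) * l" using l by simp
      then have "d ((I - 1) * l) \<le> d ((I - 1) * l + 1)" by (rule mono[OF _ le_add1 order_trans[OF 1 Il]])
      then show ?thesis using False by (simp add: e_def)
    qed (simp add: e_def)
    moreover have "d ((I - 1) * l + 1) \<le> d (I * l)" by (rule mono) (use 1 Il in auto)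
    moreover have "e I = d (I * l)" using I by (simp add: e_def)
    ultimately show "(if d ((I - 1) * l + 1) < d (I * l) then 1 else 0) \<le> real (e I) - real (e (I - 1))"
      by auto
  qed
  also have "\<dots> = real (e N) - real (e 0)"
    using sum_Suc_diff'[of 0 N "\<lambda>I. real (e I)"] by (simp add: sum.atLeast1_atMost_eq atLeast0LessThan)
  also have "\<dots> \<le> real K" using K[of "N * l"] K[of 0] by (auto simp: e_def)
  finally show ?thesis by simp
qed

lemma sum_indicator_card:
  assumes "finite X"
  shows "(\<Sum>z\<in>X. indicator B z :: real) = real (card (X \<inter> B))"
  using assms by induction (auto simp: indicator_def Int_insert_left)

text \<open>All but K of the coarse blocks carry a single colour. Where row and column block are
  both of this kind, R is constant and rounding costs 1/N; the rows and columns of the other blocks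
  fill at most the fraction 2K/N of the square. The range of possible G does not depend on
  l.\<close>

lemma coarse_approx:
  fixes d :: "nat \<Rightarrow> nat" and R :: "nat \<Rightarrow> nat \<Rightarrow> real"
  assumes N: "0 < N" and l: "0 < l"
    and R: "\<And>i j. R i j = R j i" "\<And>i j. 0 \<le> R i j" "\<And>i j. R i j \<le> 1"
    and dR: "\<And>i j i' j'. d i = d i' \<Longrightarrow> d j = d j' \<Longrightarrow> R i j = R i' j'"
    and mono: "\<And>i j. 1 \<le> i \<Longrightarrow> i \<le> j \<Longrightarrow> j \<le> N * l \<Longrightarrow> d i \<le> d j" and K: "\<And>i. d i < K"
  obtains G where "\<And>I J. G I J = G J I" "\<And>I J. G I J \<in> (\<lambda>m. real m / N) ` {..N}"
    "\<And>I J. I \<notin> {1..N} \<or> J \<notin> {1..N} \<Longrightarrow> G I J = 0"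
    "cut_dist (step_graphon (N * l) R) (step_graphon N G) \<le> (2 * real K + 1) / real N"
proof -
  let ?n = "N * l"
  have n: "0 < ?n" using N l by simp
  define b where "b i = (i + l - 1) div l" for i
  \<comment> \<open>Each block is represented by its first index, and the entry is rounded down to a
    multiple of 1/N.\<close>
  define G where "G I J = (if I \<in> {1..N} \<and> J \<in> {1..N}
      then real (nat \<lfloor>real N * R ((I - 1) * l + 1) ((J - 1) * l + 1)\<rfloor>) / N else 0)" for I J
  have G1: "G I J = G J I" for I J using R(1) by (simp add: G_def)
  have G2: "G I J \<in> (\<lambda>m. real m / N) ` {..N}" for I J
  proof (cases "I \<in> {1..N} \<and> J \<in> {1..N}")
    case True
    have "real N * R i j \<le> real N" for i j using mult_left_mono[OF R(3), of "real N" i j] by simp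
    then have "nat \<lfloor>real N * R ((I - 1) * l + 1) ((J - 1) * l + 1)\<rfloor> \<le> N"
      by (simp add: nat_le_iff floor_le_iff) (meson le_less_trans less_add_one)
    then show ?thesis using True by (auto simp: G_def)
  next
    case False
    then show ?thesis by (auto simp: G_def intro!: image_eqI[of _ _ 0])
  qed
  define Bad where "Bad = {I \<in> {1..N}. d ((I - 1) * l + 1) < d (I * l)}"
  define BadV where "BadV = {i \<in> {1..?n}. b i \<in> Bad}"
  have cb: "card Bad \<le> K" unfolding Bad_def by (rule coarse_block_count[OF mono K l])
  have bprop: "b i \<in> {1..N}" "(b i - 1) * l + 1 \<le> i" "i \<le> b i * l" if i: "i \<in> {1..?n}" for i
  proof -
    have lt: "b i < Suc m \<longleftrightarrow> i \<le> l * m" for m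
    proof -
      have "(i + l - 1) div l < Suc m \<longleftrightarrow> i + l - 1 < Suc m * l" using l by (rule div_less_iff_less_mult)
      then show ?thesis using l by (auto simp: algebra_simps b_def)
    qed
    show "i \<le> b i * l" using lt[of "b i"] by (simp add: mult.commute)
    have "b i \<noteq> 0" using lt[of 0] i by (intro notI) auto
    moreover have "b i \<le> N" using lt[of N] i by (simp add: mult.commute)
    ultimately show "b i \<in> {1..N}" by simp
    have "\<not> b i < Suc (b i - 1)" using \<open>b i \<noteq> 0\<close> by simp
    then show "(b i - 1) * l + 1 \<le> i" using lt[of "b i - 1"] by (simp add: mult.commute)
  qed
  have good: "d i = d ((b i - 1) * l + 1)" if i: "i \<in> {1..?n}" "i \<notin> BadV" for i
  proof -
    note bp = bprop[OF i(1)]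
    have "b i * l \<le> ?n" using bp(1) by simp
    then have "d ((b i - 1) * l + 1) \<le> d i" "d i \<le> d (b i * l)" using bp i by (auto intro!: mono)
    moreover have "\<not> d ((b i - 1) * l + 1) < d (b i * l)" using i bp(1) by (auto simp: BadV_def Bad_def)
    ultimately show ?thesis by simp
  qed
  have finBV: "finite BadV" by (simp add: BadV_def)
  have cbv: "card BadV \<le> K * l"
  proof -
    have "BadV \<subseteq> (\<Union>I\<in>Bad. {(I - 1) * l + 1..I * l})"
      using bprop by (auto simp: BadV_def)
    then have "card BadV \<le> card (\<Union>I\<in>Bad. {(I - 1) * l + 1..I * l})"
      by (intro card_mono) (auto simp: Bad_def)
    also have "\<dots> \<le> (\<Sum>I\<in>Bad. card {(I - 1) * l + 1..I * l})"
      by (rule card_UN_le) (simp add: Bad_def)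
    also have "\<dots> \<le> (\<Sum>I\<in>Bad. l)"
    proof (rule sum_mono)
      fix I assume "I \<in> Bad"
      then show "card {(I - 1) * l + 1..I * l} \<le> l" by (cases I) (auto simp: Bad_def)
    qed
    also have "\<dots> \<le> K * l" using cb by simp
    finally show ?thesis .
  qed
  define D where "D i j = R i j - G (b i) (b j)" for i j
  have D1: "\<bar>D i j\<bar> \<le> 1" for i j
  proof -
    have "0 \<le> G I J \<and> G I J \<le> 1" for I J using G2[of I J] N by auto
    then show ?thesis using R(2,3)[of i j] unfolding D_def by (smt (verit))
  qed
  have Dg: "\<bar>D i j\<bar> \<le> 1 / N" if ij: "i \<in> {1..?n}" "j \<in> {1..?n}" "i \<notin> BadV" "j \<notin> BadV" for i j
  proof -
    let ?r = "R ((b i - 1) * l + 1) ((b j - 1) * l + 1)"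
    have "R i j = ?r" by (rule dR) (use good ij in auto)
    moreover have "G (b i) (b j) = real (nat \<lfloor>real N * ?r\<rfloor>) / N"
      using bprop(1)[OF ij(1)] bprop(1)[OF ij(2)] by (simp add: G_def)
    moreover have "real (nat \<lfloor>real N * ?r\<rfloor>) = real_of_int \<lfloor>real N * ?r\<rfloor>"
      using R(2) by (simp add: of_nat_nat)
    moreover have "\<bar>real N * ?r - real_of_int \<lfloor>real N * ?r\<rfloor>\<bar> \<le> 1" by linarith
    moreover have "?r = real N * ?r / N" using N by simp
    ultimately have "D i j = (real N * ?r - real_of_int \<lfloor>real N * ?r\<rfloor>) / N"
      unfolding D_def diff_divide_distrib by metis
    then show ?thesis
      using \<open>\<bar>real N * ?r - real_of_int \<lfloor>real N * ?r\<rfloor>\<bar> \<le> 1\<close> by (simp only: abs_divide) (simp add: divide_right_mono)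
  qed
  have Dtot: "(\<Sum>z\<in>{1..?n} \<times> {1..?n}. \<bar>D (fst z) (snd z)\<bar>) \<le> (2 * real K + 1) / real N * (real ?n)\<^sup>2"
  proof -
    let ?X = "{1..?n} \<times> {1..?n}"
    have "(\<Sum>z\<in>?X. \<bar>D (fst z) (snd z)\<bar>)
        \<le> (\<Sum>z\<in>?X. 1 / N + indicator (BadV \<times> {1..?n}) z + indicator ({1..?n} \<times> BadV) z)"
    proof (rule sum_mono)
      fix z assume z: "z \<in> ?X"
      show "\<bar>D (fst z) (snd z)\<bar> \<le> 1 / N + indicator (BadV \<times> {1..?n}) z + indicator ({1..?n} \<times> BadV) z"
      proof (cases "fst z \<in> BadV \<or> snd z \<in> BadV")
        case True
        have "0 \<le> 1 / real N" by simp
        moreover have "1 \<le> indicator (BadV \<times> {1..?n}) z + (indicator ({1..?n} \<times> BadV) z :: real)"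
          using True z by (auto simp: indicator_def)
        ultimately show ?thesis using D1[of "fst z" "snd z"] by linarith
      next
        case False
        have "\<bar>D (fst z) (snd z)\<bar> \<le> 1 / N" using False z by (intro Dg) auto
        moreover have "0 \<le> (indicator (BadV \<times> {1..?n}) z :: real)" "0 \<le> (indicator ({1..?n} \<times> BadV) z :: real)" by simp_all
        ultimately show ?thesis by linarith
      qed
    qed
    also have "\<dots> = real (card ?X) / N + real (card (BadV \<times> {1..?n})) + real (card ({1..?n} \<times> BadV))"
    proof -
      have s: "?X \<inter> (BadV \<times> {1..?n}) = BadV \<times> {1..?n}" "?X \<inter> ({1..?n} \<times> BadV) = {1..?n} \<times> BadV"
        by (auto simp: BadV_def)
      have "(\<Sum>z\<in>?X. indicator (BadV \<times> {1..?n}) z :: real) = real (card (?X \<inter> (BadV \<times> {1..?n})))"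
        "(\<Sum>z\<in>?X. indicator ({1..?n} \<times> BadV) z :: real) = real (card (?X \<inter> ({1..?n} \<times> BadV)))"
        by (rule sum_indicator_card; simp)+
      then show ?thesis unfolding s by (simp add: sum.distrib)
    qed
    also have "\<dots> = (real ?n)\<^sup>2 / N + 2 * (real (card BadV) * real ?n)"
      by (simp add: card_cartesian_product power2_eq_square)
    also have "\<dots> \<le> (real ?n)\<^sup>2 / N + 2 * (real (K * l) * real ?n)"
      by (intro add_left_mono mult_left_mono mult_right_mono of_nat_mono cbv) auto
    also have "\<dots> = (2 * real K + 1) / real N * (real ?n)\<^sup>2"
      using N by (simp add: power2_eq_square field_simps)
    finally show ?thesis .
  qed
  have "cut_dist (step_graphon ?n R) (step_graphon ?n (\<lambda>i j. G (b i) (b j))) \<le> (2 * real K + 1) / real N"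
  proof (rule cut_dist_step_le[OF n])
    fix S T assume ST: "S \<subseteq> {1..?n}" "T \<subseteq> {1..?n}"
    have "\<bar>\<Sum>z\<in>S \<times> T. R (fst z) (snd z) - G (b (fst z)) (b (snd z))\<bar> \<le> (\<Sum>z\<in>S \<times> T. \<bar>D (fst z) (snd z)\<bar>)"
      unfolding D_def by (rule sum_abs)
    also have "\<dots> \<le> (\<Sum>z\<in>{1..?n} \<times> {1..?n}. \<bar>D (fst z) (snd z)\<bar>)"
      by (rule sum_mono2) (use ST in auto)
    also note Dtot
    finally show "\<bar>\<Sum>z\<in>S \<times> T. R (fst z) (snd z) - G (b (fst z)) (b (snd z))\<bar> \<le> (2 * real K + 1) / real N * (real ?n)\<^sup>2" .
  qed
  then have "cut_dist (step_graphon ?n R) (step_graphon N G) \<le> (2 * real K + 1) / real N"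
    using step_graphon_coarse[OF l, of N G] by (simp add: b_def)
  moreover have "G I J = 0" if "I \<notin> {1..N} \<or> J \<notin> {1..N}" for I J using that by (auto simp: G_def)
  ultimately show ?thesis using G1 G2 by (intro that[of G])
qed

text \<open>N and the net depend on e alone. Only the refinement l depends on f, so that the grid
  with N * l cells is fine enough for it; regularity, sorting and coarsening then lead back to an N
  by N matrix with finitely many possible entries.\<close>

lemma finite_grid_net:
  assumes e: "0 < e"
  obtains \<F> where "finite \<F>" "\<F> \<subseteq> graphons" "\<And>f. f \<in> graphons \<Longrightarrow> \<exists>h\<in>\<F>. orbit_dist f h < e"
proof -
  \<comment> \<open>Three errors of size \<epsilon> will occur, from the grid, from regularity and
    from coarsening; relabelling costs nothing.\<close>
  define \<epsilon> where "\<epsilon> = e / 4"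
  have \<epsilon>: "0 < \<epsilon>" using e by (simp add: \<epsilon>_def)
  obtain k :: nat where k: "1 / \<epsilon>\<^sup>2 < real k" using reals_Archimedean2 by blast
  then have k: "1 < real k * \<epsilon>\<^sup>2" using \<epsilon> by (simp add: field_simps)
  define K :: nat where "K = 4 ^ k"
  obtain N :: nat where N: "(2 * real K + 1) / \<epsilon> < real N" using reals_Archimedean2 by blast
  have N0: "0 < N"
  proof (rule ccontr)
    assume "\<not> 0 < N"
    then have "(2 * real K + 1) / \<epsilon> < 0" using N by simp
    moreover have "0 \<le> (2 * real K + 1) / \<epsilon>" using \<epsilon> by simp
    ultimately show False by simp
  qed
  have NK: "(2 * real K + 1) / real N < \<epsilon>" using N N0 \<epsilon> by (simp add: field_simps)
  let ?V = "(\<lambda>m. real m / N) ` {..N}" and ?X = "{1..N} \<times> {1..N}"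
  let ?mat = "\<lambda>B i j. if i \<in> {1..N} \<and> j \<in> {1..N} then B (i, j) else (0::real)"
  define \<F> where "\<F> = (\<lambda>B. step_graphon N (?mat B)) ` (PiE ?X (\<lambda>_. ?V)) \<inter> graphons"
  have "finite (PiE ?X (\<lambda>_. ?V))" by (intro finite_PiE) auto
  then have 1: "finite \<F>" by (simp add: \<F>_def)
  have 2: "\<F> \<subseteq> graphons" by (simp add: \<F>_def)
  have 3: "\<exists>h\<in>\<F>. orbit_dist f h < e" if f: "f \<in> graphons" for f
  proof -
    have "\<forall>\<^sub>F n in sequentially. cut_dist f (grid_avg n f) < \<epsilon>"
      using grid_avg_cut_dist[OF f] \<epsilon> by (rule order_tendstoD(2))
    then obtain n0 where n0: "\<And>n. n0 \<le> n \<Longrightarrow> cut_dist f (grid_avg n f) < \<epsilon>"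
      by (auto simp: eventually_sequentially)
    define l where "l = Suc n0"
    let ?n = "N * l"
    have l: "0 < l" by (simp add: l_def)
    have n: "0 < ?n" using N0 l by simp
    have "n0 \<le> ?n" using N0 by (cases N) (auto simp: l_def)
    then have d1: "cut_dist f (grid_avg ?n f) < \<epsilon>" by (rule n0)
    let ?A = "cell_avg ?n f"
    let ?Q = "\<lambda>c i j. fiber_avg ({1..?n} \<times> {1..?n}) (map_prod c c) (\<lambda>z. ?A (fst z) (snd z)) (i, j)"
    obtain c where c: "\<And>i. c i < (4::nat) ^ k" and Qg: "step_graphon ?n (?Q c) \<in> graphons"
      and d2: "cut_dist (step_graphon ?n ?A) (step_graphon ?n (?Q c)) \<le> \<epsilon>"
      by (rule graphon_regularity[OF n cell_avg_bounds[OF f n] \<epsilon> k]) (rule that)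
    obtain \<pi> where \<pi>: "\<pi> permutes {1..?n}" "\<And>i j. 1 \<le> i \<Longrightarrow> i \<le> j \<Longrightarrow> j \<le> ?n \<Longrightarrow> c (\<pi> i) \<le> c (\<pi> j)"
      by (rule sorting_permutation[of ?n c]) (rule that)
    define R where "R i j = ?Q c (\<pi> i) (\<pi> j)" for i j
    have Rr: "step_graphon ?n R = relabel (perm_map ?n \<pi>) (step_graphon ?n (?Q c))"
      unfolding relabel_perm_map[OF n \<pi>(1)] R_def ..
    have mp: "perm_map ?n \<pi> \<in> mp_bijections" by (rule perm_map_mp[OF n \<pi>(1)])
    have Rg: "step_graphon ?n R \<in> graphons" unfolding Rr by (rule relabel_graphon[OF mp Qg])
    note cb = cell_avg_bounds[OF f n]
    obtain G where G: "\<And>I J. G I J = G J I" "\<And>I J. G I J \<in> ?V"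
      "\<And>I J. I \<notin> {1..N} \<or> J \<notin> {1..N} \<Longrightarrow> G I J = 0"
      "cut_dist (step_graphon ?n R) (step_graphon N G) \<le> (2 * real K + 1) / real N"
    proof (rule coarse_approx[OF N0 l, of R "\<lambda>i. c (\<pi> i)" K])
      show "R i j = R j i" for i j unfolding R_def by (rule fiber_avg_symmetric) (simp add: cb(1))
      show "0 \<le> R i j" "R i j \<le> 1" for i j unfolding R_def by (intro fiber_avg_range; simp add: cb(2,3))+
      show "R i j = R i' j'" if "c (\<pi> i) = c (\<pi> i')" "c (\<pi> j) = c (\<pi> j')" for i j i' j'
        unfolding R_def by (rule fiber_avg_cong) (simp add: that)
      show "c (\<pi> i) < K" for i using c by (simp add: K_def)
    qed (use \<pi>(2) in auto)
    have G01: "0 \<le> G I J" "G I J \<le> 1" for I J using G(2)[of I J] N0 by auto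
    have Gg: "step_graphon N G \<in> graphons" by (rule step_graphon_in) (use G(1) G01 in auto)
    have mat: "?mat (restrict (\<lambda>z. G (fst z) (snd z)) ?X) = G" using G(3) by (auto simp: fun_eq_iff)
    have "restrict (\<lambda>z. G (fst z) (snd z)) ?X \<in> PiE ?X (\<lambda>_. ?V)" using G(2) by auto
    then have "step_graphon N (?mat (restrict (\<lambda>z. G (fst z) (snd z)) ?X))
        \<in> (\<lambda>B. step_graphon N (?mat B)) ` (PiE ?X (\<lambda>_. ?V))" by (rule imageI)
    then have "step_graphon N G \<in> (\<lambda>B. step_graphon N (?mat B)) ` (PiE ?X (\<lambda>_. ?V))" unfolding mat .
    then have "step_graphon N G \<in> \<F>" using Gg by (simp add: \<F>_def)
    moreover have "orbit_dist f (step_graphon N G) < e"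
    proof -
      let ?a = "grid_avg ?n f" and ?q = "step_graphon ?n (?Q c)" and ?r = "step_graphon ?n R" and ?g = "step_graphon N G"
      have ag: "?a \<in> graphons" by (rule grid_avg_in[OF f n])
      have "orbit_dist f ?a < \<epsilon>" using orbit_dist_le_cut_dist[OF f ag] d1 by simp
      moreover have "orbit_dist ?a ?q \<le> \<epsilon>"
        using orbit_dist_le_cut_dist[OF ag Qg] d2 by (simp add: grid_avg_def)
      moreover have "orbit_dist ?q ?r = 0"
        using orbit_dist_relabel[OF Qg mp] orbit_dist_sym[OF Qg Rg] by (simp add: Rr)
      moreover have "orbit_dist ?r ?g < \<epsilon>"
        using orbit_dist_le_cut_dist[OF Rg Gg] G(4) NK by simp
      moreover have "orbit_dist f ?g \<le> orbit_dist f ?a + (orbit_dist ?a ?q + (orbit_dist ?q ?r + orbit_dist ?r ?g))"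
        using orbit_dist_triangle[OF f ag Gg] orbit_dist_triangle[OF ag Qg Gg] orbit_dist_triangle[OF Qg Rg Gg]
        by linarith
      ultimately show ?thesis using \<epsilon> unfolding \<epsilon>_def by linarith
    qed
    ultimately show ?thesis by blast
  qed
  show ?thesis using 1 2 3 by (rule that)
qed

lemma cut_metric_orbit_dist:
  "f \<in> graphons \<Longrightarrow> g \<in> graphons \<Longrightarrow> cut_metric (graphon_class f) (graphon_class g) = orbit_dist f g"
  by (simp add: cut_metric_class orbit_dist_def)

interpretation cut_space: Metric_space graphon_quotient cut_metric
  by (rule Metric_space_cut_metric)

lemma mtotally_bounded_graphons: "cut_space.mtotally_bounded graphon_quotient"
  unfolding cut_space.mtotally_bounded_def
proof (intro allI impI)
  fix e :: real assume "0 < e"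
  then obtain \<F> where \<F>: "finite \<F>" "\<F> \<subseteq> graphons" "\<And>f. f \<in> graphons \<Longrightarrow> \<exists>h\<in>\<F>. orbit_dist f h < e"
    by (rule finite_grid_net) blast
  show "\<exists>K. finite K \<and> K \<subseteq> graphon_quotient \<and> graphon_quotient \<subseteq> (\<Union>x\<in>K. cut_space.mball x e)"
  proof (intro exI[of _ "graphon_class ` \<F>"] conjI subsetI)
    show "finite (graphon_class ` \<F>)" using \<F>(1) by simp
    show "x \<in> graphon_quotient" if "x \<in> graphon_class ` \<F>" for x
      using that \<F>(2) by (auto simp: graphon_quotient_def)
    fix x assume "x \<in> graphon_quotient"
    then obtain f where f: "f \<in> graphons" "x = graphon_class f" by (auto simp: graphon_quotient_def)
    obtain h where h: "h \<in> \<F>" "orbit_dist f h < e" using \<F>(3)[OF f(1)] by blast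
    have hg: "h \<in> graphons" using h(1) \<F>(2) by blast
    have q: "graphon_class f \<in> graphon_quotient" "graphon_class h \<in> graphon_quotient"
      using f(1) hg by (auto simp: graphon_quotient_def)
    have "x \<in> cut_space.mball (graphon_class h) e"
      using f hg h(2) orbit_dist_sym[OF f(1) hg] q
      by (simp add: cut_space.in_mball cut_metric_orbit_dist)
    then show "x \<in> (\<Union>x\<in>graphon_class ` \<F>. cut_space.mball x e)" using h(1) by blast
  qed
qed

text \<open>Total boundedness yields a Cauchy subsequence of classes, thinned out until consecutive
  orbit distances decay geometrically. Relabelling each term to fit the previously chosen one makes
  the graphons Cauchy for the cut distance itself, and completeness applies.\<close>

theorem graphons_seq_compact:
  assumes h: "\<And>k. h k \<in> graphons"
  obtains r f where "strict_mono (r :: nat \<Rightarrow> nat)" "f \<in> graphons" "(\<lambda>k. orbit_dist (h (r k)) f) \<longlonglongrightarrow> 0"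
proof -
  define \<sigma> where "\<sigma> k = graphon_class (h k)" for k
  have "range \<sigma> \<subseteq> graphon_quotient" using h by (auto simp: \<sigma>_def graphon_quotient_def)
  then obtain r where r: "strict_mono r" "cut_space.MCauchy (\<sigma> \<circ> r)"
    using mtotally_bounded_graphons unfolding cut_space.mtotally_bounded_sequentially by blast
  have "\<exists>n0. \<forall>m\<ge>n0. \<forall>n\<ge>n0. orbit_dist (h (r m)) (h (r n)) < (1 / 2) ^ k / 2" for k
  proof -
    have "0 < (1 / 2 :: real) ^ k / 2" by simp
    then obtain n0 where "\<forall>m n. n0 \<le> m \<longrightarrow> n0 \<le> n \<longrightarrow> cut_metric ((\<sigma> \<circ> r) m) ((\<sigma> \<circ> r) n) < (1 / 2) ^ k / 2"
      using r(2) unfolding cut_space.MCauchy_def by blast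
    then show ?thesis using h by (auto simp: \<sigma>_def cut_metric_orbit_dist)
  qed
  then obtain n0 where n0: "\<And>k m n. n0 k \<le> m \<Longrightarrow> n0 k \<le> n \<Longrightarrow> orbit_dist (h (r m)) (h (r n)) < (1 / 2) ^ k / 2"
    by metis
  \<comment> \<open>Partial sums of positive terms: strictly increasing, and at least n0.\<close>
  define s where "s k = (\<Sum>i\<le>k. Suc (n0 i))" for k
  have s: "strict_mono s" by (rule strict_monoI_Suc) (simp add: s_def)
  have sn: "n0 k \<le> s k" for k
  proof -
    have "Suc (n0 k) \<le> s k" unfolding s_def by (rule member_le_sum) auto
    then show ?thesis by simp
  qed
  have rs: "orbit_dist (h (r (s k))) (h (r (s (Suc k)))) < (1 / 2) ^ k / 2" for k
  proof (rule n0[OF sn])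
    have "s k < s (Suc k)" using s by (simp add: strict_mono_Suc_iff)
    then show "n0 k \<le> s (Suc k)" using sn[of k] by linarith
  qed
  define v where "v k = h (r (s k))" for k
  have v: "v k \<in> graphons" for k using h by (simp add: v_def)
  have "\<exists>u. \<forall>k. (u k \<in> graphons \<and> orbit_dist (v k) (u k) = 0) \<and> cut_dist (u k) (u (Suc k)) \<le> (1 / 2) ^ k"
  proof (rule dependent_nat_choice)
    show "\<exists>u. u \<in> graphons \<and> orbit_dist (v 0) u = 0" using v[of 0] orbit_dist_refl[OF v] by blast
    fix u k assume u: "u \<in> graphons \<and> orbit_dist (v k) u = 0"
    then have u': "u \<in> graphons" by simp
    have "orbit_dist u (v (Suc k)) \<le> orbit_dist u (v k) + orbit_dist (v k) (v (Suc k))"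
      by (rule orbit_dist_triangle[OF u' v v])
    also have "\<dots> < (1 / 2) ^ k"
    proof -
      have "orbit_dist (v k) (v (Suc k)) < (1 / 2) ^ k / 2" using rs[of k] by (simp only: v_def)
      moreover have "orbit_dist u (v k) = 0" using u orbit_dist_sym[OF u' v[of k]] by simp
      moreover have "0 < (1 / 2 :: real) ^ k" by simp
      ultimately show ?thesis by linarith
    qed
    finally obtain \<tau> where \<tau>: "\<tau> \<in> mp_bijections" "cut_dist u (relabel \<tau> (v (Suc k))) < (1 / 2) ^ k"
      unfolding orbit_dist_less_iff[OF u' v] by blast
    show "\<exists>w. (w \<in> graphons \<and> orbit_dist (v (Suc k)) w = 0) \<and> cut_dist u w \<le> (1 / 2) ^ k"
    proof (intro exI conjI)
      show w: "relabel \<tau> (v (Suc k)) \<in> graphons" by (rule relabel_graphon[OF \<tau>(1) v])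
      show "orbit_dist (v (Suc k)) (relabel \<tau> (v (Suc k))) = 0"
        using orbit_dist_relabel[OF v \<tau>(1)] orbit_dist_sym[OF v w] by simp
      show "cut_dist u (relabel \<tau> (v (Suc k))) \<le> (1 / 2) ^ k" using \<tau>(2) by simp
    qed
  qed
  then obtain u where u: "\<And>k. u k \<in> graphons" "\<And>k. orbit_dist (v k) (u k) = 0"
    "\<And>k. cut_dist (u k) (u (Suc k)) \<le> (1 / 2) ^ k" by blast
  obtain g where g: "g \<in> graphons" "(\<lambda>k. cut_dist (u k) g) \<longlonglongrightarrow> 0"
    by (rule cut_dist_complete[OF u(1,3)]) blast
  have "(\<lambda>k. orbit_dist (v k) g) \<longlonglongrightarrow> 0"
  proof (rule tendsto_sandwich[OF _ _ tendsto_const g(2)])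
    show "\<forall>\<^sub>F k in sequentially. 0 \<le> orbit_dist (v k) g"
      by (intro always_eventually allI orbit_dist_nonneg v g)
    have "orbit_dist (v k) g \<le> cut_dist (u k) g" for k
      using orbit_dist_triangle[OF v u(1) g(1), of k k] u(2)[of k] orbit_dist_le_cut_dist[OF u(1) g(1), of k] by linarith
    then show "\<forall>\<^sub>F k in sequentially. orbit_dist (v k) g \<le> cut_dist (u k) g" by simp
  qed
  moreover have "strict_mono (r \<circ> s)" by (rule strict_mono_o[OF r(1) s])
  ultimately show ?thesis using g(1) by (intro that[of "r \<circ> s" g]) (simp_all add: v_def)
qed

section \<open>Large deviation bounds for random graphs\<close>

lemma graph_graphon_step: "graph_graphon n E = step_graphon n (\<lambda>i j. of_bool ({i, j} \<in> E))"
  by (simp add: graph_graphon_def step_graphon_def gidx_def of_bool_def)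

lemma graph_graphon_in: "graph_graphon n E \<in> graphons"
  unfolding graph_graphon_step by (rule step_graphon_in) (auto simp: insert_commute)

lemma triangle_density_graph:
  assumes "0 < n" "E \<subseteq> vertex_pairs n"
  shows "triangle_density (graph_graphon n E) = real (triangles n E) / real n ^ 3"
  unfolding graph_graphon_step triangle_density_step[OF assms(1)] triangles_hom_count[OF assms(2)] by simp

section \<open>Likelihood ratios and the upper bound\<close>

definition edge_fn :: "(nat \<Rightarrow> nat \<Rightarrow> real) \<Rightarrow> nat set \<Rightarrow> real" where
  "edge_fn a e = a (Min e) (Max e)"

lemma edge_fn_pair: "a i j = a j i \<Longrightarrow> edge_fn a {i, j} = a i j"
  by (cases "i \<le> j") (simp_all add: edge_fn_def min_def max_def)

lemma vertex_pairsE: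
  assumes "e \<in> vertex_pairs n"
  obtains i j where "e = {i, j}" "i < j" "i \<in> {1..n}" "j \<in> {1..n}" "Min e = i" "Max e = j"
proof -
  have "card e = 2" "e \<subseteq> {1..n}" using assms by (auto simp: vertex_pairs_def)
  then obtain a b where ab: "e = {a, b}" "a \<noteq> b" by (auto simp: card_2_iff)
  have "a \<in> {1..n}" "b \<in> {1..n}" using ab \<open>e \<subseteq> {1..n}\<close> by blast+
  then show ?thesis
    using ab that[of a b] that[of b a] by (cases "a < b") (auto simp: insert_commute)
qed

text \<open>The contribution of one edge to the log-likelihood ratio of edge probability u against
  p.\<close>

definition log_ratio :: "real \<Rightarrow> real \<Rightarrow> bool \<Rightarrow> real" where
  "log_ratio p u b = (if b then ln (u / p) else ln ((1 - u) / (1 - p)))"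

text \<open>The conditions on q make every factor of G positive, so the two products can be compared
  factor by factor with genuine logarithms.\<close>

lemma edge_weight_change:
  assumes p: "0 < p" "p < 1"
    and q: "\<And>e. e \<in> V \<Longrightarrow> e \<in> G \<Longrightarrow> 0 < q e" "\<And>e. e \<in> V \<Longrightarrow> e \<notin> G \<Longrightarrow> q e < 1"
  shows "edge_weight V (\<lambda>_. p) G = edge_weight V q G * exp (- (\<Sum>e\<in>V. log_ratio p (q e) (e \<in> G)))"
proof (cases "finite V")
  case True
  have "edge_weight V (\<lambda>_. p) G = (\<Prod>e\<in>V. (if e \<in> G then q e else 1 - q e) * exp (- log_ratio p (q e) (e \<in> G)))"
    unfolding edge_weight_def
  proof (rule prod.cong[OF refl])
    fix e assume "e \<in> V"
    then show "(if e \<in> G then p else 1 - p)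
        = (if e \<in> G then q e else 1 - q e) * exp (- log_ratio p (q e) (e \<in> G))"
      using q(1)[of e] q(2)[of e] p by (cases "e \<in> G") (simp_all add: log_ratio_def exp_minus)
  qed
  also have "\<dots> = edge_weight V q G * (\<Prod>e\<in>V. exp (- log_ratio p (q e) (e \<in> G)))"
    by (simp add: edge_weight_def prod.distrib)
  also have "(\<Prod>e\<in>V. exp (- log_ratio p (q e) (e \<in> G))) = exp (- (\<Sum>e\<in>V. log_ratio p (q e) (e \<in> G)))"
    using True by (simp add: exp_sum sum_negf[symmetric] del: sum_negf)
  finally show ?thesis .
qed (simp add: edge_weight_def)

text \<open>A block with an edge has positive density; likewise, as shown next, a block with a
  non-edge has density below 1. Hence a graph has positive weight under its own block
  densities.\<close>

lemma fiber_avg_pos: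
  assumes "finite X" "x \<in> X" "0 < f x" "\<And>y. y \<in> X \<Longrightarrow> 0 \<le> f y"
  shows "0 < fiber_avg X \<kappa> f x"
proof -
  let ?N = "{y \<in> X. \<kappa> y = \<kappa> x}"
  have "0 < (\<Sum>y\<in>?N. f y)" by (rule sum_pos2[of _ x]) (use assms in auto)
  moreover have "0 < card ?N" using assms by (auto simp: card_gt_0_iff)
  ultimately show ?thesis by (simp add: fiber_avg_def)
qed

lemma fiber_avg_less_1:
  assumes "finite X" "x \<in> X" "f x < 1" "\<And>y. y \<in> X \<Longrightarrow> f y \<le> 1"
  shows "fiber_avg X \<kappa> f x < 1"
proof -
  let ?N = "{y \<in> X. \<kappa> y = \<kappa> x}"
  have "(\<Sum>y\<in>?N. f y) < (\<Sum>y\<in>?N. 1)" by (rule sum_strict_mono_ex1) (use assms in auto)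
  moreover have "0 < card ?N" using assms by (auto simp: card_gt_0_iff)
  ultimately show ?thesis by (simp add: fiber_avg_def)
qed

lemma sum_square_off_diagonal:
  fixes F :: "nat \<Rightarrow> nat \<Rightarrow> real"
  shows "(\<Sum>z\<in>{1..n} \<times> {1..n}. F (fst z) (snd z))
    = (\<Sum>(i, j)\<in>{(i, j). i \<in> {1..n} \<and> j \<in> {1..n} \<and> i \<noteq> j}. F i j) + (\<Sum>i=1..n. F i i)"
proof -
  let ?X = "{(i, j). i \<in> {1..n} \<and> j \<in> {1..n} \<and> i \<noteq> j}" and ?D = "(\<lambda>i. (i, i)) ` {1..n}"
  have "{1..n} \<times> {1..n} = ?X \<union> ?D" "?X \<inter> ?D = {}" by auto
  moreover have "finite ?X" by (rule finite_subset[of _ "{1..n} \<times> {1..n}"]) auto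
  ultimately have "(\<Sum>z\<in>{1..n} \<times> {1..n}. F (fst z) (snd z))
      = (\<Sum>z\<in>?X. F (fst z) (snd z)) + (\<Sum>z\<in>?D. F (fst z) (snd z))"
    by (simp add: sum.union_disjoint)
  also have "(\<Sum>z\<in>?D. F (fst z) (snd z)) = (\<Sum>i=1..n. F i i)"
    by (subst sum.reindex) (auto intro: inj_onI)
  finally show ?thesis by (simp add: case_prod_unfold)
qed

text \<open>Because \<open>Q\<close> averages the adjacency matrix over blocks, the log-likelihood ratio of \<open>G\<close> against
  the random graph with edge probabilities \<open>Q\<close> is determined by \<open>Q\<close> alone, up to the diagonal terms,
  which have the favourable sign.\<close>

lemma likelihood_bound:
  fixes c :: "nat \<Rightarrow> nat"
  assumes p: "0 < p" "p < 1" and n: "0 < n" and G: "G \<subseteq> vertex_pairs n"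
  defines "Q \<equiv> \<lambda>i j. fiber_avg ({1..n} \<times> {1..n}) (map_prod c c) (\<lambda>z. of_bool ({fst z, snd z} \<in> G)) (i, j)"
  shows "edge_weight (vertex_pairs n) (\<lambda>_. p) G
    \<le> edge_weight (vertex_pairs n) (edge_fn Q) G
      * exp (real n * ln (1 / (1 - p)) - (real n)\<^sup>2 * graphon_rate p (step_graphon n Q))"
proof -
  let ?V = "vertex_pairs n" and ?X = "{1..n} \<times> {1..n}"
  let ?A = "\<lambda>z. of_bool ({fst z, snd z} \<in> G) :: real"
  let ?R = "\<lambda>i j. log_ratio p (Q i j) ({i, j} \<in> G)"
  have Qsym: "Q i j = Q j i" for i j
    unfolding Q_def by (rule fiber_avg_symmetric) (simp add: insert_commute)
  have Q01: "0 \<le> Q i j" "Q i j \<le> 1" for i j unfolding Q_def by (intro fiber_avg_range; simp)+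
  have eQ: "edge_fn Q {i, j} = Q i j" for i j by (rule edge_fn_pair[of Q i j]) (rule Qsym)
  have pos: "0 < edge_fn Q e" if "e \<in> ?V" "e \<in> G" for e
  proof -
    from that(1) obtain i j where e: "e = {i, j}" "i \<in> {1..n}" "j \<in> {1..n}" by (rule vertex_pairsE) (rule that)
    have "0 < Q i j" unfolding Q_def by (rule fiber_avg_pos) (use e that in auto)
    then show ?thesis using e eQ by simp
  qed
  have less: "edge_fn Q e < 1" if "e \<in> ?V" "e \<notin> G" for e
  proof -
    from that(1) obtain i j where e: "e = {i, j}" "i \<in> {1..n}" "j \<in> {1..n}" by (rule vertex_pairsE) (rule that)
    have "Q i j < 1" unfolding Q_def by (rule fiber_avg_less_1) (use e that in auto)
    then show ?thesis using e eQ by simp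
  qed
  have "2 * (\<Sum>e\<in>?V. log_ratio p (edge_fn Q e) (e \<in> G))
      = (\<Sum>(i, j)\<in>{(i, j). i \<in> {1..n} \<and> j \<in> {1..n} \<and> i \<noteq> j}. log_ratio p (edge_fn Q {i, j}) ({i, j} \<in> G))"
    by (rule sum_vertex_pairs[symmetric])
  then have "2 * (\<Sum>e\<in>?V. log_ratio p (edge_fn Q e) (e \<in> G))
      = (\<Sum>z\<in>?X. ?R (fst z) (snd z)) - (\<Sum>i=1..n. ?R i i)"
    unfolding sum_square_off_diagonal[of ?R n] by (simp add: eQ)
  also have "(\<Sum>z\<in>?X. ?R (fst z) (snd z)) = 2 * ((real n)\<^sup>2 * graphon_rate p (step_graphon n Q))"
  proof -
    let ?u = "\<lambda>z. ln (Q (fst z) (snd z) / p)" and ?v = "\<lambda>z. ln ((1 - Q (fst z) (snd z)) / (1 - p))"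
    have QQ: "Q (fst z) (snd z) = fiber_avg ?X (map_prod c c) ?A z" for z by (simp add: Q_def)
    \<comment> \<open>The logarithms are constant on blocks, so the adjacency matrix may be replaced
      by its block averages; what is left is the rate of the step graphon.\<close>
    have avg: "(\<Sum>z\<in>?X. Q (fst z) (snd z) * (?u z - ?v z)) = (\<Sum>z\<in>?X. ?A z * (?u z - ?v z))"
      unfolding QQ
    proof (rule fiber_avg_sum)
      fix x y :: "nat \<times> nat" assume "map_prod c c x = map_prod c c y"
      then have "fiber_avg ?X (map_prod c c) ?A x = fiber_avg ?X (map_prod c c) ?A y" by (rule fiber_avg_cong)
      then show "ln (fiber_avg ?X (map_prod c c) ?A x / p) - ln ((1 - fiber_avg ?X (map_prod c c) ?A x) / (1 - p))
          = ln (fiber_avg ?X (map_prod c c) ?A y / p) - ln ((1 - fiber_avg ?X (map_prod c c) ?A y) / (1 - p))"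
        by simp
    qed simp
    have "(\<Sum>z\<in>?X. ?R (fst z) (snd z)) = (\<Sum>z\<in>?X. ?A z * (?u z - ?v z) + ?v z)"
      by (intro sum.cong refl) (simp add: log_ratio_def)
    also have "\<dots> = (\<Sum>z\<in>?X. Q (fst z) (snd z) * (?u z - ?v z) + ?v z)"
      unfolding sum.distrib avg ..
    also have "\<dots> = (\<Sum>z\<in>?X. 2 * rate p (Q (fst z) (snd z)))"
      by (intro sum.cong refl) (simp add: rate_def algebra_simps)
    also have "\<dots> = 2 * ((real n)\<^sup>2 * graphon_rate p (step_graphon n Q))"
      unfolding graphon_rate_step[OF n] sum.cartesian_product case_prod_unfold
      using n by (simp flip: sum_distrib_left)
    finally show ?thesis .
  qed
  finally have L: "2 * (\<Sum>e\<in>?V. log_ratio p (edge_fn Q e) (e \<in> G))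
      = 2 * ((real n)\<^sup>2 * graphon_rate p (step_graphon n Q)) - (\<Sum>i=1..n. ?R i i)" .
  have "(\<Sum>i=1..n. ?R i i) \<le> (\<Sum>i=1..n. ln (1 / (1 - p)))"
  proof (rule sum_mono)
    fix i assume "i \<in> {1..n}"
    have "{i, i} \<notin> G" using G by (auto simp: vertex_pairs_def)
    moreover have "ln ((1 - Q i i) / (1 - p)) \<le> ln (1 / (1 - p))"
    \<comment> \<open>With ln 0 = 0 the claim reads 0 \<le> ln (1 / (1 - p)) in this case.\<close>
    proof (cases "Q i i = 1")
      case True then show ?thesis using p by simp
    next
      case False
      then have "0 < 1 - Q i i" using Q01(2)[of i i] by simp
      then show ?thesis using Q01(1)[of i i] p by (simp add: divide_right_mono)
    qed
    ultimately show "?R i i \<le> ln (1 / (1 - p))" by (simp add: log_ratio_def)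
  qed
  then have "(\<Sum>i=1..n. ?R i i) \<le> real n * ln (1 / (1 - p))" by simp
  moreover have "0 \<le> real n * ln (1 / (1 - p))" using p by simp
  ultimately have "- (\<Sum>e\<in>?V. log_ratio p (edge_fn Q e) (e \<in> G))
      \<le> real n * ln (1 / (1 - p)) - (real n)\<^sup>2 * graphon_rate p (step_graphon n Q)"
    using L by linarith
  then have "exp (- (\<Sum>e\<in>?V. log_ratio p (edge_fn Q e) (e \<in> G)))
      \<le> exp (real n * ln (1 / (1 - p)) - (real n)\<^sup>2 * graphon_rate p (step_graphon n Q))"
    by simp
  moreover have "0 \<le> edge_weight ?V (edge_fn Q) G"
  proof (rule edge_weight_nonneg)
    fix e assume "e \<in> ?V"
    then obtain i j where "e = {i, j}" by (rule vertex_pairsE) (rule that)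
    then show "0 \<le> edge_fn Q e \<and> edge_fn Q e \<le> 1" using eQ Q01 by simp
  qed
  ultimately have "edge_weight ?V (edge_fn Q) G * exp (- (\<Sum>e\<in>?V. log_ratio p (edge_fn Q e) (e \<in> G)))
      \<le> edge_weight ?V (edge_fn Q) G
        * exp (real n * ln (1 / (1 - p)) - (real n)\<^sup>2 * graphon_rate p (step_graphon n Q))"
    by (rule mult_left_mono)
  moreover have "edge_weight ?V (\<lambda>_. p) G
      = edge_weight ?V (edge_fn Q) G * exp (- (\<Sum>e\<in>?V. log_ratio p (edge_fn Q e) (e \<in> G)))"
    by (rule edge_weight_change[OF p]) (use pos less in auto)
  ultimately show ?thesis by simp
qed

text \<open>The block densities of a graph take only subexponentially many values, so a union bound over
  them costs nothing at speed \<open>n\<^sup>2\<close>.\<close>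

theorem graph_probability_upper_bound:
  assumes p: "0 < p" "p < 1" and e: "0 < e" "1 < real k * e\<^sup>2" and n: "0 < n"
    and \<G>: "\<G> \<subseteq> Pow (vertex_pairs n)"
    and m: "\<And>G h. G \<in> \<G> \<Longrightarrow> h \<in> graphons \<Longrightarrow> cut_dist (graph_graphon n G) h \<le> e \<Longrightarrow> m \<le> graphon_rate p h"
  shows "(\<Sum>G\<in>\<G>. edge_weight (vertex_pairs n) (\<lambda>_. p) G)
    \<le> real (4 ^ k) ^ n * real (n\<^sup>2 + 1) ^ ((4 ^ k)\<^sup>2) * exp (real n * ln (1 / (1 - p)) - (real n)\<^sup>2 * m)"
proof -
  let ?V = "vertex_pairs n" and ?X = "{1..n} \<times> {1..n}"
  define K :: nat where "K = 4 ^ k"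
  let ?E = "exp (real n * ln (1 / (1 - p)) - (real n)\<^sup>2 * m)"
  \<comment> \<open>A parameter is a colouring together with the number of adjacent ordered pairs
    between any two classes. Counts, unlike densities, range over a set fixed in advance.\<close>
  define \<Theta> where "\<Theta> = (PiE {1..n} (\<lambda>_. {..<K})) \<times> (PiE ({..<K} \<times> {..<K}) (\<lambda>_. {..n\<^sup>2}))"
  define q :: "(nat \<Rightarrow> nat) \<times> (nat \<times> nat \<Rightarrow> nat) \<Rightarrow> nat set \<Rightarrow> real" where
    "q \<theta> e = real (snd \<theta> (fst \<theta> (Min e), fst \<theta> (Max e)))
      / real (card {z \<in> ?X. map_prod (fst \<theta>) (fst \<theta>) z = (fst \<theta> (Min e), fst \<theta> (Max e))})" for \<theta> e
  \<comment> \<open>The parameters whose quotients are probabilities: their weights are nonnegative,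
    so each may be summed over all graphs.\<close>
  define \<Theta>' where "\<Theta>' = {\<theta> \<in> \<Theta>. \<forall>e\<in>?V. 0 \<le> q \<theta> e \<and> q \<theta> e \<le> 1}"
  have fin\<Theta>: "finite \<Theta>" unfolding \<Theta>_def by (intro finite_cartesian_product finite_PiE) auto
  then have fin\<Theta>': "finite \<Theta>'" by (simp add: \<Theta>'_def)
  have finV: "finite (Pow ?V)" using finite_vertex_pairs by simp
  have card\<Theta>: "card \<Theta> = K ^ n * (n\<^sup>2 + 1) ^ (K\<^sup>2)"
    by (simp add: \<Theta>_def card_cartesian_product card_PiE power2_eq_square)
  have ex: "\<exists>\<theta>\<in>\<Theta>'. edge_weight ?V (\<lambda>_. p) G \<le> edge_weight ?V (q \<theta>) G * ?E" if G: "G \<in> \<G>" for G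
  proof -
    have GV: "G \<subseteq> ?V" using G \<G> by blast
    let ?A = "\<lambda>i j. of_bool ({i, j} \<in> G) :: real"
    let ?Q = "\<lambda>c i j. fiber_avg ?X (map_prod c c) (\<lambda>z. of_bool ({fst z, snd z} \<in> G) :: real) (i, j)"
    have Asym: "?A i j = ?A j i" for i j by (simp add: insert_commute)
    obtain c where c: "\<And>i. c i < (4::nat) ^ k" and Qg: "step_graphon n (?Q c) \<in> graphons"
      and d: "cut_dist (step_graphon n ?A) (step_graphon n (?Q c)) \<le> e"
      by (rule graphon_regularity[of n ?A e k, OF n Asym _ _ e]) (simp, simp, rule that)
    have rate: "m \<le> graphon_rate p (step_graphon n (?Q c))"
      by (rule m[OF G Qg]) (use d in \<open>simp add: graph_graphon_step\<close>)
    define mm where "mm ab = card {z \<in> ?X. map_prod c c z = ab \<and> {fst z, snd z} \<in> G}" for ab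
    define \<theta> where "\<theta> = (restrict c {1..n}, restrict mm ({..<K} \<times> {..<K}))"
    have qe: "q \<theta> e = edge_fn (?Q c) e" if "e \<in> ?V" for e
    proof -
      from that obtain i j where ij: "i \<in> {1..n}" "j \<in> {1..n}" "Min e = i" "Max e = j" by (rule vertex_pairsE) (rule that)
      have "{z \<in> ?X. map_prod (fst \<theta>) (fst \<theta>) z = (fst \<theta> i, fst \<theta> j)} = {z \<in> ?X. map_prod c c z = map_prod c c (i, j)}"
        using ij by (auto simp: \<theta>_def)
      moreover have "snd \<theta> (fst \<theta> i, fst \<theta> j) = mm (c i, c j)"
        using ij c by (simp add: \<theta>_def K_def)
      moreover have "real (mm (c i, c j)) = (\<Sum>z\<in>{z \<in> ?X. map_prod c c z = map_prod c c (i, j)}. of_bool ({fst z, snd z} \<in> G))"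
      proof -
        have "{z \<in> ?X. map_prod c c z = (c i, c j) \<and> {fst z, snd z} \<in> G}
            = {z \<in> ?X. map_prod c c z = map_prod c c (i, j)} \<inter> {z. {fst z, snd z} \<in> G}" by auto
        moreover have "finite {z \<in> ?X. map_prod c c z = map_prod c c (i, j)}" by simp
        ultimately show ?thesis unfolding mm_def by (subst sum_of_bool_eq) simp_all
      qed
      ultimately show ?thesis using ij by (simp add: q_def edge_fn_def fiber_avg_def)
    qed
    have "\<theta> \<in> \<Theta>"
    proof -
      have "mm ab \<le> n\<^sup>2" for ab
      proof -
        have "mm ab \<le> card ?X" unfolding mm_def by (intro card_mono) auto
        then show ?thesis by (simp add: card_cartesian_product power2_eq_square)
      qed
      then show ?thesis using c by (auto simp: \<Theta>_def \<theta>_def K_def)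
    qed
    moreover have "0 \<le> q \<theta> e \<and> q \<theta> e \<le> 1" if "e \<in> ?V" for e
      unfolding qe[OF that] edge_fn_def by (intro conjI fiber_avg_range) auto
    ultimately have "\<theta> \<in> \<Theta>'" by (simp add: \<Theta>'_def)
    moreover have "edge_weight ?V (\<lambda>_. p) G \<le> edge_weight ?V (q \<theta>) G * ?E"
    proof -
      have eq: "edge_weight ?V (q \<theta>) G = edge_weight ?V (edge_fn (?Q c)) G"
        unfolding edge_weight_def using qe by (intro prod.cong) auto
      have "0 \<le> edge_weight ?V (q \<theta>) G"
        using \<open>\<theta> \<in> \<Theta>'\<close> by (intro edge_weight_nonneg) (simp add: \<Theta>'_def)
      moreover have "(real n)\<^sup>2 * m \<le> (real n)\<^sup>2 * graphon_rate p (step_graphon n (?Q c))"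
        using rate by (intro mult_left_mono) auto
      then have "exp (real n * ln (1 / (1 - p)) - (real n)\<^sup>2 * graphon_rate p (step_graphon n (?Q c))) \<le> ?E" by simp
      ultimately have "edge_weight ?V (q \<theta>) G * exp (real n * ln (1 / (1 - p)) - (real n)\<^sup>2 * graphon_rate p (step_graphon n (?Q c)))
          \<le> edge_weight ?V (q \<theta>) G * ?E" by (intro mult_left_mono)
      then show ?thesis using likelihood_bound[OF p n GV, of c] unfolding eq by linarith
    qed
    ultimately show ?thesis by blast
  qed
  have w0: "0 \<le> edge_weight ?V (q \<theta>) G * ?E" if "\<theta> \<in> \<Theta>'" for \<theta> G
    using that by (intro mult_nonneg_nonneg edge_weight_nonneg) (auto simp: \<Theta>'_def)
  \<comment> \<open>Each graph is charged to its own parameter. After the sums are exchanged, every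
    parameter contributes total weight 1.\<close>
  have "(\<Sum>G\<in>\<G>. edge_weight ?V (\<lambda>_. p) G) \<le> (\<Sum>G\<in>\<G>. \<Sum>\<theta>\<in>\<Theta>'. edge_weight ?V (q \<theta>) G * ?E)"
  proof (rule sum_mono)
    fix G assume "G \<in> \<G>"
    from ex[OF this] obtain \<theta> where \<theta>: "\<theta> \<in> \<Theta>'" "edge_weight ?V (\<lambda>_. p) G \<le> edge_weight ?V (q \<theta>) G * ?E" by blast
    have "edge_weight ?V (q \<theta>) G * ?E \<le> (\<Sum>\<theta>\<in>\<Theta>'. edge_weight ?V (q \<theta>) G * ?E)"
      by (rule member_le_sum[OF \<theta>(1)]) (use w0 fin\<Theta>' in auto)
    then show "edge_weight ?V (\<lambda>_. p) G \<le> (\<Sum>\<theta>\<in>\<Theta>'. edge_weight ?V (q \<theta>) G * ?E)" using \<theta>(2) by linarith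
  qed
  also have "\<dots> \<le> (\<Sum>G\<in>Pow ?V. \<Sum>\<theta>\<in>\<Theta>'. edge_weight ?V (q \<theta>) G * ?E)"
    by (rule sum_mono2[OF finV \<G>]) (intro sum_nonneg w0)
  also have "\<dots> = (\<Sum>\<theta>\<in>\<Theta>'. \<Sum>G\<in>Pow ?V. edge_weight ?V (q \<theta>) G * ?E)" by (rule sum.swap)
  also have "\<dots> = real (card \<Theta>') * ?E"
    by (simp add: sum_edge_weight[OF finite_vertex_pairs] flip: sum_distrib_right)
  also have "\<dots> \<le> real (card \<Theta>) * ?E"
    using fin\<Theta> by (intro mult_right_mono of_nat_mono card_mono) (auto simp: \<Theta>'_def)
  also have "real (card \<Theta>) = real (4 ^ k) ^ n * real (n\<^sup>2 + 1) ^ ((4 ^ k)\<^sup>2)"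
    by (simp add: card\<Theta> K_def)
  finally show ?thesis .
qed

section \<open>Planting a graphon: the lower bound, and the exponential form of the upper
  bound\<close>

lemma expected_triangles:
  fixes a :: "nat \<Rightarrow> nat \<Rightarrow> real"
  assumes n: "0 < n" and a: "\<And>i j. a i j = a j i" "\<And>i j. 0 \<le> a i j" "\<And>i j. a i j \<le> 1"
  shows "real n ^ 3 * triangle_density (step_graphon n a) - (real n)\<^sup>2 / 2
    \<le> (\<Sum>A\<in>vertex_triples n. \<Prod>e\<in>edges_of A. edge_fn a e)"
proof -
  let ?f = "\<lambda>i j k. a i j * a j k * a k i"
  let ?I = "{1..n}"
  let ?Y = "{(i, j, k). i \<in> ?I \<and> j \<in> ?I \<and> k \<in> ?I \<and> i \<noteq> j \<and> j \<noteq> k \<and> k \<noteq> i}"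
  let ?B = "(\<lambda>(i, j). (i, i, j)) ` (?I \<times> ?I) \<union> ((\<lambda>(i, j). (i, j, j)) ` (?I \<times> ?I) \<union> (\<lambda>(i, j). (i, j, i)) ` (?I \<times> ?I))"
  have f01: "0 \<le> ?f i j k" "?f i j k \<le> 1" for i j k
    using a(2,3) by (auto intro!: mult_nonneg_nonneg mult_le_one)
  have finY: "finite ?Y" by (rule finite_subset[of _ "?I \<times> ?I \<times> ?I"]) auto
  \<comment> \<open>The three diagonals i = j, j = k and k = i. Each degenerate triple counts for at
    most 1, and dividing by 6 leaves the loss n^2 / 2.\<close>
  have cB: "card ?B \<le> 3 * n\<^sup>2"
  proof -
    have c: "card (g ` (?I \<times> ?I)) \<le> n\<^sup>2" for g :: "nat \<times> nat \<Rightarrow> nat \<times> nat \<times> nat"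
      using card_image_le[of "?I \<times> ?I" g] by (simp add: card_cartesian_product power2_eq_square)
    show ?thesis
      by (rule order_trans[OF card_Un_le order_trans[OF add_mono[OF c order_trans[OF card_Un_le add_mono[OF c c]]]]]) simp
  qed
  have "6 * (real n ^ 3 * triangle_density (step_graphon n a)) = (\<Sum>i\<in>?I. \<Sum>j\<in>?I. \<Sum>k\<in>?I. ?f i j k)"
    unfolding triangle_density_step[OF n] using n by simp
  also have "\<dots> = (\<Sum>(i, j, k)\<in>?I \<times> ?I \<times> ?I. ?f i j k)"
    by (simp only: sum.cartesian_product case_prod_beta fst_conv snd_conv)
  also have "\<dots> \<le> (\<Sum>(i, j, k)\<in>?Y \<union> ?B. ?f i j k)"
  proof (rule sum_mono2)
    show "finite (?Y \<union> ?B)" using finY by simp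
    show "?I \<times> ?I \<times> ?I \<subseteq> ?Y \<union> ?B" by (auto simp: image_iff)
  qed (use f01 in auto)
  also have "\<dots> \<le> (\<Sum>(i, j, k)\<in>?Y. ?f i j k) + (\<Sum>(i, j, k)\<in>?B. ?f i j k)"
  proof -
    let ?F = "\<lambda>(i, j, k). ?f i j k"
    have "sum ?F (?Y \<union> ?B) + sum ?F (?Y \<inter> ?B) = sum ?F ?Y + sum ?F ?B"
      by (rule sum.union_inter) (use finY in auto)
    moreover have "0 \<le> sum ?F (?Y \<inter> ?B)" by (rule sum_nonneg) (use f01 in auto)
    ultimately show ?thesis by linarith
  qed
  also have "(\<Sum>(i, j, k)\<in>?Y. ?f i j k) = (\<Sum>(i, j, k)\<in>?Y. \<Prod>e\<in>edges_of {i, j, k}. edge_fn a e)"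
  proof (rule sum.cong[OF refl], clarify)
    fix i j k :: nat assume ne: "i \<noteq> j" "j \<noteq> k" "k \<noteq> i"
    then have "{i, j} \<noteq> {j, k}" "{i, j} \<noteq> {k, i}" "{j, k} \<noteq> {k, i}" by (auto simp: doubleton_eq_iff)
    then show "?f i j k = (\<Prod>e\<in>edges_of {i, j, k}. edge_fn a e)"
      unfolding edges_of_triple[OF ne] using a(1) by (simp add: edge_fn_pair mult.assoc)
  qed
  also have "\<dots> = 6 * (\<Sum>A\<in>vertex_triples n. \<Prod>e\<in>edges_of A. edge_fn a e)"
    by (rule sum_vertex_triples)
  finally have "6 * (real n ^ 3 * triangle_density (step_graphon n a))
      \<le> 6 * (\<Sum>A\<in>vertex_triples n. \<Prod>e\<in>edges_of A. edge_fn a e) + (\<Sum>(i, j, k)\<in>?B. ?f i j k)" .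
  moreover have "(\<Sum>(i, j, k)\<in>?B. ?f i j k) \<le> 3 * (real n)\<^sup>2"
  proof -
    have "(\<Sum>(i, j, k)\<in>?B. ?f i j k) \<le> real (card ?B) * 1"
      by (rule sum_bounded_above) (use f01 in auto)
    also have "\<dots> \<le> 3 * (real n)\<^sup>2" using of_nat_mono[OF cB, where 'a = real] by simp
    finally show ?thesis .
  qed
  ultimately show ?thesis by linarith
qed

text \<open>The factor \<open>1 - 1 / real n\<close> bounds the probability of the triangle event
  under the planted measure from below. It remains in the conclusion and tends to 1 where the
  estimate is applied.\<close>

theorem graph_probability_lower_bound:
  assumes p: "0 < p" "p < 1" and f: "f \<in> graphons" and t: "t < triangle_density f"
  defines "P \<equiv> \<lambda>n. \<Sum>G\<in>{G \<in> Pow (vertex_pairs n). t * real n ^ 3 \<le> real (triangles n G)}. edge_weight (vertex_pairs n) (\<lambda>_. p) G"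
  shows "\<forall>\<^sub>F n in sequentially. 0 < P n \<and>
    - ((real n)\<^sup>2 * graphon_rate p f + ln 2) \<le> ln (P n) * (1 - 1 / real n)"
proof -
  define \<delta> where "\<delta> = (triangle_density f - t) / 2"
  have \<delta>: "0 < \<delta>" using t by (simp add: \<delta>_def)
  have ev: "\<forall>\<^sub>F n in sequentially. c \<le> real n" for c
    using filterlim_real_sequentially by (simp add: filterlim_at_top)
  have "\<forall>\<^sub>F n in sequentially. cut_dist f (grid_avg n f) < 2 * \<delta>"
    using grid_avg_cut_dist[OF f] \<delta> by (intro order_tendstoD(2)) auto
  then show ?thesis
    using ev[of "1 / \<delta>"] ev[of "4 / \<delta>\<^sup>2"] ev[of 2]
  proof eventually_elim
    case (elim n)
    have n: "0 < n" using elim(4) by simp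
    have nr: "0 < real n" using n by simp
    let ?V = "vertex_pairs n" and ?a = "cell_avg n f"
    let ?W = "edge_weight ?V (\<lambda>_. p)"
    define q where "q = edge_fn ?a"
    note ab = cell_avg_bounds[OF f n]
    have q01: "0 \<le> q e \<and> q e \<le> 1" for e by (simp add: q_def edge_fn_def ab)
    let ?X = "Pow ?V" and ?U = "edge_weight ?V q"
    let ?A = "{G \<in> ?X. t * real n ^ 3 \<le> real (triangles n G)}"
    have finX: "finite ?X" using finite_vertex_pairs by simp
    have U0: "0 \<le> ?U G" for G using q01 by (intro edge_weight_nonneg)
    have W0: "0 \<le> ?W G" for G using p by (intro edge_weight_nonneg) auto
    define \<mu> where "\<mu> = (\<Sum>A\<in>vertex_triples n. \<Prod>e\<in>edges_of A. q e)"
    have T: "t + \<delta> \<le> triangle_density (step_graphon n ?a)"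
    proof -
      have "2 * \<delta> = triangle_density f - t" by (simp add: \<delta>_def)
      then show ?thesis
        using triangle_density_lipschitz[OF f grid_avg_in[OF f n]] elim(1) unfolding grid_avg_def by linarith
    qed
    have n2: "(real n)\<^sup>2 / 2 \<le> \<delta> / 2 * real n ^ 3"
    proof -
      have "1 \<le> \<delta> * real n" using elim(2) \<delta> by (simp add: field_simps)
      then have "(real n)\<^sup>2 * 1 \<le> (real n)\<^sup>2 * (\<delta> * real n)" by (intro mult_left_mono) auto
      then show ?thesis by (simp add: power2_eq_square power3_eq_cube mult_ac)
    qed
    have "real n ^ 3 * (t + \<delta>) \<le> real n ^ 3 * triangle_density (step_graphon n ?a)"
      using T by (intro mult_left_mono) auto
    also have "\<dots> \<le> \<mu> + (real n)\<^sup>2 / 2"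
      using expected_triangles[OF n, of ?a, OF ab] unfolding \<mu>_def q_def by linarith
    finally have \<mu>: "t * real n ^ 3 \<le> \<mu> - \<delta> / 2 * real n ^ 3" using n2 by (simp add: algebra_simps)
    have s: "0 < \<delta> / 2 * real n ^ 3" using \<delta> nr by simp
    have "sum ?U (?X - ?A) \<le> 1 / real n"
    proof -
      let ?B = "{G \<in> ?X. (\<Sum>A\<in>vertex_triples n. of_bool (edges_of A \<subseteq> G)) < \<mu> - \<delta> / 2 * real n ^ 3}"
      have "sum ?U (?X - ?A) \<le> sum ?U ?B"
        by (rule sum_mono2) (use finX U0 \<mu> in \<open>auto simp: triangles_eq simp del: sum_of_bool_eq\<close>)
      also have "\<dots> \<le> real (card {(A, B) \<in> vertex_triples n \<times> vertex_triples n. edges_of A \<inter> edges_of B \<noteq> {}}) / (\<delta> / 2 * real n ^ 3)\<^sup>2"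
        unfolding \<mu>_def
      proof (rule subgraph_count_concentration[OF finite_vertex_pairs finite_vertex_triples _ _ s])
        fix A assume "A \<in> vertex_triples n"
        then show "edges_of A \<subseteq> ?V" by (auto simp: vertex_triples_def edges_of_def vertex_pairs_def)
      qed (rule q01)
      also have "\<dots> \<le> real (n ^ 4) / (\<delta> / 2 * real n ^ 3)\<^sup>2"
        by (intro divide_right_mono of_nat_mono card_overlapping_triples) simp
      also have "\<dots> = (4 / \<delta>\<^sup>2) / real n * (1 / real n)"
        using \<delta> nr by (simp add: power2_eq_square power3_eq_cube power4_eq_xxxx field_simps)
      also have "\<dots> \<le> 1 * (1 / real n)"
      proof (rule mult_right_mono)
        show "(4 / \<delta>\<^sup>2) / real n \<le> 1" unfolding divide_le_eq_1_pos[OF nr] by (rule elim(3))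
      qed simp
      finally show ?thesis by simp
    qed
    moreover have "sum ?U ?X = sum ?U ?A + sum ?U (?X - ?A)"
      using finX by (metis (no_types, lifting) Collect_subset add.commute mem_Collect_eq subsetI sum.subset_diff)
    ultimately have UA: "1 - 1 / real n \<le> sum ?U ?A"
      using sum_edge_weight[OF finite_vertex_pairs, of n q] by linarith
    have "1 / real n < 1" using elim(4) by simp
    then have UA0: "0 < sum ?U ?A" using UA by linarith
    define L where "L G = (\<Sum>e\<in>?V. log_ratio p (q e) (e \<in> G))" for G
    have QP: "?W G = ?U G * exp (- L G)" if "G \<in> ?X" "0 < ?U G" for G
      unfolding L_def
    proof (rule edge_weight_change[OF p])
      have ne: "(if e \<in> G then q e else 1 - q e) \<noteq> 0" if "e \<in> ?V" for e
      proof
        assume "(if e \<in> G then q e else 1 - q e) = 0"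
        then have "\<exists>e\<in>?V. (if e \<in> G then q e else 1 - q e) = 0" using that by blast
        then have "?U G = 0"
          unfolding edge_weight_def by (rule prod_zero[OF finite_vertex_pairs])
        then show False using \<open>0 < ?U G\<close> by simp
      qed
      show "0 < q e" if "e \<in> ?V" "e \<in> G" for e using ne[OF that(1)] that(2) q01[of e] by auto
      show "q e < 1" if "e \<in> ?V" "e \<notin> G" for e using ne[OF that(1)] that(2) q01[of e] by auto
    qed
    have W1: "sum ?W ?X = 1" by (rule sum_edge_weight[OF finite_vertex_pairs])
    have U1: "sum ?U ?X = 1" by (rule sum_edge_weight[OF finite_vertex_pairs])
    have ent: "0 < sum ?W ?A" "- ((\<Sum>G\<in>?X. ?U G * L G) + ln 2) \<le> ln (sum ?W ?A) * sum ?U ?A"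
      by (rule entropy_lower_bound[OF finX W0 _ U0 U1 QP _ UA0]; use W1 in auto)+
    have "(\<Sum>G\<in>?X. ?U G * L G) \<le> (real n)\<^sup>2 * graphon_rate p f"
    proof -
      have "(\<Sum>G\<in>?X. ?U G * L G) = (\<Sum>e\<in>?V. q e * ln (q e / p) + (1 - q e) * ln ((1 - q e) / (1 - p)))"
        unfolding L_def log_ratio_def by (rule sum_edge_weight_additive[OF finite_vertex_pairs])
      also have "\<dots> = 2 * (\<Sum>e\<in>?V. rate p (q e))"
        by (simp add: sum_distrib_left rate_def)
      also have "\<dots> = (\<Sum>(i, j)\<in>{(i, j). i \<in> {1..n} \<and> j \<in> {1..n} \<and> i \<noteq> j}. rate p (q {i, j}))"
        by (rule sum_vertex_pairs[symmetric])
      also have "\<dots> = (\<Sum>(i, j)\<in>{(i, j). i \<in> {1..n} \<and> j \<in> {1..n} \<and> i \<noteq> j}. rate p (?a i j))"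
        by (intro sum.cong refl) (auto simp: q_def edge_fn_pair ab(1))
      also have "\<dots> \<le> (\<Sum>z\<in>{1..n} \<times> {1..n}. rate p (?a (fst z) (snd z)))"
      proof -
        have "0 \<le> (\<Sum>i=1..n. rate p (?a i i))"
          by (intro sum_nonneg rate_nonneg p ab)
        then show ?thesis unfolding sum_square_off_diagonal[of "\<lambda>i j. rate p (?a i j)" n] by simp
      qed
      also have "\<dots> = (real n)\<^sup>2 * graphon_rate p (grid_avg n f)"
        unfolding grid_avg_def graphon_rate_step[OF n] sum.cartesian_product case_prod_unfold using n by simp
      also have "\<dots> \<le> (real n)\<^sup>2 * graphon_rate p f"
        by (intro mult_left_mono graphon_rate_grid_avg_le p f n) simp
      finally show ?thesis .
    qed
    moreover have "sum ?W ?A \<le> 1" using sum_mono2[OF finX, of ?A ?W] W0 W1 by auto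
    then have "ln (sum ?W ?A) \<le> 0" using ent(1) by simp
    \<comment> \<open>The logarithm is at most 0, so lowering the other factor raises the
      product.\<close>
    then have "ln (sum ?W ?A) * sum ?U ?A \<le> ln (sum ?W ?A) * (1 - 1 / real n)"
      using UA by (rule mult_left_mono_neg[rotated])
    ultimately have "- ((real n)\<^sup>2 * graphon_rate p f + ln 2) \<le> ln (sum ?W ?A) * (1 - 1 / real n)"
      using ent(2) by linarith
    then show ?case using ent(1) unfolding P_def by blast
  qed
qed

text \<open>For a fixed accuracy the factors counting colourings and edge counts are exp (O(n)),
  since ln (n^2 + 1) \<le> 2 n. Giving up \<delta> n^2 in the exponent absorbs them for large
  n.\<close>

lemma graph_probability_exponential_upper:
  assumes p: "0 < p" "p < 1" and e: "0 < e" and \<delta>: "0 < \<delta>"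
    and \<G>: "\<And>n. \<G> n \<subseteq> Pow (vertex_pairs n)"
    and m: "\<And>n G h. 0 < n \<Longrightarrow> G \<in> \<G> n \<Longrightarrow> h \<in> graphons \<Longrightarrow> cut_dist (graph_graphon n G) h \<le> e \<Longrightarrow> m \<le> graphon_rate p h"
  shows "\<forall>\<^sub>F n in sequentially. (\<Sum>G\<in>\<G> n. edge_weight (vertex_pairs n) (\<lambda>_. p) G) \<le> exp (- ((real n)\<^sup>2 * (m - \<delta>)))"
proof -
  obtain k :: nat where "1 / e\<^sup>2 < real k" using reals_Archimedean2 by blast
  then have k: "1 < real k * e\<^sup>2" using e by (simp add: field_simps)
  define K :: real where "K = 4 ^ k"
  have K: "1 \<le> K" by (simp add: K_def)
  \<comment> \<open>The coefficient of n in the total error exponent; \<delta> n exceeds it once n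
    \<ge> D / \<delta>.\<close>
  define D where "D = ln K + 2 * K\<^sup>2 + ln (1 / (1 - p))"
  have "\<forall>\<^sub>F n in sequentially. D / \<delta> \<le> real n"
    using filterlim_real_sequentially by (simp add: filterlim_at_top)
  then show ?thesis using eventually_gt_at_top[of 0]
  proof eventually_elim
    case (elim n)
    let ?n = "real n"
    have n: "0 < ?n" using elim by simp
    have "(\<Sum>G\<in>\<G> n. edge_weight (vertex_pairs n) (\<lambda>_. p) G)
        \<le> real (4 ^ k) ^ n * real (n\<^sup>2 + 1) ^ ((4 ^ k)\<^sup>2) * exp (?n * ln (1 / (1 - p)) - ?n\<^sup>2 * m)"
      by (rule graph_probability_upper_bound[OF p e k elim(2) \<G>]) (rule m[OF elim(2)])
    also have "real (4 ^ k) ^ n = exp (?n * ln K)"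
    proof -
      have "exp (?n * ln K) = exp (ln K) ^ n" by (rule exp_of_nat_mult)
      also have "exp (ln K) = K" using K by simp
      finally show ?thesis by (simp add: K_def)
    qed
    also have "real (n\<^sup>2 + 1) ^ ((4 ^ k)\<^sup>2) = exp (K\<^sup>2 * ln (?n\<^sup>2 + 1))"
    proof -
      have "exp (real ((4 ^ k)\<^sup>2) * ln (?n\<^sup>2 + 1)) = exp (ln (?n\<^sup>2 + 1)) ^ ((4 ^ k)\<^sup>2)"
        by (rule exp_of_nat_mult)
      also have "exp (ln (?n\<^sup>2 + 1)) = ?n\<^sup>2 + 1" by (rule exp_ln) (simp add: add_nonneg_pos)
      finally show ?thesis by (simp add: K_def add.commute)
    qed
    also have "exp (?n * ln K) * exp (K\<^sup>2 * ln (?n\<^sup>2 + 1)) * exp (?n * ln (1 / (1 - p)) - ?n\<^sup>2 * m)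
        = exp (?n * ln K + K\<^sup>2 * ln (?n\<^sup>2 + 1) + ?n * ln (1 / (1 - p)) - ?n\<^sup>2 * m)"
      by (simp add: algebra_simps flip: exp_add)
    also have "\<dots> \<le> exp (- (?n\<^sup>2 * (m - \<delta>)))"
    proof -
      have "ln (?n\<^sup>2 + 1) \<le> ln ((1 + ?n)\<^sup>2)"
        using n by (subst ln_le_cancel_iff) (auto simp: power2_eq_square algebra_simps add_pos_pos)
      also have "\<dots> = 2 * ln (1 + ?n)" using n by (simp add: ln_realpow)
      also have "\<dots> \<le> 2 * ?n" using n ln_add_one_self_le_self[of ?n] by simp
      finally have "K\<^sup>2 * ln (?n\<^sup>2 + 1) \<le> K\<^sup>2 * (2 * ?n)" by (intro mult_left_mono) auto
      moreover have "?n * D \<le> ?n * (\<delta> * ?n)"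
        using elim(1) n \<delta> by (intro mult_left_mono) (auto simp: field_simps)
      moreover have "?n * D = ?n * ln K + K\<^sup>2 * (2 * ?n) + ?n * ln (1 / (1 - p))"
        unfolding D_def by (simp only: distrib_left mult_ac)
      moreover have "?n * (\<delta> * ?n) = \<delta> * ?n\<^sup>2" by (simp add: power2_eq_square mult_ac)
      moreover have "?n\<^sup>2 * (m - \<delta>) = ?n\<^sup>2 * m - \<delta> * ?n\<^sup>2" by (simp add: algebra_simps)
      ultimately show ?thesis by simp
    qed
    finally show ?case .
  qed
qed

section \<open>The variational problem\<close>

definition mix_one :: "real \<Rightarrow> (real \<times> real \<Rightarrow> real) \<Rightarrow> real \<times> real \<Rightarrow> real" where
  "mix_one l f = restrict (\<lambda>z. (1 - l) * f z + l) ({0..1} \<times> {0..1})"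

lemma mix_one_unit:
  fixes u l :: real
  assumes "0 \<le> l" "l \<le> 1" "0 \<le> u" "u \<le> 1"
  shows "0 \<le> (1 - l) * u + l" "(1 - l) * u + l \<le> 1"
proof -
  show "0 \<le> (1 - l) * u + l" using assms by simp
  have "(1 - l) * u \<le> (1 - l) * 1" using assms by (intro mult_left_mono) auto
  then show "(1 - l) * u + l \<le> 1" by simp
qed

lemma mix_one_in:
  assumes f: "f \<in> graphons" and l: "0 \<le> l" "l \<le> 1"
  shows "mix_one l f \<in> graphons"
proof -
  note [measurable] = graphonD(1)[OF f]
  have "(\<lambda>z. (1 - l) * f z + l) \<in> borel_measurable square_measure" by measurable
  then have "mix_one l f \<in> borel_measurable square_measure"
    by (rule measurable_cong[THEN iffD1, rotated]) (auto simp: mix_one_def space_square)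
  moreover have "(1 - l) * f (x, y) + l \<in> {0..1}" if "x \<in> {0..1}" "y \<in> {0..1}" for x y
    using graphonD(2)[OF f that] mix_one_unit[OF l, of "f (x, y)"] by simp
  ultimately show ?thesis
    using graphonD(3)[OF f] by (auto simp: graphons_def mix_one_def PiE_def Pi_def simp del: atLeastAtMost_iff)
qed

lemma cut_dist_mix_one:
  assumes f: "f \<in> graphons" and g: "g \<in> graphons" and l: "0 \<le> l" "l \<le> 1"
  shows "cut_dist (mix_one l f) (mix_one l g) \<le> cut_dist f g"
proof (rule cut_dist_least)
  fix S T assume ST: "S \<in> sets unit_measure" "T \<in> sets unit_measure"
  have "(LINT z : S \<times> T | square_measure. mix_one l f z - mix_one l g z)
      = (LINT z | square_measure. (1 - l) * (indicator (S \<times> T) z *\<^sub>R (f z - g z)))"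
    unfolding set_lebesgue_integral_def
    by (rule Bochner_Integration.integral_cong[OF refl])
       (auto simp: mix_one_def space_square indicator_def algebra_simps)
  then have "\<bar>LINT z : S \<times> T | square_measure. mix_one l f z - mix_one l g z\<bar>
      = (1 - l) * \<bar>LINT z : S \<times> T | square_measure. f z - g z\<bar>"
    using l by (simp add: set_lebesgue_integral_def abs_mult)
  also have "\<dots> \<le> 1 * cut_dist f g"
    using l cut_dist_upper[OF f g ST] by (intro mult_mono) auto
  finally show "\<bar>LINT z : S \<times> T | square_measure. mix_one l f z - mix_one l g z\<bar> \<le> cut_dist f g" by simp
qed

lemma mix_one_step: "mix_one l (step_graphon n A) = step_graphon n (\<lambda>i j. (1 - l) * A i j + l)"
  by (auto simp: mix_one_def step_graphon_def fun_eq_iff)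

text \<open>In the expansion every monomial in a, b, c is at least a * b * c, because the factors
  lie in [0, 1]. Apart from the constant term l ^ 3 the coefficients add up to 1 - l ^ 3.\<close>

lemma mix_one_product:
  fixes a b c l :: real
  assumes l: "0 \<le> l" "l \<le> 1" and abc: "0 \<le> a" "a \<le> 1" "0 \<le> b" "b \<le> 1" "0 \<le> c" "c \<le> 1"
  shows "(1 - l ^ 3) * (a * b * c) + l ^ 3 \<le> ((1 - l) * a + l) * ((1 - l) * b + l) * ((1 - l) * c + l)"
proof -
  let ?x = "a * b * c"
  have le: "x * y \<le> x" if "0 \<le> x" "y \<le> 1" for x y :: real using mult_left_mono[of y 1 x] that by simp
  have 1: "?x \<le> a * b" "?x \<le> b * c" "?x \<le> a * c"
    using le[of "a * b" c] le[of "b * c" a] le[of "a * c" b] abc by (simp_all add: mult_ac)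
  have 2: "?x \<le> a" "?x \<le> b" "?x \<le> c"
    using 1 le[of a b] le[of b c] le[of c a] abc by (simp_all add: mult_ac)
  have "(1 - l)\<^sup>2 * l * (3 * ?x) \<le> (1 - l)\<^sup>2 * l * (a * b + b * c + a * c)"
    using 1 l by (intro mult_left_mono) auto
  moreover have "(1 - l) * l\<^sup>2 * (3 * ?x) \<le> (1 - l) * l\<^sup>2 * (a + b + c)"
    using 2 l by (intro mult_left_mono) auto
  moreover have "((1 - l) * a + l) * ((1 - l) * b + l) * ((1 - l) * c + l)
      = (1 - l) ^ 3 * ?x + (1 - l)\<^sup>2 * l * (a * b + b * c + a * c) + (1 - l) * l\<^sup>2 * (a + b + c) + l ^ 3"
    by (simp add: power2_eq_square power3_eq_cube algebra_simps)
  moreover have "(1 - l ^ 3) * ?x = (1 - l) ^ 3 * ?x + (1 - l)\<^sup>2 * l * (3 * ?x) + (1 - l) * l\<^sup>2 * (3 * ?x)"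
    by (simp add: power2_eq_square power3_eq_cube algebra_simps)
  ultimately show ?thesis by linarith
qed

text \<open>For step graphons the pointwise inequality is summed over triples of indices. Grid
  averages and the Lipschitz bound transfer it to f, as mixing does not increase the cut
  distance.\<close>

lemma triangle_density_mix_one:
  assumes f: "f \<in> graphons" and l: "0 \<le> l" "l \<le> 1"
  shows "(1 - l ^ 3) * triangle_density f + l ^ 3 / 6 \<le> triangle_density (mix_one l f)"
proof -
  have l3: "0 \<le> 1 - l ^ 3" "1 - l ^ 3 \<le> 1" using l by (simp_all add: power_le_one)
  have step: "(1 - l ^ 3) * triangle_density (grid_avg n f) + l ^ 3 / 6 \<le> triangle_density (mix_one l (grid_avg n f))"
    if n: "0 < n" for n
  proof -
    let ?a = "cell_avg n f"
    note ab = cell_avg_bounds[OF f n]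
    have "(1 - l ^ 3) * (\<Sum>i=1..n. \<Sum>j=1..n. \<Sum>k=1..n. ?a i j * ?a j k * ?a k i) + l ^ 3 * real n ^ 3
        = (\<Sum>i=1..n. \<Sum>j=1..n. \<Sum>k=1..n. (1 - l ^ 3) * (?a i j * ?a j k * ?a k i) + l ^ 3)"
      by (simp add: sum.distrib sum_distrib_left power3_eq_cube)
    also have "\<dots> \<le> (\<Sum>i=1..n. \<Sum>j=1..n. \<Sum>k=1..n. ((1 - l) * ?a i j + l) * ((1 - l) * ?a j k + l) * ((1 - l) * ?a k i + l))"
      by (intro sum_mono mix_one_product l ab)
    finally have le: "(1 - l ^ 3) * (\<Sum>i=1..n. \<Sum>j=1..n. \<Sum>k=1..n. ?a i j * ?a j k * ?a k i) + l ^ 3 * real n ^ 3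
        \<le> (\<Sum>i=1..n. \<Sum>j=1..n. \<Sum>k=1..n. ((1 - l) * ?a i j + l) * ((1 - l) * ?a j k + l) * ((1 - l) * ?a k i + l))" .
    have "(1 - l ^ 3) * triangle_density (grid_avg n f) + l ^ 3 / 6
        = ((1 - l ^ 3) * (\<Sum>i=1..n. \<Sum>j=1..n. \<Sum>k=1..n. ?a i j * ?a j k * ?a k i) + l ^ 3 * real n ^ 3) / (6 * real n ^ 3)"
      unfolding grid_avg_def triangle_density_step[OF n] using n by (simp add: add_divide_distrib)
    also have "\<dots> \<le> triangle_density (mix_one l (grid_avg n f))"
      unfolding grid_avg_def mix_one_step triangle_density_step[OF n]
      by (rule divide_right_mono[OF le]) simp
    finally show ?thesis .
  qed
  have "(1 - l ^ 3) * triangle_density f + l ^ 3 / 6 - triangle_density (mix_one l f) \<le> cut_dist f (grid_avg n f)"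
    if n: "0 < n" for n
  proof -
    note g = grid_avg_in[OF f n]
    let ?c = "cut_dist f (grid_avg n f)"
    have c0: "0 \<le> ?c" by (rule cut_dist_nonneg[OF f g])
    have "triangle_density f \<le> triangle_density (grid_avg n f) + ?c / 2"
      using triangle_density_lipschitz[OF f g] by linarith
    then have "(1 - l ^ 3) * triangle_density f \<le> (1 - l ^ 3) * (triangle_density (grid_avg n f) + ?c / 2)"
      using l3 by (intro mult_left_mono)
    also have "\<dots> = (1 - l ^ 3) * triangle_density (grid_avg n f) + (1 - l ^ 3) * (?c / 2)" by (rule distrib_left)
    also have "(1 - l ^ 3) * (?c / 2) \<le> 1 * (?c / 2)" using l3 c0 by (intro mult_right_mono) auto
    finally have "(1 - l ^ 3) * triangle_density f \<le> (1 - l ^ 3) * triangle_density (grid_avg n f) + 1 * (?c / 2)" by simp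
    moreover have "triangle_density (mix_one l (grid_avg n f)) - triangle_density (mix_one l f) \<le> ?c / 2"
      using triangle_density_lipschitz[OF mix_one_in[OF f l] mix_one_in[OF g l]] cut_dist_mix_one[OF f g l] by linarith
    ultimately show ?thesis using step[OF n] by linarith
  qed
  then have "(1 - l ^ 3) * triangle_density f + l ^ 3 / 6 - triangle_density (mix_one l f) \<le> 0"
    by (intro LIMSEQ_le_const[OF grid_avg_cut_dist[OF f]]) (auto intro!: exI[of _ 1])
  then show ?thesis by simp
qed

text \<open>Convexity, read off from the tangent at the mixture itself, which is affine and lies
  below \<open>rate p\<close>. A mixture equal to 0 or 1 has no such tangent, but then l = 0, l = 1
  or u = 1.\<close>

lemma rate_mix_one:
  assumes p: "0 < p" "p < 1" and l: "0 \<le> l" "l \<le> 1" and u: "0 \<le> u" "u \<le> 1"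
  shows "rate p ((1 - l) * u + l) \<le> (1 - l) * rate p u + l * rate p 1"
proof -
  let ?w = "(1 - l) * u + l"
  note w01 = mix_one_unit[OF l u]
  consider "?w = 0" | "?w = 1" | "0 < ?w" "?w < 1" using w01 by linarith
  then show ?thesis
  proof cases
    case 1
    have "0 \<le> (1 - l) * u" using l u by simp
    then have "l = 0" using 1 l by linarith
    then show ?thesis by simp
  next
    case 2
    then have "(1 - l) * (1 - u) = 0" by (simp add: algebra_simps)
    then have "l = 1 \<or> u = 1" by auto
    then show ?thesis by (auto simp: algebra_simps)
  next
    case 3
    have "rate ?w ?w = 0" using 3 by (simp add: rate_def)
    then have "rate p ?w = rate_line p ?w ?w" using rate_shift[OF 3 p, of ?w] w01 by simp
    also have "\<dots> = (1 - l) * rate_line p ?w u + l * rate_line p ?w 1"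
      unfolding rate_line_def by (simp add: field_simps)
    also have "\<dots> \<le> (1 - l) * rate p u + l * rate p 1"
      using rate_shift[OF 3 p u] rate_nonneg[OF 3 u] rate_shift[OF 3 p, of 1] rate_nonneg[OF 3, of 1] l
      by (intro add_mono mult_left_mono) auto
    finally show ?thesis .
  qed
qed

lemma graphon_rate_mix_one:
  assumes p: "0 < p" "p < 1" and f: "f \<in> graphons" and l: "0 \<le> l" "l \<le> 1"
  shows "graphon_rate p (mix_one l f) \<le> graphon_rate p f + l * rate p 1"
proof -
  have r1: "0 \<le> rate p 1" by (rule rate_nonneg) (use p in auto)
  note i = graphon_rate_square[OF p f]
  have "graphon_rate p (mix_one l f) = (LINT z|square_measure. rate p (mix_one l f z))"
    by (rule graphon_rate_square(2)[OF p mix_one_in[OF f l]])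
  also have "\<dots> \<le> (LINT z|square_measure. rate p (f z) + l * rate p 1)"
  proof (rule integral_mono)
    show "integrable square_measure (\<lambda>z. rate p (mix_one l f z))"
      by (rule graphon_rate_square(1)[OF p mix_one_in[OF f l]])
    show "integrable square_measure (\<lambda>z. rate p (f z) + l * rate p 1)" using i(1) by simp
    fix z assume z: "z \<in> space square_measure"
    have u: "0 \<le> f z" "f z \<le> 1" using graphon_in_unit[OF f z] by auto
    have "rate p (mix_one l f z) \<le> (1 - l) * rate p (f z) + l * rate p 1"
      using rate_mix_one[OF p l u] z by (simp add: mix_one_def space_square)
    also have "(1 - l) * rate p (f z) \<le> 1 * rate p (f z)"
      using l rate_nonneg[OF p u] by (intro mult_right_mono) auto
    finally show "rate p (mix_one l f z) \<le> rate p (f z) + l * rate p 1" by simp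
  qed
  also have "\<dots> = graphon_rate p f + l * rate p 1"
    using i square_measure.P.prob_space by simp
  finally show ?thesis .
qed

section \<open>The value of the variational problem and its continuity\<close>

lemma phi_real:
  assumes p: "0 < p" "p < 1" and t: "t < 1 / 6"
  obtains \<phi> where "phi p t = ereal \<phi>"
    "\<forall>f\<in>graphons. t \<le> triangle_density f \<longrightarrow> \<phi> \<le> graphon_rate p f"
    "\<forall>\<delta>>0. \<exists>f\<in>graphons. t \<le> triangle_density f \<and> graphon_rate p f < \<phi> + \<delta>"
proof -
  let ?S = "{f \<in> graphons. triangle_density f \<ge> t}"
  have P: "phi p t = (INF f\<in>?S. ereal (graphon_rate p f))" using t by (simp add: phi_def)
  \<comment> \<open>The constant graphon 1 has triangle density 1/6 > t; it makes the infimum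
    finite.\<close>
  have one: "step_graphon 1 (\<lambda>_ _. 1) \<in> ?S"
    using t by (auto simp: triangle_density_step intro!: step_graphon_in)
  have "0 \<le> phi p t" unfolding P by (intro INF_greatest) (auto intro: graphon_rate_nonneg[OF p])
  moreover have "phi p t \<le> ereal (graphon_rate p (step_graphon 1 (\<lambda>_ _. 1)))"
    unfolding P by (rule INF_lower[OF one])
  ultimately obtain \<phi> where \<phi>: "phi p t = ereal \<phi>" by (cases "phi p t") auto
  show ?thesis
  proof (rule that[OF \<phi>])
    have "\<phi> \<le> graphon_rate p f" if "f \<in> graphons" "t \<le> triangle_density f" for f
    proof -
      have "phi p t \<le> ereal (graphon_rate p f)" unfolding P using that by (intro INF_lower) simp
      then show ?thesis by (simp add: \<phi>)
    qed
    then show "\<forall>f\<in>graphons. t \<le> triangle_density f \<longrightarrow> \<phi> \<le> graphon_rate p f" by blast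
    have "\<exists>f\<in>graphons. t \<le> triangle_density f \<and> graphon_rate p f < \<phi> + \<delta>" if "0 < \<delta>" for \<delta>
    proof -
      have "phi p t < ereal (\<phi> + \<delta>)" using that by (simp add: \<phi>)
      then show ?thesis unfolding P INF_less_iff by auto
    qed
    then show "\<forall>\<delta>>0. \<exists>f\<in>graphons. t \<le> triangle_density f \<and> graphon_rate p f < \<phi> + \<delta>" by blast
  qed
qed

text \<open>Mixing with the constant graphon \<open>1\<close> raises the triangle density at a small cost in the rate,
  which makes \<^const>\<open>phi\<close> continuous below \<open>1/6\<close>.\<close>

lemma variational_continuity:
  assumes p: "0 < p" "p < 1" and t: "t < 1 / 6"
    and \<phi>: "\<forall>f\<in>graphons. t \<le> triangle_density f \<longrightarrow> \<phi> \<le> graphon_rate p f"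
      "\<forall>\<delta>>0. \<exists>f\<in>graphons. t \<le> triangle_density f \<and> graphon_rate p f < \<phi> + \<delta>"
    and \<delta>: "0 < \<delta>"
  shows "\<exists>\<eta>>0. \<forall>h\<in>graphons. t - \<eta> \<le> triangle_density h \<longrightarrow> \<phi> - \<delta> \<le> graphon_rate p h"
    "\<exists>f\<in>graphons. t < triangle_density f \<and> graphon_rate p f < \<phi> + \<delta>"
proof -
  have r1: "0 \<le> rate p 1" by (rule rate_nonneg) (use p in auto)
  \<comment> \<open>Makes the cost l * rate p 1 of mixing at most \<delta> / 2; the added 1 keeps
    the denominator positive when only 0 \<le> rate p 1 is known.\<close>
  define l where "l = min 1 (\<delta> / (2 * (rate p 1 + 1)))"
  have l: "0 < l" "0 \<le> l" "l \<le> 1" using \<delta> r1 by (auto simp: l_def)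
  have "l * rate p 1 \<le> \<delta> / (2 * (rate p 1 + 1)) * rate p 1" using r1 by (intro mult_right_mono) (auto simp: l_def)
  also have "\<dots> \<le> \<delta> / 2" using r1 \<delta> by (simp add: field_simps)
  finally have lr: "l * rate p 1 \<le> \<delta> / 2" .
  have l3: "0 < l ^ 3" "l ^ 3 \<le> 1" using l by (simp_all add: power_le_one)
  \<comment> \<open>The triangle density gained for certain when a graphon of density t is mixed
    with weight l.\<close>
  define \<eta> where "\<eta> = l ^ 3 * (1 / 6 - t)"
  have \<eta>: "0 < \<eta>" using l3 t by (simp add: \<eta>_def)
  have up: "(1 - l ^ 3) * s + l ^ 3 / 6 \<le> triangle_density (mix_one l h)"
    if "h \<in> graphons" "s \<le> triangle_density h" for h s
  proof -
    have "(1 - l ^ 3) * s \<le> (1 - l ^ 3) * triangle_density h" using that l3 by (intro mult_left_mono) auto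
    then show ?thesis using triangle_density_mix_one[OF that(1) l(2,3)] by linarith
  qed
  show "\<exists>\<eta>>0. \<forall>h\<in>graphons. t - \<eta> \<le> triangle_density h \<longrightarrow> \<phi> - \<delta> \<le> graphon_rate p h"
  proof (intro exI[of _ \<eta>] conjI ballI impI \<eta>)
    fix h assume h: "h \<in> graphons" "t - \<eta> \<le> triangle_density h"
    \<comment> \<open>With c = l ^ 3: a deficit of \<eta> is more than repaired, since the mixture
      arrives at t + c * \<eta>.\<close>
    have "(1 - c) * (t - c * (1 / 6 - t)) + c / 6 = t + c * (c * (1 / 6 - t))" for c by (simp add: field_simps)
    then have "(1 - l ^ 3) * (t - \<eta>) + l ^ 3 / 6 = t + l ^ 3 * \<eta>" by (simp only: \<eta>_def)
    moreover have "0 \<le> l ^ 3 * \<eta>" using l3 \<eta> by simp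
    ultimately have "t \<le> triangle_density (mix_one l h)" using up[OF h] by linarith
    then have "\<phi> \<le> graphon_rate p (mix_one l h)" using \<phi>(1) mix_one_in[OF h(1) l(2,3)] by blast
    then show "\<phi> - \<delta> \<le> graphon_rate p h"
      using graphon_rate_mix_one[OF p h(1) l(2,3)] lr \<delta> by linarith
  qed
  have "0 < \<delta> / 2" using \<delta> by simp
  with \<phi>(2) obtain h where h: "h \<in> graphons" "t \<le> triangle_density h" "graphon_rate p h < \<phi> + \<delta> / 2" by blast
  show "\<exists>f\<in>graphons. t < triangle_density f \<and> graphon_rate p f < \<phi> + \<delta>"
  proof (intro bexI[of _ "mix_one l h"] conjI)
    have "(1 - l ^ 3) * t + l ^ 3 / 6 = t + \<eta>" by (simp add: \<eta>_def algebra_simps)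
    then show "t < triangle_density (mix_one l h)" using up[OF h(1,2)] \<eta> by linarith
    show "graphon_rate p (mix_one l h) < \<phi> + \<delta>"
      using graphon_rate_mix_one[OF p h(1) l(2,3)] lr h(3) by linarith
    show "mix_one l h \<in> graphons" by (rule mix_one_in[OF h(1) l(2,3)])
  qed
qed

section \<open>Invariance under relabelling\<close>

lemma integral_mp_bijection:
  fixes g :: "real \<Rightarrow> real"
  assumes "\<sigma> \<in> mp_bijections" "g \<in> borel_measurable unit_measure"
  shows "(LINT x|unit_measure. g (\<sigma> x)) = (LINT x|unit_measure. g x)"
proof -
  have "\<sigma> \<in> measurable unit_measure unit_measure" "distr unit_measure unit_measure \<sigma> = unit_measure"
    using assms(1) by (auto simp: mp_bijections_def)
  then show ?thesis using integral_distr[of \<sigma> unit_measure unit_measure g] assms(2) by simp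
qed

lemma triangle_density_relabel:
  assumes s: "\<sigma> \<in> mp_bijections" and f: "f \<in> graphons"
  shows "triangle_density (relabel \<sigma> f) = triangle_density f"
proof -
  note [measurable] = graphonD(1)[OF f]
  let ?F = "\<lambda>x y z. f (x, y) * f (y, z) * f (z, x)"
  have "(LINT x|unit_measure. LINT y|unit_measure. LINT z|unit_measure. relabel \<sigma> f (x, y) * relabel \<sigma> f (y, z) * relabel \<sigma> f (z, x))
      = (LINT x|unit_measure. LINT y|unit_measure. LINT z|unit_measure. ?F (\<sigma> x) (\<sigma> y) (\<sigma> z))"
    by (intro Bochner_Integration.integral_cong refl) (simp add: relabel_def)
  also have "\<dots> = (LINT x|unit_measure. LINT y|unit_measure. LINT z|unit_measure. ?F (\<sigma> x) (\<sigma> y) z)"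
  proof (rule Bochner_Integration.integral_cong[OF refl], rule Bochner_Integration.integral_cong[OF refl])
    fix x y assume "x \<in> space unit_measure" "y \<in> space unit_measure"
    then have [measurable]: "\<sigma> x \<in> space unit_measure" "\<sigma> y \<in> space unit_measure"
      using mp_in[OF s] by (simp_all del: atLeastAtMost_iff)
    show "(LINT z|unit_measure. ?F (\<sigma> x) (\<sigma> y) (\<sigma> z)) = (LINT z|unit_measure. ?F (\<sigma> x) (\<sigma> y) z)"
      by (rule integral_mp_bijection[OF s]) measurable
  qed
  also have "\<dots> = (LINT x|unit_measure. LINT y|unit_measure. LINT z|unit_measure. ?F (\<sigma> x) y z)"
  proof (rule Bochner_Integration.integral_cong[OF refl])
    fix x assume "x \<in> space unit_measure"
    then have [measurable]: "\<sigma> x \<in> space unit_measure"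
      using mp_in[OF s] by (simp_all del: atLeastAtMost_iff)
    show "(LINT y|unit_measure. LINT z|unit_measure. ?F (\<sigma> x) (\<sigma> y) z) = (LINT y|unit_measure. LINT z|unit_measure. ?F (\<sigma> x) y z)"
      by (rule integral_mp_bijection[OF s]) measurable
  qed
  also have "\<dots> = (LINT x|unit_measure. LINT y|unit_measure. LINT z|unit_measure. ?F x y z)"
    by (rule integral_mp_bijection[OF s]) measurable
  finally show ?thesis by (simp add: triangle_density_def)
qed

lemma graphon_rate_relabel:
  assumes p: "0 < p" "p < 1" and s: "\<sigma> \<in> mp_bijections" and f: "f \<in> graphons"
  shows "graphon_rate p (relabel \<sigma> f) = graphon_rate p f"
proof -
  note [measurable] = graphonD(1)[OF f]
  have m: "(\<lambda>z. rate p (f z)) \<in> borel_measurable square_measure" by measurable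
  have "graphon_rate p (relabel \<sigma> f) = (LINT z|square_measure. rate p (relabel \<sigma> f z))"
    by (rule graphon_rate_square(2)[OF p relabel_graphon[OF s f]])
  also have "\<dots> = (LINT z|square_measure. rate p (f (case z of (x, y) \<Rightarrow> (\<sigma> x, \<sigma> y))))"
    by (rule Bochner_Integration.integral_cong[OF refl]) (auto simp: relabel_def space_square)
  also have "\<dots> = (LINT z|distr square_measure square_measure (\<lambda>(x, y). (\<sigma> x, \<sigma> y)). rate p (f z))"
    by (rule integral_distr[symmetric, OF measurable_mp_pair[OF s] m])
  also have "\<dots> = graphon_rate p f"
    unfolding distr_mp_pair[OF s] by (rule graphon_rate_square(2)[OF p f, symmetric])
  finally show ?thesis .
qed

section \<open>Minimizers\<close>

text \<open>The slack \<open>\<eta> k\<close> in both constraint and rate lets one argument serve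
  the existence of minimizers, their compactness (slack 0) and the gap below. Along relabelled terms
  converging in the cut distance, the triangle density is continuous and the rate lower
  semicontinuous.\<close>

lemma minimizing_sequence:
  assumes p: "0 < p" "p < 1" and \<phi>: "phi p t = ereal \<phi>"
    "\<forall>f\<in>graphons. t \<le> triangle_density f \<longrightarrow> \<phi> \<le> graphon_rate p f"
    and h: "\<And>k. h k \<in> graphons" "\<And>k. t - \<eta> k \<le> triangle_density (h k)" "\<And>k. graphon_rate p (h k) \<le> \<phi> + \<eta> k"
    and \<eta>: "\<eta> \<longlonglongrightarrow> 0"
  obtains r f where "strict_mono (r :: nat \<Rightarrow> nat)" "f \<in> minimizers p t" "(\<lambda>k. orbit_dist (h (r k)) f) \<longlonglongrightarrow> 0"
proof -
  obtain r f where r: "strict_mono (r :: nat \<Rightarrow> nat)" and f: "f \<in> graphons"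
    and lim: "(\<lambda>k. orbit_dist (h (r k)) f) \<longlonglongrightarrow> 0"
    by (rule graphons_seq_compact[OF h(1)]) (rule that)
  have "\<exists>\<tau>\<in>mp_bijections. cut_dist f (relabel \<tau> (h (r k))) < orbit_dist (h (r k)) f + 1 / real (Suc k)" for k
  proof -
    have "orbit_dist f (h (r k)) < orbit_dist (h (r k)) f + 1 / real (Suc k)"
      using orbit_dist_sym[OF f h(1)] by simp
    then show ?thesis unfolding orbit_dist_less_iff[OF f h(1)] .
  qed
  then obtain \<tau> where \<tau>: "\<And>k. \<tau> k \<in> mp_bijections"
    "\<And>k. cut_dist f (relabel (\<tau> k) (h (r k))) < orbit_dist (h (r k)) f + 1 / real (Suc k)" by metis
  define g where "g k = relabel (\<tau> k) (h (r k))" for k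
  have g: "g k \<in> graphons" for k unfolding g_def by (rule relabel_graphon[OF \<tau>(1) h(1)])
  have cut: "(\<lambda>k. cut_dist (g k) f) \<longlonglongrightarrow> 0"
  proof (rule tendsto_sandwich[OF _ _ tendsto_const])
    show "\<forall>\<^sub>F k in sequentially. 0 \<le> cut_dist (g k) f" by (intro always_eventually allI cut_dist_nonneg g f)
    show "\<forall>\<^sub>F k in sequentially. cut_dist (g k) f \<le> orbit_dist (h (r k)) f + 1 / real (Suc k)"
      using \<tau>(2) by (intro always_eventually allI) (simp add: g_def cut_dist_sym less_imp_le)
    show "(\<lambda>k. orbit_dist (h (r k)) f + 1 / real (Suc k)) \<longlonglongrightarrow> 0"
      using tendsto_add[OF lim LIMSEQ_Suc[OF lim_1_over_n]] by simp
  qed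
  have \<eta>r: "(\<lambda>k. \<eta> (r k)) \<longlonglongrightarrow> 0" using LIMSEQ_subseq_LIMSEQ[OF \<eta> r] by (simp add: comp_def)
  have "t \<le> triangle_density f"
  proof -
    have "t \<le> triangle_density f + (cut_dist (g k) f / 2 + \<eta> (r k))" for k
      using triangle_density_lipschitz[OF g f, of k] h(2)[of "r k"] triangle_density_relabel[OF \<tau>(1) h(1), of k "r k"]
      unfolding g_def by linarith
    moreover have "(\<lambda>k. triangle_density f + (cut_dist (g k) f / 2 + \<eta> (r k))) \<longlonglongrightarrow> triangle_density f + (0 / 2 + 0)"
      by (intro tendsto_intros cut \<eta>r) simp
    ultimately show ?thesis by (intro LIMSEQ_le_const) auto
  qed
  moreover have "graphon_rate p f \<le> \<phi> + 0"
  proof (rule graphon_rate_lsc[OF p f g cut])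
    show "graphon_rate p (g k) \<le> \<phi> + \<eta> (r k)" for k
      using h(3)[of "r k"] graphon_rate_relabel[OF p \<tau>(1) h(1), of k "r k"] by (simp add: g_def)
    show "(\<lambda>k. \<phi> + \<eta> (r k)) \<longlonglongrightarrow> \<phi> + 0" by (intro tendsto_intros \<eta>r)
  qed
  ultimately have "f \<in> minimizers p t" using \<phi>(2) f by (force simp: minimizers_def \<phi>(1))
  with r show ?thesis using lim by (rule that)
qed

lemma minimizers_nonempty:
  assumes p: "0 < p" "p < 1" and \<phi>: "phi p t = ereal \<phi>"
    "\<forall>f\<in>graphons. t \<le> triangle_density f \<longrightarrow> \<phi> \<le> graphon_rate p f"
    "\<forall>\<delta>>0. \<exists>f\<in>graphons. t \<le> triangle_density f \<and> graphon_rate p f < \<phi> + \<delta>"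
  shows "minimizers p t \<noteq> {}"
proof -
  have "\<exists>f\<in>graphons. t \<le> triangle_density f \<and> graphon_rate p f < \<phi> + 1 / real (Suc k)" for k
    using \<phi>(3) by simp
  then obtain h where h: "\<And>k. h k \<in> graphons" "\<And>k. t \<le> triangle_density (h k)"
    "\<And>k. graphon_rate p (h k) < \<phi> + 1 / real (Suc k)" by metis
  have 1: "t - 1 / real (Suc k) \<le> triangle_density (h k)" for k
  proof -
    have "0 \<le> 1 / real (Suc k)" by simp
    then show ?thesis using h(2)[of k] by linarith
  qed
  show ?thesis
    by (rule minimizing_sequence[OF p \<phi>(1,2) h(1) 1 less_imp_le[OF h(3)] LIMSEQ_Suc[OF lim_1_over_n]]) auto
qed

lemma compactin_minimizer_classes:
  assumes p: "0 < p" "p < 1" and \<phi>: "phi p t = ereal \<phi>"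
    "\<forall>f\<in>graphons. t \<le> triangle_density f \<longrightarrow> \<phi> \<le> graphon_rate p f"
  shows "compactin cut_space.mtopology (minimizer_classes p t)"
  unfolding cut_space.compactin_sequentially
proof (intro conjI allI impI)
  show sub: "minimizer_classes p t \<subseteq> graphon_quotient"
    by (auto simp: minimizer_classes_def minimizers_def graphon_quotient_def)
  fix \<sigma> :: "nat \<Rightarrow> (real \<times> real \<Rightarrow> real) set" assume "range \<sigma> \<subseteq> minimizer_classes p t"
  then have "\<forall>k. \<exists>h\<in>minimizers p t. \<sigma> k = graphon_class h" by (auto simp: minimizer_classes_def)
  then obtain h where h: "\<And>k. h k \<in> minimizers p t" "\<And>k. \<sigma> k = graphon_class (h k)" by metis
  have hg: "h k \<in> graphons" "t - 0 \<le> triangle_density (h k)" "graphon_rate p (h k) \<le> \<phi> + 0" for k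
    using h(1)[of k] by (auto simp: minimizers_def \<phi>(1))
  obtain r f where r: "strict_mono (r :: nat \<Rightarrow> nat)" and f: "f \<in> minimizers p t"
    and lim: "(\<lambda>k. orbit_dist (h (r k)) f) \<longlonglongrightarrow> 0"
    by (rule minimizing_sequence[OF p \<phi> hg tendsto_const]) (rule that)
  have fg: "f \<in> graphons" using f by (simp add: minimizers_def)
  have "limitin cut_space.mtopology (\<sigma> \<circ> r) (graphon_class f) sequentially"
    unfolding cut_space.limit_metric_sequentially
  proof (intro conjI allI impI)
    show "graphon_class f \<in> graphon_quotient" using fg by (simp add: graphon_quotient_def)
    fix e :: real assume "0 < e"
    then have "\<forall>\<^sub>F k in sequentially. orbit_dist (h (r k)) f < e" using lim by (intro order_tendstoD(2))
    then obtain k0 where "\<And>k. k0 \<le> k \<Longrightarrow> orbit_dist (h (r k)) f < e" by (auto simp: eventually_sequentially)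
    then show "\<exists>N. \<forall>n\<ge>N. (\<sigma> \<circ> r) n \<in> graphon_quotient \<and> cut_metric ((\<sigma> \<circ> r) n) (graphon_class f) < e"
      using hg(1) fg by (auto simp: h(2) cut_metric_orbit_dist graphon_quotient_def)
  qed
  then show "\<exists>l r. l \<in> minimizer_classes p t \<and> strict_mono r \<and> limitin cut_space.mtopology (\<sigma> \<circ> r) l sequentially"
    using r f by (auto simp: minimizer_classes_def)
qed

text \<open>Otherwise the slacks 1 / (k + 1) would give a sequence that stays away from all
  minimizers although a subsequence converges to one. The weakened constraint leaves room for
  replacing a graph by a nearby step graphon.\<close>

lemma minimizer_gap:
  assumes p: "0 < p" "p < 1" and \<phi>: "phi p t = ereal \<phi>"
    "\<forall>f\<in>graphons. t \<le> triangle_density f \<longrightarrow> \<phi> \<le> graphon_rate p f"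
    and e: "0 < e"
  shows "\<exists>\<eta>>0. \<forall>h\<in>graphons. t - \<eta> \<le> triangle_density h \<longrightarrow>
    (\<forall>g\<in>minimizers p t. e \<le> orbit_dist h g) \<longrightarrow> \<phi> + \<eta> \<le> graphon_rate p h"
proof (rule ccontr)
    assume neg: "\<not> ?thesis"
    have "\<exists>h\<in>graphons. t - 1 / real (Suc k) \<le> triangle_density h \<and> (\<forall>g\<in>minimizers p t. e \<le> orbit_dist h g)
        \<and> graphon_rate p h \<le> \<phi> + 1 / real (Suc k)" for k
    proof -
      have "0 < 1 / real (Suc k)" by simp
      with neg obtain h where "h \<in> graphons" "t - 1 / real (Suc k) \<le> triangle_density h"
        "\<forall>g\<in>minimizers p t. e \<le> orbit_dist h g" "\<not> \<phi> + 1 / real (Suc k) \<le> graphon_rate p h" by blast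
      then show ?thesis by (intro bexI[of _ h]) auto
    qed
    then obtain h where h: "\<And>k. h k \<in> graphons" "\<And>k. t - 1 / real (Suc k) \<le> triangle_density (h k)"
      "\<And>k g. g \<in> minimizers p t \<Longrightarrow> e \<le> orbit_dist (h k) g" "\<And>k. graphon_rate p (h k) \<le> \<phi> + 1 / real (Suc k)" by metis
    obtain r f where f: "f \<in> minimizers p t" and lim: "(\<lambda>k. orbit_dist (h (r k)) f) \<longlonglongrightarrow> 0"
      by (rule minimizing_sequence[OF p \<phi> h(1,2,4) LIMSEQ_Suc[OF lim_1_over_n]]) (rule that)
    have "e \<le> 0" using h(3)[OF f] by (intro LIMSEQ_le_const[OF lim]) auto
    then show False using e by simp
qed

text \<open>The triple (1, 1, 1) spans no edge. The resulting strict inequality settles the boundary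
  case t = 1/6.\<close>

lemma triangles_less:
  assumes n: "0 < n" and G: "G \<subseteq> vertex_pairs n"
  shows "real (triangles n G) < real n ^ 3 / 6"
proof -
  let ?I = "{1..n}"
  have "6 * real (triangles n G)
      = (\<Sum>(i, j, k)\<in>?I \<times> ?I \<times> ?I. of_bool ({i, j} \<in> G) * of_bool ({j, k} \<in> G) * of_bool ({k, i} \<in> G))"
    unfolding triangles_hom_count[OF G, symmetric]
    by (simp only: sum.cartesian_product case_prod_beta fst_conv snd_conv)
  also have "\<dots> < (\<Sum>z\<in>?I \<times> ?I \<times> ?I. 1)"
  proof (rule sum_strict_mono_ex1)
    have "{1, 1} \<notin> G" using G by (auto simp: vertex_pairs_def)
    then show "\<exists>z\<in>?I \<times> ?I \<times> ?I. (case z of (i, j, k) \<Rightarrow> of_bool ({i, j} \<in> G) * of_bool ({j, k} \<in> G) * of_bool ({k, i} \<in> G)) < (1::real)"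
      using n by (intro bexI[of _ "(1, 1, 1)"]) auto
  qed (auto simp: of_bool_def)
  also have "\<dots> = real n ^ 3" by (simp add: card_cartesian_product power3_eq_cube)
  finally show ?thesis by simp
qed

section \<open>Tail asymptotics and conditioning\<close>

theorem triangle_tail_limit:
  assumes p: "0 < p" "p < 1"
  shows "(\<lambda>n. ereal (1 / (real n)\<^sup>2) *
      log_ereal (\<P>(G in erdos_renyi n p. real (triangles n G) \<ge> t * real n ^ 3))) \<longlonglongrightarrow> - phi p t"
proof (cases "t < 1 / 6")
  case False
  have "ereal (1 / (real n)\<^sup>2) * log_ereal (\<P>(G in erdos_renyi n p. real (triangles n G) \<ge> t * real n ^ 3)) = - \<infinity>"
    if n: "0 < n" for n
  proof -
    have "1 / 6 * real n ^ 3 \<le> t * real n ^ 3" using False by (intro mult_right_mono) auto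
    then have "\<not> t * real n ^ 3 \<le> real (triangles n G)" if "G \<subseteq> vertex_pairs n" for G
      using triangles_less[OF n that] by linarith
    then have "{G \<in> Pow (vertex_pairs n). t * real n ^ 3 \<le> real (triangles n G)} = {}" by auto
    then have "\<P>(G in erdos_renyi n p. real (triangles n G) \<ge> t * real n ^ 3) = 0"
      unfolding prob_erdos_renyi[OF p] by (simp only: sum.empty)
    then show ?thesis using n by (simp add: log_ereal_def)
  qed
  moreover have "phi p t = \<infinity>" using False by (simp add: phi_def)
  ultimately have "\<forall>\<^sub>F n in sequentially. ereal (1 / (real n)\<^sup>2) *
      log_ereal (\<P>(G in erdos_renyi n p. real (triangles n G) \<ge> t * real n ^ 3)) = - phi p t"
    by (intro eventually_mono[OF eventually_gt_at_top[of 0]]) (simp only:)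
  then show ?thesis by (rule tendsto_eventually)
next
  case True
  obtain \<phi> where \<phi>: "phi p t = ereal \<phi>"
    "\<forall>f\<in>graphons. t \<le> triangle_density f \<longrightarrow> \<phi> \<le> graphon_rate p f"
    "\<forall>\<delta>>0. \<exists>f\<in>graphons. t \<le> triangle_density f \<and> graphon_rate p f < \<phi> + \<delta>"
    by (rule phi_real[OF p True]) (rule that)
  note vc = variational_continuity[OF p True \<phi>(2,3)]
  define \<A> where "\<A> n = {G \<in> Pow (vertex_pairs n). t * real n ^ 3 \<le> real (triangles n G)}" for n
  define P where "P n = (\<Sum>G\<in>\<A> n. edge_weight (vertex_pairs n) (\<lambda>_. p) G)" for n
  have prob: "\<P>(G in erdos_renyi n p. real (triangles n G) \<ge> t * real n ^ 3) = P n" for n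
    unfolding prob_erdos_renyi[OF p] P_def \<A>_def ..
  have low: "\<forall>\<^sub>F n in sequentially. 0 < P n \<and> - ((real n)\<^sup>2 * graphon_rate p f + ln 2) \<le> ln (P n) * (1 - 1 / real n)"
    if "f \<in> graphons" "t < triangle_density f" for f
    using graph_probability_lower_bound[OF p that] unfolding P_def \<A>_def .
  obtain f0 where "f0 \<in> graphons" "t < triangle_density f0" using vc(2)[of 1] by auto
  from low[OF this] have pos: "\<forall>\<^sub>F n in sequentially. 0 < P n" by (rule eventually_mono) simp
  have "(\<lambda>n. ln (P n) / (real n)\<^sup>2) \<longlonglongrightarrow> - \<phi>"
  proof (rule order_tendstoI)
    fix a assume "a < - \<phi>"
    define \<delta> where "\<delta> = - \<phi> - a"
    have \<delta>: "0 < \<delta>" using \<open>a < - \<phi>\<close> by (simp add: \<delta>_def)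
    obtain f where f: "f \<in> graphons" "t < triangle_density f" "graphon_rate p f < \<phi> + \<delta>" using vc(2)[OF \<delta>] by blast
    let ?I = "graphon_rate p f"
    \<comment> \<open>The lower bound solved for ln (P n) / n^2; the term ln 2 and the factor 1 -
      1/n disappear in the limit.\<close>
    let ?b = "\<lambda>n. - (?I + ln 2 * (1 / real n) * (1 / real n)) / (1 - 1 / real n)"
    have "?b \<longlonglongrightarrow> - (?I + ln 2 * 0 * 0) / (1 - 0)"
      by (intro tendsto_intros lim_1_over_n) simp
    moreover have "a < - (?I + ln 2 * 0 * 0) / (1 - 0)" using f(3) by (simp add: \<delta>_def)
    ultimately have "\<forall>\<^sub>F n in sequentially. a < ?b n" by (rule order_tendstoD(1))
    then show "\<forall>\<^sub>F n in sequentially. a < ln (P n) / (real n)\<^sup>2"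
      using low[OF f(1,2)] eventually_gt_at_top[of 1]
    proof eventually_elim
      case (elim n)
      have n: "1 < real n" using elim(3) by simp
      then have d: "0 < 1 - 1 / real n" by simp
      have e: "?I + ln 2 * (1 / real n) * (1 / real n) = ((real n)\<^sup>2 * ?I + ln 2) / (real n)\<^sup>2"
        using n by (simp add: power2_eq_square add_divide_distrib)
      have "?b n = - ((real n)\<^sup>2 * ?I + ln 2) / (real n)\<^sup>2 / (1 - 1 / real n)"
        by (simp only: e minus_divide_left)
      also have "\<dots> \<le> (ln (P n) * (1 - 1 / real n)) / (real n)\<^sup>2 / (1 - 1 / real n)"
        using elim(2) d by (intro divide_right_mono) auto
      also have "\<dots> = ln (P n) / (real n)\<^sup>2"
      proof -
        have "1 - 1 / real n \<noteq> 0" using d by (metis less_irrefl)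
        then show ?thesis by (metis nonzero_mult_div_cancel_right times_divide_eq_left)
      qed
      finally show ?case using elim(1) by linarith
    qed
  next
    fix a assume "- \<phi> < a"
    \<comment> \<open>One third of the margin goes to the weakened constraint, one to the counting
      factors, and one keeps the inequality strict.\<close>
    define \<delta> where "\<delta> = (a + \<phi>) / 3"
    have \<delta>: "0 < \<delta>" using \<open>- \<phi> < a\<close> by (simp add: \<delta>_def)
    obtain \<eta> where \<eta>: "0 < \<eta>" "\<And>h. h \<in> graphons \<Longrightarrow> t - \<eta> \<le> triangle_density h \<Longrightarrow> \<phi> - \<delta> \<le> graphon_rate p h"
      using vc(1)[OF \<delta>] by blast
    have "\<forall>\<^sub>F n in sequentially. P n \<le> exp (- ((real n)\<^sup>2 * (\<phi> - \<delta> - \<delta>)))"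
      unfolding P_def
    proof (rule graph_probability_exponential_upper[OF p \<eta>(1) \<delta>])
      show "\<A> n \<subseteq> Pow (vertex_pairs n)" for n by (auto simp: \<A>_def)
      fix n G h assume n: "0 < n" and G: "G \<in> \<A> n" and h: "h \<in> graphons" and c: "cut_dist (graph_graphon n G) h \<le> \<eta>"
      have "t \<le> triangle_density (graph_graphon n G)"
        using G n by (simp add: \<A>_def triangle_density_graph field_simps)
      then show "\<phi> - \<delta> \<le> graphon_rate p h"
        using triangle_density_lipschitz[OF graph_graphon_in h, of n G] c \<eta>(1) by (intro \<eta>(2) h) linarith
    qed
    then show "\<forall>\<^sub>F n in sequentially. ln (P n) / (real n)\<^sup>2 < a"
      using pos eventually_gt_at_top[of 0]
    proof eventually_elim
      case (elim n)
      have "ln (P n) \<le> ln (exp (- ((real n)\<^sup>2 * (\<phi> - \<delta> - \<delta>))))"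
        using elim(1,2) by (subst ln_le_cancel_iff) auto
      then have "ln (P n) \<le> - ((real n)\<^sup>2 * (\<phi> - \<delta> - \<delta>))" by (simp only: ln_exp)
      then have "ln (P n) / (real n)\<^sup>2 \<le> - ((real n)\<^sup>2 * (\<phi> - \<delta> - \<delta>)) / (real n)\<^sup>2" by (rule divide_right_mono) simp
      also have "\<dots> = 2 * \<delta> - \<phi>" using elim(3) by simp
      also have "\<dots> < a" using \<delta> by (simp add: \<delta>_def field_simps)
      finally show ?case .
    qed
  qed
  then have "(\<lambda>n. ereal (ln (P n) / (real n)\<^sup>2)) \<longlonglongrightarrow> ereal (- \<phi>)" by (rule tendsto_ereal)
  moreover have "\<forall>\<^sub>F n in sequentially. ereal (ln (P n) / (real n)\<^sup>2) = ereal (1 / (real n)\<^sup>2) * log_ereal (P n)"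
    using pos by eventually_elim (simp add: log_ereal_def)
  ultimately show ?thesis
    unfolding prob \<phi>(1) uminus_ereal.simps by (rule Lim_transform_eventually)
qed

text \<open>By the gap the bad event has exponent at least \<phi> + 3 \<eta> / 4, while the
  condition has exponent at most \<phi> + \<eta> / 4; the difference is C = \<eta> / 2.\<close>

theorem conditional_concentration:
  assumes p: "0 < p" "p < 1" and t: "t < 1 / 6" and \<epsilon>: "0 < \<epsilon>"
  shows "\<exists>C>0. \<forall>\<^sub>F n in sequentially.
    \<P>(G in erdos_renyi n p. cut_metric_set (graphon_class (graph_graphon n G)) (minimizer_classes p t) \<ge> \<epsilon>
      \<bar> real (triangles n G) \<ge> t * real n ^ 3) \<le> exp (- C * (real n)\<^sup>2)"
proof -
  obtain \<phi> where \<phi>: "phi p t = ereal \<phi>"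
    "\<forall>f\<in>graphons. t \<le> triangle_density f \<longrightarrow> \<phi> \<le> graphon_rate p f"
    "\<forall>\<delta>>0. \<exists>f\<in>graphons. t \<le> triangle_density f \<and> graphon_rate p f < \<phi> + \<delta>"
    by (rule phi_real[OF p t]) (rule that)
  have "0 < \<epsilon> / 2" using \<epsilon> by simp
  from minimizer_gap[OF p \<phi>(1,2) this] obtain \<eta> where \<eta>: "0 < \<eta>"
    "\<forall>h\<in>graphons. t - \<eta> \<le> triangle_density h \<longrightarrow>
      (\<forall>g\<in>minimizers p t. \<epsilon> / 2 \<le> orbit_dist h g) \<longrightarrow> \<phi> + \<eta> \<le> graphon_rate p h" by blast
  define Q where "Q n G \<longleftrightarrow> real (triangles n G) \<ge> t * real n ^ 3" for n G
  define B where "B n G \<longleftrightarrow> cut_metric_set (graphon_class (graph_graphon n G)) (minimizer_classes p t) \<ge> \<epsilon>" for n G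
  \<comment> \<open>At accuracy \<epsilon> / 2 a graphon near a bad graph is still \<epsilon> / 2
    away from every minimizer; at accuracy \<eta> it still meets the constraint with slack
    \<eta>.\<close>
  define e where "e = min (\<epsilon> / 2) \<eta>"
  have e: "0 < e" "e \<le> \<epsilon> / 2" "e \<le> \<eta>" using \<epsilon> \<eta> by (auto simp: e_def)
  have \<eta>4: "0 < \<eta> / 4" using \<eta> by simp
  have up: "\<forall>\<^sub>F n in sequentially. (\<Sum>G\<in>{G \<in> Pow (vertex_pairs n). B n G \<and> Q n G}. edge_weight (vertex_pairs n) (\<lambda>_. p) G)
      \<le> exp (- ((real n)\<^sup>2 * (\<phi> + \<eta> - \<eta> / 4)))"
  proof (rule graph_probability_exponential_upper[OF p e(1) \<eta>4])
    fix n G h assume n: "0 < n" and G: "G \<in> {G \<in> Pow (vertex_pairs n). B n G \<and> Q n G}"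
      and h: "h \<in> graphons" and c: "cut_dist (graph_graphon n G) h \<le> e"
    let ?g = "graph_graphon n G"
    note gg = graph_graphon_in[of n G]
    show "\<phi> + \<eta> \<le> graphon_rate p h"
    proof (rule \<eta>(2)[rule_format, OF h])
      have "t \<le> triangle_density ?g"
        using G n by (simp add: Q_def triangle_density_graph field_simps)
      then show "t - \<eta> \<le> triangle_density h"
        using triangle_density_lipschitz[OF gg h] c e \<eta>(1) by linarith
      fix f assume f: "f \<in> minimizers p t"
      then have fg: "f \<in> graphons" by (simp add: minimizers_def)
      have "cut_metric_set (graphon_class ?g) (minimizer_classes p t) \<le> cut_metric (graphon_class ?g) (graphon_class f)"
        unfolding cut_metric_set_def
      proof (rule cINF_lower)
        show "bdd_below (cut_metric (graphon_class ?g) ` minimizer_classes p t)"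
          by (rule bdd_belowI2[where m = 0]) (rule cut_space.nonneg)
        show "graphon_class f \<in> minimizer_classes p t" using f by (simp add: minimizer_classes_def)
      qed
      then have "\<epsilon> \<le> orbit_dist ?g f" using G by (simp add: B_def cut_metric_orbit_dist[OF gg fg])
      also have "\<dots> \<le> orbit_dist ?g h + orbit_dist h f" by (rule orbit_dist_triangle[OF gg h fg])
      finally show "\<epsilon> / 2 \<le> orbit_dist h f" using orbit_dist_le_cut_dist[OF gg h] c e by linarith
    qed
  qed auto
  \<comment> \<open>The room between \<eta> / 8 and \<eta> / 4 absorbs the factor 1 - 1/n and the
    term ln 2 / n^2.\<close>
  obtain f where f: "f \<in> graphons" "t < triangle_density f" "graphon_rate p f < \<phi> + \<eta> / 8"
    using variational_continuity(2)[OF p t \<phi>(2,3), of "\<eta> / 8"] \<eta>(1) by auto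
  let ?P = "\<lambda>n. \<Sum>G\<in>{G \<in> Pow (vertex_pairs n). t * real n ^ 3 \<le> real (triangles n G)}. edge_weight (vertex_pairs n) (\<lambda>_. p) G"
  have lo: "\<forall>\<^sub>F n in sequentially. exp (- ((real n)\<^sup>2 * (\<phi> + \<eta> / 4))) \<le> ?P n"
  proof -
    let ?I = "graphon_rate p f"
    have I0: "0 \<le> ?I" by (rule graphon_rate_nonneg[OF p f(1)])
    have "(\<lambda>n. (\<phi> + \<eta> / 4) * (1 - 1 / real n) - ln 2 * (1 / real n) * (1 / real n)) \<longlonglongrightarrow> (\<phi> + \<eta> / 4) * (1 - 0) - ln 2 * 0 * 0"
      by (intro tendsto_intros lim_1_over_n)
    moreover have "?I < (\<phi> + \<eta> / 4) * (1 - 0) - ln 2 * 0 * 0" using f(3) \<eta>(1) by simp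
    ultimately have "\<forall>\<^sub>F n in sequentially. ?I < (\<phi> + \<eta> / 4) * (1 - 1 / real n) - ln 2 * (1 / real n) * (1 / real n)"
      by (rule order_tendstoD(1))
    then show ?thesis using graph_probability_lower_bound[OF p f(1,2)] eventually_gt_at_top[of 1]
    proof eventually_elim
      case (elim n)
      have n: "1 < real n" using elim(3) by simp
      define d X where "d = 1 - 1 / real n" and "X = (real n)\<^sup>2 * (\<phi> + \<eta> / 4)"
      have d: "0 < d" using n by (simp add: d_def)
      have "(real n)\<^sup>2 * ?I \<le> (real n)\<^sup>2 * ((\<phi> + \<eta> / 4) * (1 - 1 / real n) - ln 2 * (1 / real n) * (1 / real n))"
        using elim(1) by (intro mult_left_mono) auto
      also have "\<dots> = X * d - ln 2"
        using n by (simp add: right_diff_distrib power2_eq_square X_def d_def)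
      finally have "- X * d \<le> ln (?P n) * d" using elim(2) unfolding d_def[symmetric] by simp
      then have "- X \<le> ln (?P n)" using d by (rule mult_right_le_imp_le)
      then show ?case using elim(2) unfolding X_def by (simp add: ln_ge_iff)
    qed
  qed
  have "\<forall>\<^sub>F n in sequentially. \<P>(G in erdos_renyi n p. B n G \<bar> Q n G) \<le> exp (- (\<eta> / 2) * (real n)\<^sup>2)"
    using up lo
  proof eventually_elim
    case (elim n)
    have "\<P>(G in erdos_renyi n p. B n G \<bar> Q n G)
        = (\<Sum>G\<in>{G \<in> Pow (vertex_pairs n). B n G \<and> Q n G}. edge_weight (vertex_pairs n) (\<lambda>_. p) G) / ?P n"
      unfolding cond_prob_def prob_erdos_renyi[OF p] by (simp add: Q_def)
    also have "\<dots> \<le> exp (- ((real n)\<^sup>2 * (\<phi> + \<eta> - \<eta> / 4))) / exp (- ((real n)\<^sup>2 * (\<phi> + \<eta> / 4)))"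
      by (rule frac_le[OF _ elim(1) _ elim(2)]) auto
    also have "\<dots> = exp (- (\<eta> / 2) * (real n)\<^sup>2)"
      by (simp add: algebra_simps flip: exp_diff)
    finally show ?case .
  qed
  then show ?thesis using \<eta>(1) unfolding B_def Q_def by (intro exI[of _ "\<eta> / 2"]) auto
qed

text \<open>The exponential bound concerns all large n, because a conditional probability at small n
  can be 1: for n = 3 and 0 < t \<le> 1/27 the condition leaves only the complete graph, which may
  be far from every minimizer.\<close>

theorem theorem4p1:
  fixes p :: real
  assumes "0 < p" and "p < 1"
  shows
    "(\<forall>t\<ge>0. (\<lambda>n. ereal (1 / (real n)\<^sup>2) *
          log_ereal (\<P>(G in erdos_renyi n p. real (triangles n G) \<ge> t * real n ^ 3)))
        \<longlonglongrightarrow> - phi p t) \<and>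
     (\<forall>t. p ^ 3 / 6 < t \<and> t < 1 / 6 \<longrightarrow>
        minimizer_classes p t \<noteq> {} \<and>
        compactin (Metric_space.mtopology graphon_quotient cut_metric) (minimizer_classes p t) \<and>
        (\<forall>\<epsilon>>0. \<exists>C>0. \<forall>\<^sub>F n in sequentially.
           \<P>(G in erdos_renyi n p.
               cut_metric_set (graphon_class (graph_graphon n G)) (minimizer_classes p t) \<ge> \<epsilon>
               \<bar> real (triangles n G) \<ge> t * real n ^ 3)
           \<le> exp (- C * (real n)\<^sup>2)))"
proof (intro conjI allI impI)
  show "(\<lambda>n. ereal (1 / (real n)\<^sup>2) *
      log_ereal (\<P>(G in erdos_renyi n p. real (triangles n G) \<ge> t * real n ^ 3))) \<longlonglongrightarrow> - phi p t" for t
    by (rule triangle_tail_limit[OF assms])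
next
  fix t assume "p ^ 3 / 6 < t \<and> t < 1 / 6"
  then have t: "t < 1 / 6" by simp
  obtain \<phi> where \<phi>: "phi p t = ereal \<phi>"
    "\<forall>f\<in>graphons. t \<le> triangle_density f \<longrightarrow> \<phi> \<le> graphon_rate p f"
    "\<forall>\<delta>>0. \<exists>f\<in>graphons. t \<le> triangle_density f \<and> graphon_rate p f < \<phi> + \<delta>"
    by (rule phi_real[OF assms t]) (rule that)
  show "minimizer_classes p t \<noteq> {}"
    using minimizers_nonempty[OF assms \<phi>] by (simp add: minimizer_classes_def)
  show "compactin (Metric_space.mtopology graphon_quotient cut_metric) (minimizer_classes p t)"
    by (rule compactin_minimizer_classes[OF assms \<phi>(1,2)])
  show "\<exists>C>0. \<forall>\<^sub>F n in sequentially.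
      \<P>(G in erdos_renyi n p. cut_metric_set (graphon_class (graph_graphon n G)) (minimizer_classes p t) \<ge> \<epsilon>
        \<bar> real (triangles n G) \<ge> t * real n ^ 3) \<le> exp (- C * (real n)\<^sup>2)" if "0 < \<epsilon>" for \<epsilon>
    by (rule conditional_concentration[OF assms t that])
qed

end
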